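(* Let $n\ge1$, let $Q$ be the equioriented quiver of type $A_n$, and let $T\in\mathbb{Z}^{\overline Q_1}$ be given by $T_a=0$ and $T_{a^*}=-1$ for $a\in Q_1$. The functor $\rho_{F,v}$ induces an equivalence of categories \[\operatorname{Mod}\mathbb{C}\tilde Q_n/J_n\longrightarrow\operatorname{Mod}\mathrm{Idem}^T(\Pi(A_n)).\]
   Context: All modules and representations are finite-dimensional over $\mathbb{C}$; paths are composed right to left. $Q$ has vertices $\{1,\dots,n\}$ and arrows $a_i:i\to i+1$ ($1\le i\le n-1$). The doubled quiver $\overline Q$ has in addition arrows $a_i^*:i+1\to i$. $\Pi(A_n)$ is the preprojective algebra: $\mathbb{C}\overline Q$ modulo the relations, one for each vertex $i$, $a_i^*a_i-a_{i-1}a_{i-1}^*$ (terms with undefined indices omitted). For a quiver $Q'$, an object $N$ of $\operatorname{Mod}\mathrm{Idem}(Q')$ is a representation $R(N)$ of $Q'$ together with linear maps $n_i^x:N_x\to N_x$ ($x\in Q'_0$, $i\in\mathbb{Z}$), for each $x$ only finitely many non-zero, with $n_i^xn_k^x=0$ for $i\ne k$ and $\sum_in_i^x=\mathrm{Id}_{N_x}$; morphisms are families of linear maps commuting with all arrows and idempotents. For $T\in\mathbb{Z}^{Q'_1}$, $\operatorname{Mod}\mathrm{Idem}^T(Q')$ is the full subcategory of $N$ with $n_i^{t(a)}N_an_k^{s(a)}=0$ whenever $a\in Q'_1$, $i-k\neq T_a$. $\operatorname{Mod}\mathrm{Idem}^T(\Pi(A_n))$ is the full subcategory of $\operatorname{Mod}\mathrm{Idem}^T(\overline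 Q)$ of those $N$ for which $R(N)$ satisfies the relations of $\Pi(A_n)$. $\tilde Q_n$ is the quiver with vertices $i_j$ ($1\le i\le n$, $j\in\mathbb{Z}$) and arrows $\alpha_{i,j}:i_j\to(i+1)_j$, $\alpha^*_{i,j}:(i+1)_j\to i_{j-1}$ ($1\le i\le n-1$, $j\in\mathbb{Z}$). $J_n$ is generated by $\alpha^*_{1,j}\alpha_{1,j}$, $\alpha_{n-1,j-1}\alpha^*_{n-1,j}$ and $\alpha^*_{i,j}\alpha_{i,j}-\alpha_{i-1,j-1}\alpha^*_{i-1,j}$ ($2\le i\le n-1$), for all $j\in\mathbb{Z}$. $F:\tilde Q_n\to\overline Q$ is the morphism of quivers $i_j\mapsto i$, $\alpha_{i,j}\mapsto a_i$, $\alpha_{i,j}^*\mapsto a_i^*$, and $v(i_j)=j$. The functor $\rho_{F,v}$ sends a representation $M$ of $\tilde Q_n$ to the object with $\rho_{F,v}(M)_x=\bigoplus_{F(y)=x}M_y$, with $\rho_{F,v}(M)_a$ (for $a\in\overline Q_1$) the map whose components are the $M_b$ with $F(b)=a$, and with the idempotent of index $k$ at $x$ the projection onto the summand $M_y$ with $F(y)=x$, $v(y)=k$. On morphisms, $(f_y)_y$ is sent to $(\bigoplus_{F(y)=x}f_y)_x$. *)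

theory Defs
  imports "Jordan_Normal_Form.VS_Connect" "Graph_Theory.Graph_Theory"
begin

section \<open>Categories and equivalences\<close>

text \<open>
  Hom-sets are indexed by their domain and codomain and need not be disjoint, so identities,
  composition and the action of a functor on arrows take the relevant objects as arguments.
\<close>

record ('o, 'm) category =
  Obj :: "'o set"
  Hom :: "'o \<Rightarrow> 'o \<Rightarrow> 'm set"
  idn :: "'o \<Rightarrow> 'm"
  cmp :: "'o \<Rightarrow> 'o \<Rightarrow> 'o \<Rightarrow> 'm \<Rightarrow> 'm \<Rightarrow> 'm"  \<comment> \<open>\<open>cmp A B D g f\<close> is \<open>g\<close> after \<open>f\<close>, for \<open>f : A \<rightarrow> B\<close>, \<open>g : B \<rightarrow> D\<close>\<close>

locale category =
  fixes C :: "('o, 'm) category"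
  assumes idn_hom: "A \<in> Obj C \<Longrightarrow> idn C A \<in> Hom C A A"
    and cmp_hom: "\<lbrakk>A \<in> Obj C; B \<in> Obj C; D \<in> Obj C; f \<in> Hom C A B; g \<in> Hom C B D\<rbrakk>
      \<Longrightarrow> cmp C A B D g f \<in> Hom C A D"
    and idn_left: "\<lbrakk>A \<in> Obj C; B \<in> Obj C; f \<in> Hom C A B\<rbrakk> \<Longrightarrow> cmp C A B B (idn C B) f = f"
    and idn_right: "\<lbrakk>A \<in> Obj C; B \<in> Obj C; f \<in> Hom C A B\<rbrakk> \<Longrightarrow> cmp C A A B f (idn C A) = f"
    and cmp_assoc: "\<lbrakk>A \<in> Obj C; B \<in> Obj C; D \<in> Obj C; E \<in> Obj C;
        f \<in> Hom C A B; g \<in> Hom C B D; h \<in> Hom C D E\<rbrakk>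
      \<Longrightarrow> cmp C A D E h (cmp C A B D g f) = cmp C A B E (cmp C B D E h g) f"

definition full_subcategory :: "('o, 'm) category \<Rightarrow> ('o \<Rightarrow> bool) \<Rightarrow> ('o, 'm) category" where
  "full_subcategory C P = C\<lparr>Obj := {A \<in> Obj C. P A}\<rparr>"

record ('o, 'm, 'p, 'q) cat_map =
  on_obj :: "'o \<Rightarrow> 'p"
  on_arr :: "'o \<Rightarrow> 'o \<Rightarrow> 'm \<Rightarrow> 'q"

locale cat_functor = source: category C + target: category D
  for C :: "('o, 'm) category" and D :: "('p, 'q) category" +
  fixes F :: "('o, 'm, 'p, 'q) cat_map"
  assumes obj: "A \<in> Obj C \<Longrightarrow> on_obj F A \<in> Obj D"
    and arr: "\<lbrakk>A \<in> Obj C; B \<in> Obj C; f \<in> Hom C A B\<rbrakk>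
      \<Longrightarrow> on_arr F A B f \<in> Hom D (on_obj F A) (on_obj F B)"
    and arr_idn: "A \<in> Obj C \<Longrightarrow> on_arr F A A (idn C A) = idn D (on_obj F A)"
    and arr_cmp: "\<lbrakk>A \<in> Obj C; B \<in> Obj C; E \<in> Obj C; f \<in> Hom C A B; g \<in> Hom C B E\<rbrakk>
      \<Longrightarrow> on_arr F A E (cmp C A B E g f) =
          cmp D (on_obj F A) (on_obj F B) (on_obj F E) (on_arr F B E g) (on_arr F A B f)"

definition id_cat_map :: "('o, 'm, 'o, 'm) cat_map" where
  "id_cat_map = \<lparr>on_obj = (\<lambda>A. A), on_arr = (\<lambda>A B f. f)\<rparr>"

definition comp_cat_map ::
  "('p, 'q, 'r, 's) cat_map \<Rightarrow> ('o, 'm, 'p, 'q) cat_map \<Rightarrow> ('o, 'm, 'r, 's) cat_map" where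
  "comp_cat_map G F =
    \<lparr>on_obj = (\<lambda>A. on_obj G (on_obj F A)),
     on_arr = (\<lambda>A B f. on_arr G (on_obj F A) (on_obj F B) (on_arr F A B f))\<rparr>"

definition cat_iso :: "('o, 'm) category \<Rightarrow> 'o \<Rightarrow> 'o \<Rightarrow> 'm \<Rightarrow> bool" where
  "cat_iso C A B f \<longleftrightarrow> f \<in> Hom C A B \<and>
    (\<exists>g \<in> Hom C B A. cmp C A B A g f = idn C A \<and> cmp C B A B f g = idn C B)"

definition natural_iso :: "('o, 'm) category \<Rightarrow> ('p, 'q) category \<Rightarrow>
    ('o, 'm, 'p, 'q) cat_map \<Rightarrow> ('o, 'm, 'p, 'q) cat_map \<Rightarrow> ('o \<Rightarrow> 'q) \<Rightarrow> bool" where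
  "natural_iso C D F G \<eta> \<longleftrightarrow>
    (\<forall>A \<in> Obj C. cat_iso D (on_obj F A) (on_obj G A) (\<eta> A)) \<and>
    (\<forall>A \<in> Obj C. \<forall>B \<in> Obj C. \<forall>f \<in> Hom C A B.
      cmp D (on_obj F A) (on_obj F B) (on_obj G B) (\<eta> B) (on_arr F A B f) =
      cmp D (on_obj F A) (on_obj G A) (on_obj G B) (on_arr G A B f) (\<eta> A))"

definition cat_equivalence ::
  "('o, 'm) category \<Rightarrow> ('p, 'q) category \<Rightarrow> ('o, 'm, 'p, 'q) cat_map \<Rightarrow> bool" where
  "cat_equivalence C D F \<longleftrightarrow> cat_functor C D F \<and>
    (\<exists>G. cat_functor D C G \<and>
      (\<exists>\<eta>. natural_iso C C (comp_cat_map G F) id_cat_map \<eta>) \<and>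
      (\<exists>\<epsilon>. natural_iso D D (comp_cat_map F G) id_cat_map \<epsilon>))"


section \<open>Representations of quivers\<close>

text \<open>
  A quiver is a (possibly infinite) multi-digraph in the sense of \<open>Graph_Theory\<close>. Vector spaces
  are modules over \<open>class_ring :: complex ring\<close>, the field of complex numbers, whose
  underlying set is any subset of the type \<open>'u\<close>. If \<open>complex\<close> injects into \<open>'u\<close>, every
  finite-dimensional space is isomorphic to one of these; otherwise only zero spaces exist. The functions in a representation carry junk at
  non-vertices and non-arrows and outside the carriers; no definition depends on it.
\<close>

record ('v, 'a, 'u) rep =
  space :: "'v \<Rightarrow> (complex, 'u) module"
  linmap :: "'a \<Rightarrow> 'u \<Rightarrow> 'u"

text \<open>The last condition makes the total dimension finite, also over an infinite quiver.\<close>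

definition is_rep :: "('v, 'a) pre_digraph \<Rightarrow> ('v, 'a, 'u) rep \<Rightarrow> bool" where
  "is_rep G M \<longleftrightarrow>
    (\<forall>x \<in> verts G. vectorspace class_ring (space M x) \<and>
      vectorspace.fin_dim class_ring (space M x)) \<and>
    (\<forall>a \<in> arcs G. linmap M a \<in>
      LinearCombinations.module_hom class_ring (space M (tail G a)) (space M (head G a))) \<and>
    finite {x \<in> verts G. carrier (space M x) \<noteq> {\<zero>\<^bsub>space M x\<^esub>}}"

text \<open>Extensionality makes equality of morphisms the equality of the families of linear maps.\<close>

definition rep_hom :: "('v, 'a) pre_digraph \<Rightarrow> ('v, 'a, 'u) rep \<Rightarrow> ('v, 'a, 'u) rep \<Rightarrow>
    ('v \<Rightarrow> 'u \<Rightarrow> 'u) set" where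
  "rep_hom G M N = {f \<in> extensional (verts G).
    (\<forall>x \<in> verts G. f x \<in> extensional (carrier (space M x)) \<and>
      f x \<in> LinearCombinations.module_hom class_ring (space M x) (space N x)) \<and>
    (\<forall>a \<in> arcs G. \<forall>m \<in> carrier (space M (tail G a)).
      f (head G a) (linmap M a m) = linmap N a (f (tail G a) m))}"

definition rep_id :: "('v, 'a) pre_digraph \<Rightarrow> ('v, 'a, 'u) rep \<Rightarrow> 'v \<Rightarrow> 'u \<Rightarrow> 'u" where
  "rep_id G M = (\<lambda>x \<in> verts G. \<lambda>m \<in> carrier (space M x). m)"

definition rep_comp :: "('v, 'a) pre_digraph \<Rightarrow> ('v, 'a, 'u) rep \<Rightarrow>
    ('v \<Rightarrow> 'u \<Rightarrow> 'u) \<Rightarrow> ('v \<Rightarrow> 'u \<Rightarrow> 'u) \<Rightarrow> 'v \<Rightarrow> 'u \<Rightarrow> 'u" where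
  "rep_comp G L g f = (\<lambda>x \<in> verts G. compose (carrier (space L x)) (g x) (f x))"

definition rep_category ::
  "('v, 'a) pre_digraph \<Rightarrow> (('v, 'a, 'u) rep, 'v \<Rightarrow> 'u \<Rightarrow> 'u) category" where
  "rep_category G =
    \<lparr>Obj = {M. is_rep G M}, Hom = rep_hom G, idn = rep_id G,
     cmp = (\<lambda>L M N g f. rep_comp G L g f)\<rparr>"


section \<open>Path algebras and their quotients\<close>

text \<open>
  A path is a pair of its source and the list of its arrows, in the order of traversal; the trivial
  path at \<open>s\<close> is \<open>(s, [])\<close>. So \<open>b a\<close>, composed right to left, is \<open>(s, [a, b])\<close>. An element of the
  path algebra is its family of coefficients.
\<close>

definition path_algebra :: "('v, 'a) pre_digraph \<Rightarrow> ('v \<times> 'a list \<Rightarrow> complex) set" where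
  "path_algebra G = {r. finite {q. r q \<noteq> 0} \<and>
    (\<forall>s p. r (s, p) \<noteq> 0 \<longrightarrow> (\<exists>t. pre_digraph.awalk G s p t))}"

definition path_elem :: "'v \<Rightarrow> 'a list \<Rightarrow> 'v \<times> 'a list \<Rightarrow> complex" where
  "path_elem s p = (\<lambda>q. if q = (s, p) then 1 else 0)"

text \<open>The coefficient at a path sums over all ways of cutting it; the right factor comes first.\<close>

definition path_mult :: "('v, 'a) pre_digraph \<Rightarrow> ('v \<times> 'a list \<Rightarrow> complex) \<Rightarrow>
    ('v \<times> 'a list \<Rightarrow> complex) \<Rightarrow> 'v \<times> 'a list \<Rightarrow> complex" where
  "path_mult G r q = (\<lambda>(s, p). \<Sum>k \<le> length p.
    r (last (pre_digraph.awalk_verts G s (take k p)), drop k p) * q (s, take k p))"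

inductive_set path_ideal :: "('v, 'a) pre_digraph \<Rightarrow> ('v \<times> 'a list \<Rightarrow> complex) set \<Rightarrow>
    ('v \<times> 'a list \<Rightarrow> complex) set"
  for G :: "('v, 'a) pre_digraph" and R :: "('v \<times> 'a list \<Rightarrow> complex) set" where
  generator: "r \<in> R \<Longrightarrow> r \<in> path_ideal G R"
| zero: "(\<lambda>_. 0) \<in> path_ideal G R"
| add: "r \<in> path_ideal G R \<Longrightarrow> r' \<in> path_ideal G R \<Longrightarrow> (\<lambda>q. r q + r' q) \<in> path_ideal G R"
| scale: "r \<in> path_ideal G R \<Longrightarrow> (\<lambda>q. c * r q) \<in> path_ideal G R"
| left_mult: "r \<in> path_ideal G R \<Longrightarrow> b \<in> path_algebra G \<Longrightarrow> path_mult G b r \<in> path_ideal G R"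
| right_mult: "r \<in> path_ideal G R \<Longrightarrow> b \<in> path_algebra G \<Longrightarrow> path_mult G r b \<in> path_ideal G R"

text \<open>\<open>path_eval G M r s t\<close> is the component \<open>M\<^sub>s \<rightarrow> M\<^sub>t\<close> of the action of \<open>r\<close> on \<open>M\<close>.\<close>

definition path_eval :: "('v, 'a) pre_digraph \<Rightarrow> ('v, 'a, 'u) rep \<Rightarrow>
    ('v \<times> 'a list \<Rightarrow> complex) \<Rightarrow> 'v \<Rightarrow> 'v \<Rightarrow> 'u \<Rightarrow> 'u" where
  "path_eval G M r s t m =
    finsum (space M t) (\<lambda>p. r (s, p) \<odot>\<^bsub>space M t\<^esub> fold (linmap M) p m)
      {p. pre_digraph.awalk G s p t \<and> r (s, p) \<noteq> 0}"

definition satisfies :: "('v, 'a) pre_digraph \<Rightarrow> ('v, 'a, 'u) rep \<Rightarrow>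
    ('v \<times> 'a list \<Rightarrow> complex) \<Rightarrow> bool" where
  "satisfies G M r \<longleftrightarrow> (\<forall>s \<in> verts G. \<forall>t \<in> verts G. \<forall>m \<in> carrier (space M s).
    path_eval G M r s t m = \<zero>\<^bsub>space M t\<^esub>)"

text \<open>
  Finite-dimensional modules over the quotient of the path algebra by the ideal \<open>J\<close>, as
  representations annihilated by \<open>J\<close>.
\<close>

definition mod_quotient :: "('v, 'a) pre_digraph \<Rightarrow> ('v \<times> 'a list \<Rightarrow> complex) set \<Rightarrow>
    (('v, 'a, 'u) rep, 'v \<Rightarrow> 'u \<Rightarrow> 'u) category" where
  "mod_quotient G J = full_subcategory (rep_category G) (\<lambda>M. \<forall>r \<in> J. satisfies G M r)"


section \<open>Representations with idempotents\<close>

record ('v, 'a, 'u) idem_rep =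
  und :: "('v, 'a, 'u) rep"
  idem :: "'v \<Rightarrow> int \<Rightarrow> 'u \<Rightarrow> 'u"

definition is_idem_rep :: "('v, 'a) pre_digraph \<Rightarrow> ('v, 'a, 'u) idem_rep \<Rightarrow> bool" where
  "is_idem_rep G N \<longleftrightarrow> is_rep G (und N) \<and>
    (\<forall>x \<in> verts G.
      (let V = space (und N) x; nz = {i. \<exists>m \<in> carrier V. idem N x i m \<noteq> \<zero>\<^bsub>V\<^esub>} in
        (\<forall>i. idem N x i \<in> LinearCombinations.module_hom class_ring V V) \<and>
        finite nz \<and>
        (\<forall>i k. i \<noteq> k \<longrightarrow> (\<forall>m \<in> carrier V. idem N x i (idem N x k m) = \<zero>\<^bsub>V\<^esub>)) \<and>
        (\<forall>m \<in> carrier V. finsum V (\<lambda>i. idem N x i m) nz = m)))"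

definition idem_hom :: "('v, 'a) pre_digraph \<Rightarrow> ('v, 'a, 'u) idem_rep \<Rightarrow>
    ('v, 'a, 'u) idem_rep \<Rightarrow> ('v \<Rightarrow> 'u \<Rightarrow> 'u) set" where
  "idem_hom G N N' = {f \<in> rep_hom G (und N) (und N').
    \<forall>x \<in> verts G. \<forall>i. \<forall>m \<in> carrier (space (und N) x).
      f x (idem N x i m) = idem N' x i (f x m)}"

definition mod_idem ::
  "('v, 'a) pre_digraph \<Rightarrow> (('v, 'a, 'u) idem_rep, 'v \<Rightarrow> 'u \<Rightarrow> 'u) category" where
  "mod_idem G =
    \<lparr>Obj = {N. is_idem_rep G N}, Hom = idem_hom G, idn = (\<lambda>N. rep_id G (und N)),
     cmp = (\<lambda>L M N g f. rep_comp G (und L) g f)\<rparr>"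

definition mod_idem_deg :: "('v, 'a) pre_digraph \<Rightarrow> ('a \<Rightarrow> int) \<Rightarrow>
    (('v, 'a, 'u) idem_rep, 'v \<Rightarrow> 'u \<Rightarrow> 'u) category" where
  "mod_idem_deg G T = full_subcategory (mod_idem G) (\<lambda>N.
    \<forall>a \<in> arcs G. \<forall>i k. i - k \<noteq> T a \<longrightarrow> (\<forall>m \<in> carrier (space (und N) (tail G a)).
      idem N (head G a) i (linmap (und N) a (idem N (tail G a) k m)) =
        \<zero>\<^bsub>space (und N) (head G a)\<^esub>))"


section \<open>The functor induced by a quiver morphism and a labelling of vertices\<close>

text \<open>
  Direct sum of modules over an arbitrary index set. The fields \<open>mult\<close> and \<open>one\<close> of a module record
  play no role.
\<close>

definition direct_sum :: "'i set \<Rightarrow> ('i \<Rightarrow> ('k, 'u) module) \<Rightarrow> ('k, 'i \<Rightarrow> 'u) module" where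
  "direct_sum I V =
    \<lparr>carrier = {m \<in> (\<Pi>\<^sub>E i \<in> I. carrier (V i)). finite {i \<in> I. m i \<noteq> \<zero>\<^bsub>V i\<^esub>}},
     monoid.mult = undefined, one = undefined,
     zero = (\<lambda>i \<in> I. \<zero>\<^bsub>V i\<^esub>),
     add = (\<lambda>m m'. \<lambda>i \<in> I. m i \<oplus>\<^bsub>V i\<^esub> m' i),
     module.smult = (\<lambda>c m. \<lambda>i \<in> I. c \<odot>\<^bsub>V i\<^esub> m i)\<rparr>"

definition fibre :: "('w, 'b) pre_digraph \<Rightarrow> ('w \<Rightarrow> 'v) \<Rightarrow> 'v \<Rightarrow> 'w set" where
  "fibre G Fv x = {y \<in> verts G. Fv y = x}"

text \<open>
  Here \<open>G\<close> is the source quiver, \<open>H\<close> the target quiver, \<open>(Fv, Fa) : G \<rightarrow> H\<close> the quiver morphism and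
  \<open>v\<close> the labelling of the vertices of \<open>G\<close>. In \<open>rho_rep\<close> the component at \<open>y\<close> of the image under an
  arrow \<open>a\<close> sums over the arrows of \<open>G\<close> above \<open>a\<close> ending in \<open>y\<close> (there must be finitely many).
\<close>

definition rho_rep :: "('w, 'b) pre_digraph \<Rightarrow> ('v, 'a) pre_digraph \<Rightarrow> ('w \<Rightarrow> 'v) \<Rightarrow> ('b \<Rightarrow> 'a) \<Rightarrow>
    ('w, 'b, 'u) rep \<Rightarrow> ('v, 'a, 'w \<Rightarrow> 'u) rep" where
  "rho_rep G H Fv Fa M =
    \<lparr>space = (\<lambda>x. direct_sum (fibre G Fv x) (space M)),
     linmap = (\<lambda>a m. \<lambda>y \<in> fibre G Fv (head H a).
       finsum (space M y) (\<lambda>b. linmap M b (m (tail G b)))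
         {b \<in> arcs G. Fa b = a \<and> head G b = y})\<rparr>"

definition rho_obj :: "('w, 'b) pre_digraph \<Rightarrow> ('v, 'a) pre_digraph \<Rightarrow> ('w \<Rightarrow> 'v) \<Rightarrow> ('b \<Rightarrow> 'a) \<Rightarrow>
    ('w \<Rightarrow> int) \<Rightarrow> ('w, 'b, 'u) rep \<Rightarrow> ('v, 'a, 'w \<Rightarrow> 'u) idem_rep" where
  "rho_obj G H Fv Fa v M =
    \<lparr>und = rho_rep G H Fv Fa M,
     idem = (\<lambda>x k m. \<lambda>y \<in> fibre G Fv x. if v y = k then m y else \<zero>\<^bsub>space M y\<^esub>)\<rparr>"

definition rho_arr :: "('w, 'b) pre_digraph \<Rightarrow> ('v, 'a) pre_digraph \<Rightarrow> ('w \<Rightarrow> 'v) \<Rightarrow>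
    ('w, 'b, 'u) rep \<Rightarrow> ('w \<Rightarrow> 'u \<Rightarrow> 'u) \<Rightarrow> 'v \<Rightarrow> ('w \<Rightarrow> 'u) \<Rightarrow> ('w \<Rightarrow> 'u)" where
  "rho_arr G H Fv M f =
    (\<lambda>x \<in> verts H. \<lambda>m \<in> carrier (direct_sum (fibre G Fv x) (space M)).
      \<lambda>y \<in> fibre G Fv x. f y (m y))"

definition rho :: "('w, 'b) pre_digraph \<Rightarrow> ('v, 'a) pre_digraph \<Rightarrow> ('w \<Rightarrow> 'v) \<Rightarrow> ('b \<Rightarrow> 'a) \<Rightarrow>
    ('w \<Rightarrow> int) \<Rightarrow> (('w, 'b, 'u) rep, 'w \<Rightarrow> 'u \<Rightarrow> 'u,
      ('v, 'a, 'w \<Rightarrow> 'u) idem_rep, 'v \<Rightarrow> ('w \<Rightarrow> 'u) \<Rightarrow> ('w \<Rightarrow> 'u)) cat_map" where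
  "rho G H Fv Fa v =
    \<lparr>on_obj = rho_obj G H Fv Fa v, on_arr = (\<lambda>M M' f. rho_arr G H Fv M f)\<rparr>"


section \<open>The quivers and relations of type A\<close>

definition A_quiver :: "nat \<Rightarrow> (nat, nat) pre_digraph" where
  "A_quiver n = \<lparr>verts = {1..n}, arcs = {1..<n}, tail = (\<lambda>i. i), head = (\<lambda>i. i + 1)\<rparr>"

datatype 'a double_arc = Arc 'a | Star 'a

definition double_quiver :: "('v, 'a) pre_digraph \<Rightarrow> ('v, 'a double_arc) pre_digraph" where
  "double_quiver Q =
    \<lparr>verts = verts Q, arcs = Arc ` arcs Q \<union> Star ` arcs Q,
     tail = case_double_arc (tail Q) (head Q),
     head = case_double_arc (head Q) (tail Q)\<rparr>"

definition preproj_relation :: "nat \<Rightarrow> nat \<Rightarrow> nat \<times> nat double_arc list \<Rightarrow> complex" where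
  "preproj_relation n i = (\<lambda>q.
    (if i \<in> arcs (A_quiver n) then path_elem i [Arc i, Star i] q else 0) -
    (if i - 1 \<in> arcs (A_quiver n) then path_elem i [Star (i - 1), Arc (i - 1)] q else 0))"

definition mod_idem_preproj :: "nat \<Rightarrow> (nat double_arc \<Rightarrow> int) \<Rightarrow>
    ((nat, nat double_arc, 'u) idem_rep, nat \<Rightarrow> 'u \<Rightarrow> 'u) category" where
  "mod_idem_preproj n T = full_subcategory (mod_idem_deg (double_quiver (A_quiver n)) T)
    (\<lambda>N. \<forall>i \<in> {1..n}. satisfies (double_quiver (A_quiver n)) (und N) (preproj_relation n i))"

datatype cover_arc = Alpha nat int | Alpha_star nat int

text \<open>The vertex written \<open>i\<^sub>j\<close> is the pair \<open>(i, j)\<close>.\<close>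

definition cover_quiver :: "nat \<Rightarrow> (nat \<times> int, cover_arc) pre_digraph" where
  "cover_quiver n =
    \<lparr>verts = {1..n} \<times> UNIV,
     arcs = {Alpha i j |i j. i \<in> {1..<n}} \<union> {Alpha_star i j |i j. i \<in> {1..<n}},
     tail = (\<lambda>b. case b of Alpha i j \<Rightarrow> (i, j) | Alpha_star i j \<Rightarrow> (i + 1, j)),
     head = (\<lambda>b. case b of Alpha i j \<Rightarrow> (i + 1, j) | Alpha_star i j \<Rightarrow> (i, j - 1))\<rparr>"

text \<open>For \<open>n = 1\<close> there are no arrows, hence no generators.\<close>

definition cover_relations :: "nat \<Rightarrow> ((nat \<times> int) \<times> cover_arc list \<Rightarrow> complex) set" where
  "cover_relations n =
    {path_elem (1, j) [Alpha 1 j, Alpha_star 1 j] |j. n \<ge> 2} \<union>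
    {path_elem (n, j) [Alpha_star (n - 1) j, Alpha (n - 1) (j - 1)] |j. n \<ge> 2} \<union>
    {\<lambda>q. path_elem (i, j) [Alpha i j, Alpha_star i j] q -
         path_elem (i, j) [Alpha_star (i - 1) j, Alpha (i - 1) (j - 1)] q
      |i j. 2 \<le> i \<and> i \<le> n - 1}"

definition cover_ideal :: "nat \<Rightarrow> ((nat \<times> int) \<times> cover_arc list \<Rightarrow> complex) set" where
  "cover_ideal n = path_ideal (cover_quiver n) (cover_relations n)"

fun cover_vert_map :: "nat \<times> int \<Rightarrow> nat" where
  "cover_vert_map (i, j) = i"

fun cover_arc_map :: "cover_arc \<Rightarrow> nat double_arc" where
  "cover_arc_map (Alpha i j) = Arc i"
| "cover_arc_map (Alpha_star i j) = Star i"

fun cover_label :: "nat \<times> int \<Rightarrow> int" where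
  "cover_label (i, j) = j"

definition cover_rho :: "nat \<Rightarrow> ((nat \<times> int, cover_arc, 'u) rep, nat \<times> int \<Rightarrow> 'u \<Rightarrow> 'u,
    (nat, nat double_arc, nat \<times> int \<Rightarrow> 'u) idem_rep,
    nat \<Rightarrow> (nat \<times> int \<Rightarrow> 'u) \<Rightarrow> (nat \<times> int \<Rightarrow> 'u)) cat_map" where
  "cover_rho n = rho (cover_quiver n) (double_quiver (A_quiver n))
    cover_vert_map cover_arc_map cover_label"

lemma wf_double_A_quiver: "wf_digraph (double_quiver (A_quiver n))"
  by unfold_locales (auto simp: double_quiver_def A_quiver_def)

lemma wf_cover_quiver: "wf_digraph (cover_quiver n)"
  by unfold_locales (auto simp: cover_quiver_def)

lemma cover_quiver_morphism:
  shows "y \<in> verts (cover_quiver n) \<Longrightarrow> cover_vert_map y \<in> verts (double_quiver (A_quiver n))"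
    and "b \<in> arcs (cover_quiver n) \<Longrightarrow>
      cover_arc_map b \<in> arcs (double_quiver (A_quiver n)) \<and>
      tail (double_quiver (A_quiver n)) (cover_arc_map b) = cover_vert_map (tail (cover_quiver n) b) \<and>
      head (double_quiver (A_quiver n)) (cover_arc_map b) = cover_vert_map (head (cover_quiver n) b)"
  by (auto simp: cover_quiver_def double_quiver_def A_quiver_def)

lemma cover_awalks:
  assumes "i \<in> {1..<n}"
  shows "pre_digraph.awalk (cover_quiver n) (i, j) [Alpha i j, Alpha_star i j] (i, j - 1)"
    and "pre_digraph.awalk (cover_quiver n) (Suc i, j) [Alpha_star i j, Alpha i (j - 1)] (Suc i, j - 1)"
  using assms by (auto simp: pre_digraph.awalk_def pre_digraph.cas.simps cover_quiver_def)

lemma cover_relations_subset: "cover_relations n \<subseteq> path_algebra (cover_quiver n)"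
proof -
  have fin1: "finite {q. path_elem s p q \<noteq> 0}" for s :: "nat \<times> int" and p :: "cover_arc list"
    by (simp add: path_elem_def)
  have fin2: "finite {q. path_elem s p q \<noteq> path_elem s' p' q}"
    for s s' :: "nat \<times> int" and p p' :: "cover_arc list"
    by (rule finite_subset[of _ "{(s, p), (s', p')}"]) (auto simp: path_elem_def)
  have up: "\<exists>t. pre_digraph.awalk (cover_quiver n) (i, j) [Alpha i j, Alpha_star i j] t"
    if "1 \<le> i" "i < n" for i j
    using cover_awalks(1)[of i n j] that by auto
  have down: "\<exists>t. pre_digraph.awalk (cover_quiver n) (i, j)
      [Alpha_star (i - 1) j, Alpha (i - 1) (j - 1)] t" if "2 \<le> i" "i \<le> n" for i j
  proof -
    have "i - 1 \<in> {1..<n}" "Suc (i - 1) = i"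
      using that by auto
    then show ?thesis
      using cover_awalks(2)[of "i - 1" n j] by metis
  qed
  have single: "path_elem s p \<in> path_algebra (cover_quiver n)"
    if "\<exists>t. pre_digraph.awalk (cover_quiver n) s p t" for s p
    using that fin1 by (simp add: path_algebra_def) (simp add: path_elem_def)
  have diff: "(\<lambda>q. path_elem s p q - path_elem s p' q) \<in> path_algebra (cover_quiver n)"
    if "\<exists>t. pre_digraph.awalk (cover_quiver n) s p t"
      "\<exists>t. pre_digraph.awalk (cover_quiver n) s p' t" for s p p'
    using that fin2 by (simp add: path_algebra_def) (auto simp: path_elem_def split: if_splits)
  show ?thesis
    unfolding cover_relations_def
  proof (intro Un_least subsetI; elim CollectE exE conjE; hypsubst)
    fix j assume n: "2 \<le> n"
    show "path_elem (1, j) [Alpha 1 j, Alpha_star 1 j] \<in> path_algebra (cover_quiver n)"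
      by (rule single, rule up) (use n in auto)
    show "path_elem (n, j) [Alpha_star (n - 1) j, Alpha (n - 1) (j - 1)]
        \<in> path_algebra (cover_quiver n)"
      by (rule single, rule down) (use n in auto)
  next
    fix i j assume i: "2 \<le> i" "i \<le> n - 1"
    show "(\<lambda>q. path_elem (i, j) [Alpha i j, Alpha_star i j] q -
        path_elem (i, j) [Alpha_star (i - 1) j, Alpha (i - 1) (j - 1)] q)
        \<in> path_algebra (cover_quiver n)"
      by (rule diff, rule up, use i in auto) (rule down[simplified], use i in auto)
  qed
qed

end

theory Submission
  imports Defs
begin

text \<open>
  The quiver with vertices \<open>i\<^sub>j\<close> is a covering of the double quiver of type A: above each vertex there is
  one vertex with each label, and above each arrow \<open>a\<close> one arrow ending in each vertex above its head,
  which raises the label by \<open>T a\<close>. For any covering \<open>G\<close> of a quiver \<open>H\<close> with these properties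
  (\<open>graded_cover\<close>), representations of \<open>G\<close> are the same as representations of \<open>H\<close> with idempotents
  of degree \<open>T\<close>. Indeed, orthogonal idempotents \<open>e\<^sub>k\<close> at \<open>x\<close> that sum to the identity decompose \<open>N\<^sub>x\<close> into
  the images of the \<open>e\<^sub>k\<close>. The degree condition says that \<open>N\<^sub>a\<close> maps the \<open>k\<close>-th image into the one with
  index \<open>k + T a\<close>, which is what an arrow of the covering above \<open>a\<close> does; and a linear map commutes with
  the idempotents if and only if it respects the decomposition. This gives the two halves of the
  equivalence, \<open>rho_essentially_surjective\<close> and \<open>rho_fully_faithful\<close>. In the first, the images of the
  idempotents have to be moved into the type \<open>'u\<close>. This is possible because a finite-dimensional complex
  space has at most as many elements as there are complex numbers (\<open>fin_dim_embeds\<close>).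

  A path of \<open>H\<close> acts on \<open>\<rho> M\<close> by the actions of its lifts on the summands (\<open>fold_rho\<close>). Therefore \<open>\<rho> M\<close>
  satisfies the relations of the preprojective algebra if and only if \<open>M\<close> satisfies their lifts, which
  up to sign are the generators of \<open>J\<^sub>n\<close> (\<open>cover_relations_iff_preproj\<close>). A representation that satisfies
  the generators is annihilated by all of \<open>J\<^sub>n\<close>, because its annihilator is a two-sided ideal
  (\<open>path_ideal_subset_annihilator\<close>). Since the relations are invariant under isomorphism, the
  equivalence restricts to the two full subcategories (\<open>equivalence_of_full_subcategories\<close>).
\<close>

section \<open>Vector spaces over the complex numbers\<close>

abbreviation lin :: "(complex, 'u) module \<Rightarrow> (complex, 'w) module \<Rightarrow> ('u \<Rightarrow> 'w) set" where
  "lin V W \<equiv> LinearCombinations.module_hom class_ring V W"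

text \<open>
  The library states its rules with the operations of the ring record; here they are restated with the
  operations of the type of complex numbers, in which form the simplifier can apply them.
\<close>

locale complex_space =
  fixes V :: "(complex, 'u) module" (structure)
  assumes vectorspace: "vectorspace class_ring V"
begin

sublocale vectorspace class_ring V
  by (rule vectorspace)

lemma scale_closed [simp]: "x \<in> carrier V \<Longrightarrow> c \<odot> x \<in> carrier V"
  using smult_closed[of c x] by simp

lemma scale_zero_left [simp]: "x \<in> carrier V \<Longrightarrow> 0 \<odot> x = \<zero>"
  using smult_l_null[of x] by simp

lemma scale_zero_right [simp]: "c \<odot> \<zero> = \<zero>"
  using smult_r_null[of c] by simp

lemma scale_one [simp]: "x \<in> carrier V \<Longrightarrow> 1 \<odot> x = x"
  using smult_one[of x] by simp

lemma scale_minus_one [simp]: "x \<in> carrier V \<Longrightarrow> (-1) \<odot> x = \<ominus> x"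
  using smult_minus_1[of x] by (simp add: class_ring_simps)

lemma scale_assoc: "x \<in> carrier V \<Longrightarrow> (a * b) \<odot> x = a \<odot> (b \<odot> x)"
  using smult_assoc1[of a b x] by simp

lemma scale_left_distrib: "x \<in> carrier V \<Longrightarrow> (a + b) \<odot> x = a \<odot> x \<oplus> b \<odot> x"
  using smult_l_distr[of a b x] by simp

lemma scale_right_distrib:
  "x \<in> carrier V \<Longrightarrow> y \<in> carrier V \<Longrightarrow> a \<odot> (x \<oplus> y) = a \<odot> x \<oplus> a \<odot> y"
  using smult_r_distr[of a x y] by simp

lemma scale_finsum:
  "g \<in> A \<rightarrow> carrier V \<Longrightarrow> c \<odot> finsum V g A = finsum V (\<lambda>i. c \<odot> g i) A"
  by (induction A rule: infinite_finite_induct) (auto simp: scale_right_distrib Pi_iff finsum_closed)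

end

lemma complex_spaceI:
  assumes "\<zero>\<^bsub>V\<^esub> \<in> carrier V"
    and "\<And>x y. x \<in> carrier V \<Longrightarrow> y \<in> carrier V \<Longrightarrow> x \<oplus>\<^bsub>V\<^esub> y \<in> carrier V"
    and "\<And>c x. x \<in> carrier V \<Longrightarrow> c \<odot>\<^bsub>V\<^esub> x \<in> carrier V"
    and "\<And>x. x \<in> carrier V \<Longrightarrow> x \<oplus>\<^bsub>V\<^esub> (-1) \<odot>\<^bsub>V\<^esub> x = \<zero>\<^bsub>V\<^esub>"
    and "\<And>x y. x \<in> carrier V \<Longrightarrow> y \<in> carrier V \<Longrightarrow> x \<oplus>\<^bsub>V\<^esub> y = y \<oplus>\<^bsub>V\<^esub> x"
    and "\<And>x y z. x \<in> carrier V \<Longrightarrow> y \<in> carrier V \<Longrightarrow> z \<in> carrier V \<Longrightarrow>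
      (x \<oplus>\<^bsub>V\<^esub> y) \<oplus>\<^bsub>V\<^esub> z = x \<oplus>\<^bsub>V\<^esub> (y \<oplus>\<^bsub>V\<^esub> z)"
    and "\<And>x. x \<in> carrier V \<Longrightarrow> x \<oplus>\<^bsub>V\<^esub> \<zero>\<^bsub>V\<^esub> = x"
    and "\<And>x. x \<in> carrier V \<Longrightarrow> 1 \<odot>\<^bsub>V\<^esub> x = x"
    and "\<And>a b x. x \<in> carrier V \<Longrightarrow> (a * b) \<odot>\<^bsub>V\<^esub> x = a \<odot>\<^bsub>V\<^esub> (b \<odot>\<^bsub>V\<^esub> x)"
    and "\<And>a b x. x \<in> carrier V \<Longrightarrow> (a + b) \<odot>\<^bsub>V\<^esub> x = a \<odot>\<^bsub>V\<^esub> x \<oplus>\<^bsub>V\<^esub> b \<odot>\<^bsub>V\<^esub> x"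
    and "\<And>a x y. x \<in> carrier V \<Longrightarrow> y \<in> carrier V \<Longrightarrow>
      a \<odot>\<^bsub>V\<^esub> (x \<oplus>\<^bsub>V\<^esub> y) = a \<odot>\<^bsub>V\<^esub> x \<oplus>\<^bsub>V\<^esub> a \<odot>\<^bsub>V\<^esub> y"
  shows "complex_space V"
  using assms by (intro complex_space.intro vs_criteria class_field) (simp_all, blast+)

lemma linI:
  assumes "\<And>x. x \<in> carrier V \<Longrightarrow> f x \<in> carrier W"
    and "\<And>x y. x \<in> carrier V \<Longrightarrow> y \<in> carrier V \<Longrightarrow> f (x \<oplus>\<^bsub>V\<^esub> y) = f x \<oplus>\<^bsub>W\<^esub> f y"
    and "\<And>c x. x \<in> carrier V \<Longrightarrow> f (c \<odot>\<^bsub>V\<^esub> x) = c \<odot>\<^bsub>W\<^esub> f x"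
  shows "f \<in> lin V W"
  using assms by (auto simp: LinearCombinations.module_hom_def)

lemma
  assumes "f \<in> lin V W" "x \<in> carrier V"
  shows lin_closed: "f x \<in> carrier W"
    and lin_scale: "f (c \<odot>\<^bsub>V\<^esub> x) = c \<odot>\<^bsub>W\<^esub> f x"
    and lin_add: "y \<in> carrier V \<Longrightarrow> f (x \<oplus>\<^bsub>V\<^esub> y) = f x \<oplus>\<^bsub>W\<^esub> f y"
  using assms by (auto simp: LinearCombinations.module_hom_def)

lemma lin_zero:
  assumes "complex_space V" "complex_space W" "f \<in> lin V W"
  shows "f \<zero>\<^bsub>V\<^esub> = \<zero>\<^bsub>W\<^esub>"
proof -
  interpret V: complex_space V by fact
  interpret W: complex_space W by fact
  have "f (0 \<odot>\<^bsub>V\<^esub> \<zero>\<^bsub>V\<^esub>) = 0 \<odot>\<^bsub>W\<^esub> f \<zero>\<^bsub>V\<^esub>"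
    by (rule lin_scale[OF assms(3)]) simp
  then show ?thesis
    using lin_closed[OF assms(3) V.zero_closed] by simp
qed

lemma lin_finsum:
  assumes "complex_space V" "complex_space W" "f \<in> lin V W" "g \<in> A \<rightarrow> carrier V"
  shows "f (finsum V g A) = finsum W (\<lambda>i. f (g i)) A"
proof -
  interpret V: complex_space V by fact
  interpret W: complex_space W by fact
  show ?thesis
    using assms(4)
  proof (induction A rule: infinite_finite_induct)
    case (insert a A)
    then have "(\<lambda>i. f (g i)) \<in> A \<rightarrow> carrier W" "f (g a) \<in> carrier W" "g \<in> A \<rightarrow> carrier V" "g a \<in> carrier V"
      using lin_closed[OF assms(3)] by auto
    with insert show ?case
      by (simp add: lin_add[OF assms(3)] V.finsum_closed)
  qed (simp_all add: lin_zero[OF assms(1-3)])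
qed

lemma lin_id: "(\<lambda>x. x) \<in> lin V V"
  by (intro linI) auto

lemma lin_comp: "f \<in> lin U V \<Longrightarrow> g \<in> lin V W \<Longrightarrow> (\<lambda>x. g (f x)) \<in> lin U W"
  by (auto simp: LinearCombinations.module_hom_def Pi_iff)

lemma lin_cong:
  assumes "f \<in> lin V W" "complex_space V" "\<And>x. x \<in> carrier V \<Longrightarrow> g x = f x"
  shows "g \<in> lin V W"
proof -
  interpret V: complex_space V by fact
  show ?thesis
    using assms by (intro linI) (auto simp: lin_closed lin_add lin_scale)
qed

context complex_space
begin

lemma finsum_in_span:
  assumes "S \<subseteq> carrier V" "g \<in> A \<rightarrow> span S"
  shows "finsum V g A \<in> span S"
proof -
  interpret W: submodule class_ring "span S" V
    by (rule span_is_submodule[OF assms(1)])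
  show ?thesis
    using assms(2)
  proof (induction A rule: infinite_finite_induct)
    case (insert a A)
    then have "g \<in> A \<rightarrow> span S" "g a \<in> span S"
      by auto
    moreover have "span S \<subseteq> carrier V"
      by (rule W.subset)
    ultimately show ?case
      using insert by (subst finsum_insert) (auto intro: W.m_closed)
  qed (use submodule.zero_closed[OF span_is_submodule[OF assms(1)]] in simp_all)
qed

lemma span_scale: "S \<subseteq> carrier V \<Longrightarrow> x \<in> span S \<Longrightarrow> c \<odot> x \<in> span S"
  using submodule.smult_closed[OF span_is_submodule, of S c x] by simp

lemma fin_dimE:
  assumes fin_dim
  obtains A where "finite A" "A \<subseteq> carrier V"
    and "\<And>x. x \<in> carrier V \<Longrightarrow> \<exists>a. x = finsum V (\<lambda>v. a v \<odot> v) A"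
proof -
  obtain A where A: "finite A" "A \<subseteq> carrier V" "span A = carrier V"
    using assms by (auto simp: fin_dim_def)
  have "\<exists>a. x = finsum V (\<lambda>v. a v \<odot> v) A" if "x \<in> carrier V" for x
    using finite_in_span[OF A(1,2), of x] that A(3) by (auto simp: lincomb_def)
  with A show ?thesis
    using that by blast
qed

lemma fin_dimI:
  assumes "finite A" "A \<subseteq> carrier V" "carrier V \<subseteq> span A"
  shows fin_dim
  using assms span_is_subset2[of A] by (auto simp: fin_dim_def)

end

lemma lin_image_span:
  assumes "complex_space V" "complex_space W" "f \<in> lin V W"
    and "A \<subseteq> carrier V" "f ` A \<subseteq> B" "B \<subseteq> carrier W"
  shows "f (finsum V (\<lambda>v. a v \<odot>\<^bsub>V\<^esub> v) A) \<in> LinearCombinations.module.span class_ring W B"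
proof -
  interpret V: complex_space V by fact
  interpret W: complex_space W by fact
  have "f (finsum V (\<lambda>v. a v \<odot>\<^bsub>V\<^esub> v) A) = finsum W (\<lambda>v. f (a v \<odot>\<^bsub>V\<^esub> v)) A"
    using assms(4) by (intro lin_finsum[OF assms(1-3)]) auto
  also have "\<dots> \<in> W.span B"
    using assms W.in_own_span[of B]
    by (intro W.finsum_in_span) (auto simp: lin_scale[OF assms(3)] subset_eq intro!: W.span_scale)
  finally show ?thesis .
qed

lemma fin_dim_surj:
  assumes "complex_space V" "complex_space W" "f \<in> lin V W" "carrier W \<subseteq> f ` carrier V"
    and "vectorspace.fin_dim class_ring V"
  shows "vectorspace.fin_dim class_ring W"
proof -
  interpret V: complex_space V by fact
  interpret W: complex_space W by fact
  obtain A where A: "finite A" "A \<subseteq> carrier V"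
    "\<And>x. x \<in> carrier V \<Longrightarrow> \<exists>a. x = finsum V (\<lambda>v. a v \<odot>\<^bsub>V\<^esub> v) A"
    using V.fin_dimE[OF assms(5)] by blast
  have B: "f ` A \<subseteq> carrier W"
    using A(2) lin_closed[OF assms(3)] by auto
  show ?thesis
  proof (rule W.fin_dimI)
    show "carrier W \<subseteq> W.span (f ` A)"
    proof
      fix y assume "y \<in> carrier W"
      then obtain x where x: "x \<in> carrier V" "y = f x"
        using assms(4) by blast
      show "y \<in> W.span (f ` A)"
        using A(3)[OF x(1)] x(2) lin_image_span[OF assms(1-3) A(2) subset_refl B] by auto
    qed
  qed (use A B in auto)
qed

text \<open>
  By induction on \<open>A\<close>, since an infinite set such as the complex numbers is equipotent to its square.
\<close>

lemma complex_families_embed: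
  "finite A \<Longrightarrow> \<exists>g :: ('i \<Rightarrow> complex) \<Rightarrow> complex. inj_on g (A \<rightarrow>\<^sub>E UNIV)"
proof (induction A rule: finite_induct)
  case empty
  then show ?case by auto
next
  case (insert a A)
  then obtain g :: "('i \<Rightarrow> complex) \<Rightarrow> complex" where g: "inj_on g (A \<rightarrow>\<^sub>E UNIV)"
    by blast
  have "\<exists>h :: complex \<times> complex \<Rightarrow> complex. inj h"
  proof -
    have "infinite (UNIV :: complex set)"
      by (rule infinite_UNIV_char_0)
    then have "(card_of (UNIV \<times> UNIV :: (complex \<times> complex) set), card_of (UNIV :: complex set)) \<in> ordLeq"
      using card_of_Times_same_infinite ordIso_imp_ordLeq by blast
    then show ?thesis
      by (auto simp flip: card_of_ordLeq)
  qed
  then obtain h :: "complex \<times> complex \<Rightarrow> complex" where h: "inj h" by blast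
  have "inj_on (\<lambda>f. h (f a, g (restrict f A))) (insert a A \<rightarrow>\<^sub>E UNIV)"
  proof (rule inj_onI)
    fix f f' :: "'i \<Rightarrow> complex"
    assume f: "f \<in> insert a A \<rightarrow>\<^sub>E UNIV" and f': "f' \<in> insert a A \<rightarrow>\<^sub>E UNIV"
      and eq: "h (f a, g (restrict f A)) = h (f' a, g (restrict f' A))"
    have "f a = f' a" "g (restrict f A) = g (restrict f' A)"
      using injD[OF h eq] by auto
    moreover from this(2) have "restrict f A = restrict f' A"
      by (rule inj_onD[OF g]) auto
    ultimately show "f = f'"
      using f f' by (intro PiE_ext[OF f f']) (metis insert_iff restrict_apply')
  qed
  then show ?case by blast
qed

text \<open>
  A vector is determined by its coefficients with respect to a finite generating set, and there are no
  more families of coefficients than complex numbers. So a space on an arbitrary type can be moved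
  into any type that contains a copy of the complex numbers.
\<close>

lemma (in complex_space) fin_dim_embeds:
  assumes fin_dim
  obtains g :: "'u \<Rightarrow> complex" where "inj_on g (carrier V)"
proof -
  obtain A where A: "finite A" "A \<subseteq> carrier V"
    "\<And>x. x \<in> carrier V \<Longrightarrow> \<exists>a. x = finsum V (\<lambda>v. a v \<odot> v) A"
    using fin_dimE[OF assms] by blast
  obtain h :: "('u \<Rightarrow> complex) \<Rightarrow> complex" where h: "inj_on h (A \<rightarrow>\<^sub>E UNIV)"
    using complex_families_embed[OF A(1)] by blast
  have "\<exists>a \<in> A \<rightarrow>\<^sub>E UNIV. x = finsum V (\<lambda>v. a v \<odot> v) A" if x: "x \<in> carrier V" for x
  proof -
    obtain a where a: "x = finsum V (\<lambda>v. a v \<odot> v) A"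
      using A(3)[OF x] by blast
    have "x = finsum V (\<lambda>v. restrict a A v \<odot> v) A"
      unfolding a using A(2) by (intro finsum_cong') auto
    then show ?thesis
      by (intro bexI[of _ "restrict a A"]) auto
  qed
  then obtain c where c: "\<And>x. x \<in> carrier V \<Longrightarrow> c x \<in> A \<rightarrow>\<^sub>E UNIV"
    "\<And>x. x \<in> carrier V \<Longrightarrow> x = finsum V (\<lambda>v. c x v \<odot> v) A"
    by metis
  have "inj_on (\<lambda>x. h (c x)) (carrier V)"
    by (rule inj_onI) (metis c inj_onD[OF h])
  then show ?thesis
    by (rule that)
qed

definition transport :: "('u \<Rightarrow> 'w) \<Rightarrow> (complex, 'u) module \<Rightarrow> (complex, 'w) module" where
  "transport g V =
    \<lparr>carrier = g ` carrier V, monoid.mult = undefined, one = undefined, zero = g \<zero>\<^bsub>V\<^esub>,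
     add = (\<lambda>x y. g (inv_into (carrier V) g x \<oplus>\<^bsub>V\<^esub> inv_into (carrier V) g y)),
     module.smult = (\<lambda>c x. g (c \<odot>\<^bsub>V\<^esub> inv_into (carrier V) g x))\<rparr>"

lemma transport:
  assumes "complex_space V" "inj_on g (carrier V)"
  shows complex_space_transport: "complex_space (transport g V)"
    and transport_lin: "g \<in> lin V (transport g V)"
    and transport_inv_lin: "inv_into (carrier V) g \<in> lin (transport g V) V"
proof -
  interpret complex_space V by fact
  have inv [simp]: "inv_into (carrier V) g (g x) = x" if "x \<in> carrier V" for x
    using assms(2) that by simp
  show "complex_space (transport g V)"
    by (rule complex_spaceI)
      (auto simp: transport_def scale_assoc scale_left_distrib scale_right_distrib r_neg a_ac)
  show "g \<in> lin V (transport g V)" "inv_into (carrier V) g \<in> lin (transport g V) V"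
    by (auto intro!: linI simp: transport_def)
qed

definition image_space :: "('u \<Rightarrow> 'u) \<Rightarrow> (complex, 'u) module \<Rightarrow> (complex, 'u) module" where
  "image_space e V = V\<lparr>carrier := e ` carrier V\<rparr>"

lemma image_space_simps [simp]:
  "carrier (image_space e V) = e ` carrier V" "\<zero>\<^bsub>image_space e V\<^esub> = \<zero>\<^bsub>V\<^esub>"
  "x \<oplus>\<^bsub>image_space e V\<^esub> y = x \<oplus>\<^bsub>V\<^esub> y" "c \<odot>\<^bsub>image_space e V\<^esub> x = c \<odot>\<^bsub>V\<^esub> x"
  by (auto simp: image_space_def)

lemma complex_space_image_space:
  assumes "complex_space V" "e \<in> lin V V"
  shows "complex_space (image_space e V)"
proof -
  interpret complex_space V by fact
  note e = lin_add[OF assms(2), symmetric] lin_scale[OF assms(2), symmetric]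
  show ?thesis
  proof (rule complex_spaceI)
    show "\<zero>\<^bsub>image_space e V\<^esub> \<in> carrier (image_space e V)"
      using lin_zero[OF assms(1,1,2)] by (metis image_space_simps(1,2) imageI zero_closed)
  qed (auto simp: e lin_closed[OF assms(2)] lin_zero[OF assms(1,1,2)] r_neg a_ac scale_assoc
        scale_left_distrib scale_right_distrib)
qed

lemma lin_image_space: "complex_space V \<Longrightarrow> e \<in> lin V V \<Longrightarrow> e \<in> lin V (image_space e V)"
  by (intro linI) (auto simp: lin_add lin_scale)

section \<open>Direct sums\<close>

lemma direct_sum_simps [simp]:
  "\<zero>\<^bsub>direct_sum I V\<^esub> = (\<lambda>i\<in>I. \<zero>\<^bsub>V i\<^esub>)"
  "m \<oplus>\<^bsub>direct_sum I V\<^esub> m' = (\<lambda>i\<in>I. m i \<oplus>\<^bsub>V i\<^esub> m' i)"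
  "c \<odot>\<^bsub>direct_sum I V\<^esub> m = (\<lambda>i\<in>I. c \<odot>\<^bsub>V i\<^esub> m i)"
  by (simp_all add: direct_sum_def)

lemma direct_sum_carrier:
  "carrier (direct_sum I V) = {m \<in> (\<Pi>\<^sub>E i\<in>I. carrier (V i)). finite {i \<in> I. m i \<noteq> \<zero>\<^bsub>V i\<^esub>}}"
  by (simp add: direct_sum_def)

lemma direct_sum_component: "m \<in> carrier (direct_sum I V) \<Longrightarrow> i \<in> I \<Longrightarrow> m i \<in> carrier (V i)"
  by (auto simp: direct_sum_carrier)

lemma direct_sum_eqI:
  assumes "m \<in> carrier (direct_sum I V)" "m' \<in> carrier (direct_sum I V)"
    and "\<And>i. i \<in> I \<Longrightarrow> m i = m' i"
  shows "m = m'"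
  using assms by (intro PiE_ext[of m I "\<lambda>i. carrier (V i)"]) (auto simp: direct_sum_carrier)

lemma complex_space_direct_sum:
  assumes "\<And>i. i \<in> I \<Longrightarrow> complex_space (V i)"
  shows "complex_space (direct_sum I V)"
proof -
  let ?S = "direct_sum I V"
  have [simp]: "\<zero>\<^bsub>V i\<^esub> \<in> carrier (V i)" "\<zero>\<^bsub>V i\<^esub> \<oplus>\<^bsub>V i\<^esub> \<zero>\<^bsub>V i\<^esub> = \<zero>\<^bsub>V i\<^esub>"
    "c \<odot>\<^bsub>V i\<^esub> \<zero>\<^bsub>V i\<^esub> = \<zero>\<^bsub>V i\<^esub>" if "i \<in> I" for i c
  proof -
    interpret complex_space "V i" using assms[OF that] .
    show "\<zero>\<^bsub>V i\<^esub> \<in> carrier (V i)" "\<zero>\<^bsub>V i\<^esub> \<oplus>\<^bsub>V i\<^esub> \<zero>\<^bsub>V i\<^esub> = \<zero>\<^bsub>V i\<^esub>"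
      "c \<odot>\<^bsub>V i\<^esub> \<zero>\<^bsub>V i\<^esub> = \<zero>\<^bsub>V i\<^esub>" by simp_all
  qed
  have group: "abelian_group (V i)" if "i \<in> I" for i
  proof -
    interpret complex_space "V i" using assms[OF that] .
    show ?thesis ..
  qed
  note mon = abelian_group.axioms(1)[OF group]
  note comp = direct_sum_component[of _ I V]
  have add: "m \<oplus>\<^bsub>?S\<^esub> m' \<in> carrier ?S" if m: "m \<in> carrier ?S" "m' \<in> carrier ?S" for m m'
  proof -
    have "{i \<in> I. (m \<oplus>\<^bsub>?S\<^esub> m') i \<noteq> \<zero>\<^bsub>V i\<^esub>} \<subseteq> {i \<in> I. m i \<noteq> \<zero>\<^bsub>V i\<^esub>} \<union> {i \<in> I. m' i \<noteq> \<zero>\<^bsub>V i\<^esub>}"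
      by auto
    then have "finite {i \<in> I. (m \<oplus>\<^bsub>?S\<^esub> m') i \<noteq> \<zero>\<^bsub>V i\<^esub>}"
      by (rule finite_subset) (use m in \<open>simp add: direct_sum_carrier\<close>)
    with comp[OF m(1)] comp[OF m(2)] show ?thesis
      unfolding direct_sum_carrier by (auto intro!: abelian_monoid.a_closed[OF mon])
  qed
  have scale: "c \<odot>\<^bsub>?S\<^esub> m \<in> carrier ?S" if m: "m \<in> carrier ?S" for c m
  proof -
    have "{i \<in> I. (c \<odot>\<^bsub>?S\<^esub> m) i \<noteq> \<zero>\<^bsub>V i\<^esub>} \<subseteq> {i \<in> I. m i \<noteq> \<zero>\<^bsub>V i\<^esub>}"
      by auto
    then have "finite {i \<in> I. (c \<odot>\<^bsub>?S\<^esub> m) i \<noteq> \<zero>\<^bsub>V i\<^esub>}"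
      by (rule finite_subset) (use m in \<open>simp add: direct_sum_carrier\<close>)
    with comp[OF m] show ?thesis
      unfolding direct_sum_carrier by (auto intro!: complex_space.scale_closed assms)
  qed
  have zero: "\<zero>\<^bsub>?S\<^esub> \<in> carrier ?S"
    by (auto simp: direct_sum_carrier)
  show ?thesis
  proof (rule complex_spaceI)
    fix x assume x: "x \<in> carrier ?S"
    show "x \<oplus>\<^bsub>?S\<^esub> (-1) \<odot>\<^bsub>?S\<^esub> x = \<zero>\<^bsub>?S\<^esub>"
      by (rule direct_sum_eqI[OF add[OF x scale[OF x]] zero])
        (use comp[OF x] in \<open>simp add: complex_space.scale_minus_one[OF assms] abelian_group.r_neg[OF group]\<close>)
    show "x \<oplus>\<^bsub>?S\<^esub> \<zero>\<^bsub>?S\<^esub> = x"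
      by (rule direct_sum_eqI[OF add[OF x zero] x])
        (use comp[OF x] in \<open>simp add: abelian_monoid.r_zero[OF mon]\<close>)
    show "1 \<odot>\<^bsub>?S\<^esub> x = x"
      by (rule direct_sum_eqI[OF scale[OF x] x])
        (use comp[OF x] in \<open>simp add: complex_space.scale_one[OF assms]\<close>)
    fix a b
    show "(a * b) \<odot>\<^bsub>?S\<^esub> x = a \<odot>\<^bsub>?S\<^esub> (b \<odot>\<^bsub>?S\<^esub> x)"
      by (rule direct_sum_eqI[OF scale[OF x] scale[OF scale[OF x]]])
        (use comp[OF x] in \<open>simp add: complex_space.scale_assoc[OF assms]\<close>)
    show "(a + b) \<odot>\<^bsub>?S\<^esub> x = a \<odot>\<^bsub>?S\<^esub> x \<oplus>\<^bsub>?S\<^esub> b \<odot>\<^bsub>?S\<^esub> x"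
      by (rule direct_sum_eqI[OF scale[OF x] add[OF scale[OF x] scale[OF x]]])
        (use comp[OF x] in \<open>simp add: complex_space.scale_left_distrib[OF assms]\<close>)
  next
    fix x y assume x: "x \<in> carrier ?S" and y: "y \<in> carrier ?S"
    show "x \<oplus>\<^bsub>?S\<^esub> y = y \<oplus>\<^bsub>?S\<^esub> x"
      by (rule direct_sum_eqI[OF add[OF x y] add[OF y x]])
        (use comp[OF x] comp[OF y] in \<open>simp add: abelian_monoid.a_comm[OF mon]\<close>)
    show "a \<odot>\<^bsub>?S\<^esub> (x \<oplus>\<^bsub>?S\<^esub> y) = a \<odot>\<^bsub>?S\<^esub> x \<oplus>\<^bsub>?S\<^esub> a \<odot>\<^bsub>?S\<^esub> y" for a
      by (rule direct_sum_eqI[OF scale[OF add[OF x y]] add[OF scale[OF x] scale[OF y]]])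
        (use comp[OF x] comp[OF y] in \<open>simp add: complex_space.scale_right_distrib[OF assms]\<close>)
    fix z assume z: "z \<in> carrier ?S"
    show "(x \<oplus>\<^bsub>?S\<^esub> y) \<oplus>\<^bsub>?S\<^esub> z = x \<oplus>\<^bsub>?S\<^esub> (y \<oplus>\<^bsub>?S\<^esub> z)"
      by (rule direct_sum_eqI[OF add[OF add[OF x y] z] add[OF x add[OF y z]]])
        (use comp[OF x] comp[OF y] comp[OF z] in \<open>simp add: abelian_monoid.a_assoc[OF mon]\<close>)
  qed (use zero add scale in auto)
qed

lemma direct_sum_proj_lin: "i \<in> I \<Longrightarrow> (\<lambda>m. m i) \<in> lin (direct_sum I V) (V i)"
  by (intro linI) (auto simp: direct_sum_component)

lemma lin_direct_sumI:
  assumes "\<And>i. i \<in> I \<Longrightarrow> (\<lambda>u. f u i) \<in> lin U (V i)"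
    and "\<And>u. u \<in> carrier U \<Longrightarrow> f u \<in> carrier (direct_sum I V)"
    and "complex_space U" "\<And>i. i \<in> I \<Longrightarrow> complex_space (V i)"
  shows "f \<in> lin U (direct_sum I V)"
proof -
  interpret U: complex_space U by fact
  interpret S: complex_space "direct_sum I V"
    by (rule complex_space_direct_sum) (rule assms(4))
  show ?thesis
  proof (rule linI)
    fix x y assume xy: "x \<in> carrier U" "y \<in> carrier U"
    show "f (x \<oplus>\<^bsub>U\<^esub> y) = f x \<oplus>\<^bsub>direct_sum I V\<^esub> f y"
      by (rule direct_sum_eqI[OF assms(2) S.a_closed]) (use xy assms(2) in \<open>auto simp: lin_add[OF assms(1)]\<close>)
  next
    fix c x assume x: "x \<in> carrier U"
    show "f (c \<odot>\<^bsub>U\<^esub> x) = c \<odot>\<^bsub>direct_sum I V\<^esub> f x"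
      by (rule direct_sum_eqI[OF assms(2) S.scale_closed]) (use x assms(2) in \<open>auto simp: lin_scale[OF assms(1)]\<close>)
  qed (rule assms(2))
qed

definition incl :: "'i set \<Rightarrow> ('i \<Rightarrow> (complex, 'u) module) \<Rightarrow> 'i \<Rightarrow> 'u \<Rightarrow> 'i \<Rightarrow> 'u" where
  "incl I V i u = (\<lambda>j\<in>I. if j = i then u else \<zero>\<^bsub>V j\<^esub>)"

lemma incl_carrier:
  assumes "\<And>i. i \<in> I \<Longrightarrow> complex_space (V i)" "i \<in> I" "u \<in> carrier (V i)"
  shows "incl I V i u \<in> carrier (direct_sum I V)"
proof -
  have "\<zero>\<^bsub>V j\<^esub> \<in> carrier (V j)" if "j \<in> I" for j
  proof -
    interpret complex_space "V j" using assms(1)[OF that] .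
    show ?thesis by simp
  qed
  moreover have "{j \<in> I. incl I V i u j \<noteq> \<zero>\<^bsub>V j\<^esub>} \<subseteq> {i}"
    by (auto simp: incl_def)
  then have "finite {j \<in> I. incl I V i u j \<noteq> \<zero>\<^bsub>V j\<^esub>}"
    by (rule finite_subset) simp
  ultimately show ?thesis
    using assms(2,3) by (auto simp: direct_sum_carrier) (auto simp: incl_def)
qed

lemma incl_lin:
  assumes V: "\<And>i. i \<in> I \<Longrightarrow> complex_space (V i)" and i: "i \<in> I"
  shows "incl I V i \<in> lin (V i) (direct_sum I V)"
proof (rule lin_direct_sumI)
  fix j assume j: "j \<in> I"
  interpret complex_space "V j" using V[OF j] .
  show "(\<lambda>u. incl I V i u j) \<in> lin (V i) (V j)"
    using j by (cases "j = i") (auto simp: incl_def intro!: linI)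
qed (use V i in \<open>auto intro: incl_carrier\<close>)

text \<open>
  Only finitely many summands are non-zero, so the images under the inclusions of finite generating
  sets of these summands form a finite generating set.
\<close>

lemma fin_dim_direct_sum:
  assumes V: "\<And>i. i \<in> I \<Longrightarrow> complex_space (V i)"
    and fd: "\<And>i. i \<in> I \<Longrightarrow> vectorspace.fin_dim class_ring (V i)"
    and fin: "finite {i \<in> I. carrier (V i) \<noteq> {\<zero>\<^bsub>V i\<^esub>}}"
  shows "vectorspace.fin_dim class_ring (direct_sum I V)"
proof -
  let ?S = "direct_sum I V" and ?J = "{i \<in> I. carrier (V i) \<noteq> {\<zero>\<^bsub>V i\<^esub>}}"
  interpret S: complex_space ?S
    by (rule complex_space_direct_sum) (rule V)
  define gens where "gens i A \<longleftrightarrow> finite A \<and> A \<subseteq> carrier (V i) \<and>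
      (\<forall>u \<in> carrier (V i). \<exists>a. u = finsum (V i) (\<lambda>v. a v \<odot>\<^bsub>V i\<^esub> v) A)" for i A
  have "\<exists>A. gens i A" if i: "i \<in> I" for i
    by (rule complex_space.fin_dimE[OF V[OF i] fd[OF i]]) (auto simp: gens_def)
  then obtain A where "\<And>i. i \<in> I \<Longrightarrow> gens i (A i)"
    by metis
  then have A: "\<And>i. i \<in> I \<Longrightarrow> finite (A i)" "\<And>i. i \<in> I \<Longrightarrow> A i \<subseteq> carrier (V i)"
    "\<And>i u. i \<in> I \<Longrightarrow> u \<in> carrier (V i) \<Longrightarrow> \<exists>a. u = finsum (V i) (\<lambda>v. a v \<odot>\<^bsub>V i\<^esub> v) (A i)"
    by (simp_all add: gens_def)
  define B where "B = (\<Union>i\<in>?J. incl I V i ` A i)"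
  have B: "B \<subseteq> carrier ?S"
    using A(2) incl_carrier[of I V, OF V] by (auto simp: B_def)
  show ?thesis
  proof (rule S.fin_dimI)
    show "finite B"
      using fin A(1) by (auto simp: B_def)
    show "carrier ?S \<subseteq> S.span B"
    proof
      fix m assume m: "m \<in> carrier ?S"
      have incl: "incl I V i (m i) \<in> carrier ?S" if "i \<in> I" for i
        using incl_carrier[of I V, OF V] that direct_sum_component[OF m that] by blast
      have "m = finsum ?S (\<lambda>i. incl I V i (m i)) ?J"
      proof (rule direct_sum_eqI[OF m])
        show "finsum ?S (\<lambda>i. incl I V i (m i)) ?J \<in> carrier ?S"
          using incl by (intro S.finsum_closed) auto
        fix j assume j: "j \<in> I"
        interpret Vj: complex_space "V j" using V[OF j] .
        have "(finsum ?S (\<lambda>i. incl I V i (m i)) ?J) j = finsum (V j) (\<lambda>i. incl I V i (m i) j) ?J"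
          using incl by (intro lin_finsum[OF S.complex_space_axioms Vj.complex_space_axioms
                direct_sum_proj_lin[OF j]]) auto
        also have "\<dots> = finsum (V j) (\<lambda>i. if j = i then m i else \<zero>\<^bsub>V j\<^esub>) ?J"
          using j direct_sum_component[OF m] by (intro Vj.finsum_cong') (auto simp: incl_def)
        also have "\<dots> = m j"
        proof (cases "j \<in> ?J")
          case True
          have "finsum (V j) (\<lambda>i. if j = i then m i else \<zero>\<^bsub>V j\<^esub>) ?J =
              finsum (V j) (\<lambda>i. if j = i then m j else \<zero>\<^bsub>V j\<^esub>) ?J"
            using j direct_sum_component[OF m] by (intro Vj.finsum_cong') auto
          also have "\<dots> = m j"
            using Vj.finsum_singleton[OF True fin, of "\<lambda>_. m j"] direct_sum_component[OF m j] by simp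
          finally show ?thesis .
        next
          case False
          then have "m j = \<zero>\<^bsub>V j\<^esub>"
            using j direct_sum_component[OF m j] by auto
          moreover have "finsum (V j) (\<lambda>i. if j = i then m i else \<zero>\<^bsub>V j\<^esub>) ?J =
              finsum (V j) (\<lambda>i. \<zero>\<^bsub>V j\<^esub>) ?J"
            using False by (intro Vj.finsum_cong') auto
          ultimately show ?thesis by simp
        qed
        finally show "m j = (finsum ?S (\<lambda>i. incl I V i (m i)) ?J) j" by simp
      qed
      also have "\<dots> \<in> S.span B"
      proof (rule S.finsum_in_span[OF B])
        show "(\<lambda>i. incl I V i (m i)) \<in> ?J \<rightarrow> S.span B"
        proof
          fix i assume i: "i \<in> ?J"
          then obtain a where a: "m i = finsum (V i) (\<lambda>v. a v \<odot>\<^bsub>V i\<^esub> v) (A i)"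
            using A(3)[OF _ direct_sum_component[OF m]] by blast
          show "incl I V i (m i) \<in> S.span B"
            unfolding a using i B A(2)
            by (intro lin_image_span V incl_lin S.complex_space_axioms) (auto simp: B_def)
        qed
      qed
      finally show "m \<in> S.span B" .
    qed
  qed (rule B)
qed

section \<open>Categories\<close>

lemma category_full_subcategory: "category C \<Longrightarrow> category (full_subcategory C P)"
  by (auto simp: category_def full_subcategory_def)

lemma full_subcategory_simps [simp]:
  "Obj (full_subcategory C P) = {A \<in> Obj C. P A}" "Hom (full_subcategory C P) = Hom C"
  "idn (full_subcategory C P) = idn C" "cmp (full_subcategory C P) = cmp C"
  by (simp_all add: full_subcategory_def)

lemma cat_iso_full_subcategory [simp]: "cat_iso (full_subcategory C P) = cat_iso C"
  by (simp add: cat_iso_def fun_eq_iff)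

lemma cat_functor_full_subcategory:
  assumes "cat_functor C D F" "\<And>A. A \<in> Obj C \<Longrightarrow> P A \<Longrightarrow> Q (on_obj F A)"
  shows "cat_functor (full_subcategory C P) (full_subcategory D Q) F"
proof -
  interpret cat_functor C D F by fact
  show ?thesis
    by (intro cat_functor.intro category_full_subcategory source.category_axioms
        target.category_axioms cat_functor_axioms.intro)
      (use assms(2) in \<open>auto simp: obj arr arr_idn arr_cmp\<close>)
qed

text \<open>
  For a quasi-inverse, choose for each object \<open>X\<close> of the target an object \<open>a X\<close> of the source and an
  isomorphism \<open>e X : F (a X) \<rightarrow> X\<close>. The quasi-inverse is \<open>a\<close> on objects, and on an arrow \<open>f : X \<rightarrow> Y\<close> it is the
  unique preimage under \<open>F\<close> of \<open>(e Y)\<inverse> f (e X)\<close>.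
\<close>

lemma equivalence_if_fully_faithful_ess_surj:
  fixes C :: "('o, 'm) category" and D :: "('p, 'q) category"
  assumes "cat_functor C D F"
    and ff: "\<And>A B. A \<in> Obj C \<Longrightarrow> B \<in> Obj C \<Longrightarrow>
      bij_betw (on_arr F A B) (Hom C A B) (Hom D (on_obj F A) (on_obj F B))"
    and es: "\<And>X. X \<in> Obj D \<Longrightarrow> \<exists>A \<in> Obj C. \<exists>f. cat_iso D (on_obj F A) X f"
  shows "cat_equivalence C D F"
proof -
  interpret F: cat_functor C D F by fact
  let ?F = "on_obj F"
  have "\<exists>A e e'. A \<in> Obj C \<and> e \<in> Hom D (?F A) X \<and> e' \<in> Hom D X (?F A) \<and>
      cmp D (?F A) X (?F A) e' e = idn D (?F A) \<and> cmp D X (?F A) X e e' = idn D X"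
    if "X \<in> Obj D" for X
    using es[OF that] unfolding cat_iso_def by blast
  then obtain a e e' where a: "\<And>X. X \<in> Obj D \<Longrightarrow> a X \<in> Obj C"
    and e: "\<And>X. X \<in> Obj D \<Longrightarrow> e X \<in> Hom D (?F (a X)) X"
    and e': "\<And>X. X \<in> Obj D \<Longrightarrow> e' X \<in> Hom D X (?F (a X))"
    and e'e: "\<And>X. X \<in> Obj D \<Longrightarrow> cmp D (?F (a X)) X (?F (a X)) (e' X) (e X) = idn D (?F (a X))"
    and ee': "\<And>X. X \<in> Obj D \<Longrightarrow> cmp D X (?F (a X)) X (e X) (e' X) = idn D X"
    by metis
  define pre where "pre A B g = inv_into (Hom C A B) (on_arr F A B) g" for A B g
  have F_surj: "on_arr F A B ` Hom C A B = Hom D (?F A) (?F B)"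
    if "A \<in> Obj C" "B \<in> Obj C" for A B
    using ff[OF that] by (simp add: bij_betw_def)
  have pre_hom: "pre A B g \<in> Hom C A B" and F_pre: "on_arr F A B (pre A B g) = g"
    if "A \<in> Obj C" "B \<in> Obj C" "g \<in> Hom D (?F A) (?F B)" for A B g
    using that F_surj[OF that(1,2)] unfolding pre_def
    by (simp_all add: inv_into_into f_inv_into_f)
  have F_inj: "f = g"
    if "A \<in> Obj C" "B \<in> Obj C" "f \<in> Hom C A B" "g \<in> Hom C A B" "on_arr F A B f = on_arr F A B g"
    for A B f g
    using ff[OF that(1,2)] that(3-5) by (meson bij_betw_imp_inj_on inj_onD)
  note obj = F.obj and arr = F.arr and comp = F.target.cmp_hom
  define c where "c X Y f = cmp D (?F (a X)) Y (?F (a Y)) (e' Y) (cmp D (?F (a X)) X Y f (e X))"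
    for X Y f
  have c: "c X Y f \<in> Hom D (?F (a X)) (?F (a Y))"
    if "X \<in> Obj D" "Y \<in> Obj D" "f \<in> Hom D X Y" for X Y f
    unfolding c_def using that by (intro comp[where B = Y] comp[where B = X]) (auto simp: e e' obj a)
  have e_c: "cmp D (?F (a X)) (?F (a Y)) Y (e Y) (c X Y f) = cmp D (?F (a X)) X Y f (e X)"
    if "X \<in> Obj D" "Y \<in> Obj D" "f \<in> Hom D X Y" for X Y f
  proof -
    have fe: "cmp D (?F (a X)) X Y f (e X) \<in> Hom D (?F (a X)) Y"
      using that by (intro comp) (auto simp: e obj a)
    have "cmp D (?F (a X)) (?F (a Y)) Y (e Y) (c X Y f) =
        cmp D (?F (a X)) Y Y (cmp D Y (?F (a Y)) Y (e Y) (e' Y)) (cmp D (?F (a X)) X Y f (e X))"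
      unfolding c_def using that fe by (intro F.target.cmp_assoc) (auto simp: e e' obj a)
    then show ?thesis
      using that fe by (simp add: ee' F.target.idn_left obj a)
  qed
  have c_id: "c X X (idn D X) = idn D (?F (a X))" if "X \<in> Obj D" for X
    unfolding c_def using that by (simp add: F.target.idn_left e e'e obj a)
  have c_comp: "c X Z (cmp D X Y Z g f) = cmp D (?F (a X)) (?F (a Y)) (?F (a Z)) (c Y Z g) (c X Y f)"
    if "X \<in> Obj D" "Y \<in> Obj D" "Z \<in> Obj D" "f \<in> Hom D X Y" "g \<in> Hom D Y Z" for X Y Z f g
  proof -
    have ob: "?F (a X) \<in> Obj D" "?F (a Y) \<in> Obj D" "?F (a Z) \<in> Obj D"
      using that by (auto simp: obj a)
    have ge: "cmp D (?F (a Y)) Y Z g (e Y) \<in> Hom D (?F (a Y)) Z"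
      using that ob by (intro comp) (auto simp: e)
    have fe: "cmp D (?F (a X)) X Y f (e X) \<in> Hom D (?F (a X)) Y"
      using that ob by (intro comp) (auto simp: e)
    have "cmp D (?F (a X)) (?F (a Y)) (?F (a Z)) (c Y Z g) (c X Y f) =
        cmp D (?F (a X)) Z (?F (a Z)) (e' Z)
          (cmp D (?F (a X)) (?F (a Y)) Z (cmp D (?F (a Y)) Y Z g (e Y)) (c X Y f))"
      unfolding c_def[of Y Z] using that ob ge
      by (intro F.target.cmp_assoc[symmetric] c) (auto simp: e')
    also have "cmp D (?F (a X)) (?F (a Y)) Z (cmp D (?F (a Y)) Y Z g (e Y)) (c X Y f) =
        cmp D (?F (a X)) Y Z g (cmp D (?F (a X)) (?F (a Y)) Y (e Y) (c X Y f))"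
      using that ob by (intro F.target.cmp_assoc[symmetric] c) (auto simp: e)
    also have "\<dots> = cmp D (?F (a X)) Y Z g (cmp D (?F (a X)) X Y f (e X))"
      using that by (simp add: e_c)
    also have "\<dots> = cmp D (?F (a X)) X Z (cmp D X Y Z g f) (e X)"
      using that ob by (intro F.target.cmp_assoc) (auto simp: e)
    finally show ?thesis
      by (simp add: c_def)
  qed
  define G where "G = \<lparr>on_obj = a, on_arr = (\<lambda>X Y f. pre (a X) (a Y) (c X Y f))\<rparr>"
  have G_functor: "cat_functor D C G"
  proof (intro cat_functor.intro F.source.category_axioms F.target.category_axioms
      cat_functor_axioms.intro)
    fix X assume X: "X \<in> Obj D"
    show "on_obj G X \<in> Obj C"
      using X by (simp add: G_def a)
    show "on_arr G X X (idn D X) = idn C (on_obj G X)"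
      using X by (intro F_inj[of "a X" "a X"])
        (auto simp: G_def a c_id F_pre pre_hom F.target.idn_hom F.source.idn_hom obj F.arr_idn)
  next
    fix X Y f assume "X \<in> Obj D" "Y \<in> Obj D" "f \<in> Hom D X Y"
    then show "on_arr G X Y f \<in> Hom C (on_obj G X) (on_obj G Y)"
      by (simp add: G_def a c pre_hom)
  next
    fix X Y Z f g
    assume XYZ: "X \<in> Obj D" "Y \<in> Obj D" "Z \<in> Obj D" "f \<in> Hom D X Y" "g \<in> Hom D Y Z"
    have gf: "cmp D X Y Z g f \<in> Hom D X Z"
      using XYZ by (intro comp)
    have "pre (a X) (a Z) (c X Z (cmp D X Y Z g f)) =
        cmp C (a X) (a Y) (a Z) (pre (a Y) (a Z) (c Y Z g)) (pre (a X) (a Y) (c X Y f))"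
    proof (rule F_inj[of "a X" "a Z"])
      show "cmp C (a X) (a Y) (a Z) (pre (a Y) (a Z) (c Y Z g)) (pre (a X) (a Y) (c X Y f))
          \<in> Hom C (a X) (a Z)"
        using XYZ by (intro F.source.cmp_hom) (auto simp: a pre_hom c)
      show "on_arr F (a X) (a Z) (pre (a X) (a Z) (c X Z (cmp D X Y Z g f))) =
          on_arr F (a X) (a Z)
            (cmp C (a X) (a Y) (a Z) (pre (a Y) (a Z) (c Y Z g)) (pre (a X) (a Y) (c X Y f)))"
        using XYZ gf c_comp[OF XYZ] c[OF XYZ(1,3) gf] by (simp add: F_pre F.arr_cmp[where B = "a Y"] pre_hom c a)
    qed (use XYZ gf in \<open>auto simp: a pre_hom c\<close>)
    then show "on_arr G X Z (cmp D X Y Z g f) = cmp C (on_obj G X) (on_obj G Y) (on_obj G Z)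
        (on_arr G Y Z g) (on_arr G X Y f)"
      by (simp add: G_def)
  qed
  have eps: "natural_iso D D (comp_cat_map F G) id_cat_map e"
    unfolding natural_iso_def cat_iso_def comp_cat_map_def id_cat_map_def G_def
    by (auto simp: e e'e ee' e_c F_pre a c intro!: bexI[OF _ e'])
  define h where "h A = pre (a (?F A)) A (e (?F A))" for A
  define h' where "h' A = pre A (a (?F A)) (e' (?F A))" for A
  have h: "h A \<in> Hom C (a (?F A)) A" "on_arr F (a (?F A)) A (h A) = e (?F A)"
    and h': "h' A \<in> Hom C A (a (?F A))" "on_arr F A (a (?F A)) (h' A) = e' (?F A)"
    if "A \<in> Obj C" for A
    using that unfolding h_def h'_def by (auto simp: pre_hom F_pre a obj e e')
  have "natural_iso C C (comp_cat_map G F) id_cat_map h"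
    unfolding natural_iso_def
  proof (intro conjI ballI)
    fix A assume A: "A \<in> Obj C"
    have aF: "a (?F A) \<in> Obj C"
      using A by (simp add: a obj)
    have "cmp C (a (?F A)) A (a (?F A)) (h' A) (h A) = idn C (a (?F A))"
      using A aF h[OF A] h'[OF A]
      by (intro F_inj[of "a (?F A)" "a (?F A)"] F.source.cmp_hom F.source.idn_hom)
        (auto simp: F.arr_cmp[where B = A] F.arr_idn e'e obj)
    moreover have "cmp C A (a (?F A)) A (h A) (h' A) = idn C A"
      using A aF h[OF A] h'[OF A]
      by (intro F_inj[of A A] F.source.cmp_hom F.source.idn_hom)
        (auto simp: F.arr_cmp[where B = "a (?F A)"] F.arr_idn ee' obj)
    ultimately show "cat_iso C (on_obj (comp_cat_map G F) A) (on_obj id_cat_map A) (h A)"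
      using h(1)[OF A] h'(1)[OF A] by (auto simp: cat_iso_def comp_cat_map_def id_cat_map_def G_def)
  next
    fix A B f assume A: "A \<in> Obj C" and B: "B \<in> Obj C" and f: "f \<in> Hom C A B"
    have aF: "a (?F A) \<in> Obj C" "a (?F B) \<in> Obj C"
      using A B by (simp_all add: a obj)
    have Ff: "on_arr F A B f \<in> Hom D (?F A) (?F B)"
      using A B f by (rule arr)
    let ?i = "pre (a (?F A)) (a (?F B)) (c (?F A) (?F B) (on_arr F A B f))"
    have i: "?i \<in> Hom C (a (?F A)) (a (?F B))"
      using aF Ff by (intro pre_hom c) (auto simp: A B obj)
    have "on_arr F (a (?F A)) B (cmp C (a (?F A)) (a (?F B)) B (h B) ?i) =
        on_arr F (a (?F A)) B (cmp C (a (?F A)) A B f (h A))"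
      using A B f aF i h Ff
      by (simp add: F.arr_cmp[where B = A] F.arr_cmp[where B = "a (?F B)"] F_pre c obj e_c)
    then have "cmp C (a (?F A)) (a (?F B)) B (h B) ?i = cmp C (a (?F A)) A B f (h A)"
      using A B f aF i h
      by (intro F_inj[of "a (?F A)" B] F.source.cmp_hom[where B = A]
          F.source.cmp_hom[where B = "a (?F B)"]) auto
    then show "cmp C (on_obj (comp_cat_map G F) A) (on_obj (comp_cat_map G F) B)
        (on_obj id_cat_map B) (h B) (on_arr (comp_cat_map G F) A B f) =
      cmp C (on_obj (comp_cat_map G F) A) (on_obj id_cat_map A) (on_obj id_cat_map B)
        (on_arr id_cat_map A B f) (h A)"
      by (simp add: comp_cat_map_def id_cat_map_def G_def)
  qed
  with eps G_functor assms(1) show ?thesis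
    unfolding cat_equivalence_def by blast
qed

text \<open>
  Whether \<open>X\<close> satisfies \<open>Q\<close> can be tested on any object isomorphic to \<open>X\<close>, in particular on one in the
  image of \<open>F\<close>.
\<close>

lemma equivalence_of_full_subcategories:
  assumes "cat_functor C D F"
    and "\<And>A B. A \<in> Obj C \<Longrightarrow> B \<in> Obj C \<Longrightarrow>
      bij_betw (on_arr F A B) (Hom C A B) (Hom D (on_obj F A) (on_obj F B))"
    and "\<And>X. X \<in> Obj D \<Longrightarrow> \<exists>A \<in> Obj C. \<exists>f. cat_iso D (on_obj F A) X f"
    and PQ: "\<And>A. A \<in> Obj C \<Longrightarrow> P A \<longleftrightarrow> Q (on_obj F A)"
    and iso: "\<And>X Y f. X \<in> Obj D \<Longrightarrow> Y \<in> Obj D \<Longrightarrow> cat_iso D X Y f \<Longrightarrow> Q Y \<Longrightarrow> Q X"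
  shows "cat_equivalence (full_subcategory C P) (full_subcategory D Q) F"
proof (rule equivalence_if_fully_faithful_ess_surj)
  show "cat_functor (full_subcategory C P) (full_subcategory D Q) F"
    using assms(1) PQ by (intro cat_functor_full_subcategory) auto
next
  fix X assume "X \<in> Obj (full_subcategory D Q)"
  then have X: "X \<in> Obj D" "Q X" by auto
  then obtain A f where A: "A \<in> Obj C" "cat_iso D (on_obj F A) X f"
    using assms(3) by blast
  then have "Q (on_obj F A)"
    using iso[OF cat_functor.obj[OF assms(1)]] X by blast
  with A PQ show "\<exists>A \<in> Obj (full_subcategory C P). \<exists>f. cat_iso (full_subcategory D Q) (on_obj F A) X f"
    by auto
qed (use assms(2) in simp)

section \<open>The category of representations\<close>

lemma
  assumes "is_rep G M"
  shows rep_space: "x \<in> verts G \<Longrightarrow> complex_space (space M x)"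
    and rep_fin_dim: "x \<in> verts G \<Longrightarrow> vectorspace.fin_dim class_ring (space M x)"
    and rep_map: "a \<in> arcs G \<Longrightarrow> linmap M a \<in> lin (space M (tail G a)) (space M (head G a))"
    and rep_support: "finite {x \<in> verts G. carrier (space M x) \<noteq> {\<zero>\<^bsub>space M x\<^esub>}}"
  using assms by (simp_all add: is_rep_def complex_space_def)

lemma rep_homD:
  assumes "f \<in> rep_hom G M N"
  shows "f \<in> extensional (verts G)"
    and "x \<in> verts G \<Longrightarrow> f x \<in> extensional (carrier (space M x))"
    and "x \<in> verts G \<Longrightarrow> f x \<in> lin (space M x) (space N x)"
    and "a \<in> arcs G \<Longrightarrow> m \<in> carrier (space M (tail G a)) \<Longrightarrow>
      f (head G a) (linmap M a m) = linmap N a (f (tail G a) m)"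
  using assms by (auto simp: rep_hom_def)

lemma rep_hom_closed:
  "f \<in> rep_hom G M N \<Longrightarrow> x \<in> verts G \<Longrightarrow> m \<in> carrier (space M x) \<Longrightarrow> f x m \<in> carrier (space N x)"
  by (rule lin_closed[OF rep_homD(3)])

lemma rep_hom_eqI:
  assumes "f \<in> rep_hom G M N" "g \<in> rep_hom G M' N'"
    and "\<And>x. x \<in> verts G \<Longrightarrow> space M x = space M' x"
    and "\<And>x m. x \<in> verts G \<Longrightarrow> m \<in> carrier (space M x) \<Longrightarrow> f x m = g x m"
  shows "f = g"
proof (rule extensionalityI[OF rep_homD(1)[OF assms(1)] rep_homD(1)[OF assms(2)]])
  fix x assume x: "x \<in> verts G"
  show "f x = g x"
    by (rule extensionalityI[of _ "carrier (space M x)"])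
      (use assms x rep_homD(2)[OF assms(1) x] rep_homD(2)[OF assms(2) x] in auto)
qed

lemma (in wf_digraph) rep_id_hom:
  assumes "is_rep G M"
  shows "rep_id G M \<in> rep_hom G M M"
proof -
  have "restrict (\<lambda>m. m) (carrier (space M x)) \<in> lin (space M x) (space M x)" if "x \<in> verts G" for x
    by (rule lin_cong[OF lin_id rep_space[OF assms that]]) simp
  then show ?thesis
    using lin_closed[OF rep_map[OF assms]] by (auto simp: rep_hom_def rep_id_def)
qed

lemma (in wf_digraph) rep_comp_hom:
  assumes "is_rep G L" "f \<in> rep_hom G L M" "g \<in> rep_hom G M N"
  shows "rep_comp G L g f \<in> rep_hom G L N"
proof -
  have "restrict (\<lambda>m. g x (f x m)) (carrier (space L x)) \<in> lin (space L x) (space N x)"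
    if "x \<in> verts G" for x
    by (rule lin_cong[OF lin_comp[OF rep_homD(3)[OF assms(2) that] rep_homD(3)[OF assms(3) that]]
          rep_space[OF assms(1) that]]) simp
  then show ?thesis
    unfolding rep_hom_def rep_comp_def compose_def
    using lin_closed[OF rep_map[OF assms(1)]] rep_hom_closed[OF assms(2)]
    by (auto simp: rep_homD(4)[OF assms(2)] rep_homD(4)[OF assms(3)])
qed

lemma (in wf_digraph) category_rep: "category (rep_category G)"
  apply (rule category.intro)
      apply (auto simp: rep_category_def rep_id_hom intro: rep_comp_hom)
  subgoal by (rule rep_hom_eqI[OF rep_comp_hom[OF _ _ rep_id_hom]]) (auto simp: rep_comp_def rep_id_def compose_def rep_hom_closed)
  subgoal by (rule rep_hom_eqI[OF rep_comp_hom[OF _ rep_id_hom]]) (auto simp: rep_comp_def rep_id_def compose_def)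
  subgoal by (auto simp: rep_comp_def compose_def fun_eq_iff rep_hom_closed)
  done

section \<open>Representations with idempotents\<close>

lemma
  assumes "is_idem_rep G N"
  shows idem_rep: "is_rep G (und N)"
    and idem_lin: "x \<in> verts G \<Longrightarrow> idem N x i \<in> lin (space (und N) x) (space (und N) x)"
    and idem_orth: "x \<in> verts G \<Longrightarrow> i \<noteq> k \<Longrightarrow> m \<in> carrier (space (und N) x) \<Longrightarrow>
      idem N x i (idem N x k m) = \<zero>\<^bsub>space (und N) x\<^esub>"
    and idem_finite: "x \<in> verts G \<Longrightarrow>
      finite {i. \<exists>m \<in> carrier (space (und N) x). idem N x i m \<noteq> \<zero>\<^bsub>space (und N) x\<^esub>}"
    and idem_sum: "x \<in> verts G \<Longrightarrow> m \<in> carrier (space (und N) x) \<Longrightarrow>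
      finsum (space (und N) x) (\<lambda>i. idem N x i m)
        {i. \<exists>m \<in> carrier (space (und N) x). idem N x i m \<noteq> \<zero>\<^bsub>space (und N) x\<^esub>} = m"
  using assms by (auto simp: is_idem_rep_def Let_def)

lemma idem_closed:
  "is_idem_rep G N \<Longrightarrow> x \<in> verts G \<Longrightarrow> m \<in> carrier (space (und N) x) \<Longrightarrow>
    idem N x i m \<in> carrier (space (und N) x)"
  by (rule lin_closed[OF idem_lin])

lemma idem_ext:
  assumes N: "is_idem_rep G N" "x \<in> verts G"
    and m: "m \<in> carrier (space (und N) x)" "m' \<in> carrier (space (und N) x)"
    and eq: "\<And>i. idem N x i m = idem N x i m'"
  shows "m = m'"
proof -
  let ?V = "space (und N) x"
  let ?I = "{i. \<exists>m \<in> carrier ?V. idem N x i m \<noteq> \<zero>\<^bsub>?V\<^esub>}"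
  have "m = finsum ?V (\<lambda>i. idem N x i m) ?I"
    by (rule idem_sum[OF N m(1), symmetric])
  also have "\<dots> = finsum ?V (\<lambda>i. idem N x i m') ?I"
    by (simp only: eq)
  also have "\<dots> = m'"
    by (rule idem_sum[OF N m(2)])
  finally show ?thesis .
qed

text \<open>Apply \<open>e\<^sub>i\<close> to \<open>m = \<Sum>\<^sub>k e\<^sub>k m\<close>: by orthogonality only the term \<open>e\<^sub>i e\<^sub>i m\<close> survives.\<close>

lemma idem_idem:
  assumes N: "is_idem_rep G N" "x \<in> verts G" and m: "m \<in> carrier (space (und N) x)"
  shows "idem N x i (idem N x i m) = idem N x i m"
proof (rule idem_ext[OF N])
  let ?V = "space (und N) x"
  let ?I = "{i. \<exists>m \<in> carrier ?V. idem N x i m \<noteq> \<zero>\<^bsub>?V\<^esub>}"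
  interpret complex_space ?V
    by (rule rep_space[OF idem_rep[OF N(1)] N(2)])
  have cl: "idem N x i m \<in> carrier ?V" if "m \<in> carrier ?V" for i m
    by (rule idem_closed[OF N that])
  show "idem N x k (idem N x i (idem N x i m)) = idem N x k (idem N x i m)" for k
  proof (cases "k = i")
    case False
    then show ?thesis
      using m cl by (simp add: idem_orth[OF N])
  next
    case True
    have eq: "idem N x i m' = idem N x i (idem N x i m')" if m': "m' \<in> carrier ?V" for m'
    proof (cases "i \<in> ?I")
      case True
      have "idem N x i m' = idem N x i (finsum ?V (\<lambda>k. idem N x k m') ?I)"
        using idem_sum[OF N m'] by simp
      also have "\<dots> = finsum ?V (\<lambda>k. idem N x i (idem N x k m')) ?I"
        using m' cl by (intro lin_finsum idem_lin[OF N] complex_space_axioms) auto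
      also have "\<dots> = finsum ?V (\<lambda>k. if i = k then idem N x i (idem N x k m') else \<zero>\<^bsub>?V\<^esub>) ?I"
        using m' cl by (intro finsum_cong') (auto simp: idem_orth[OF N])
      also have "\<dots> = idem N x i (idem N x i m')"
        using m' cl True by (intro finsum_singleton idem_finite[OF N]) auto
      finally show ?thesis .
    next
      case False
      then show ?thesis
        using m' cl by auto
    qed
    show ?thesis
      using eq m cl True by metis
  qed
qed (use m idem_closed[OF N] in auto)

lemma idem_homD:
  assumes "f \<in> idem_hom G N N'"
  shows "f \<in> rep_hom G (und N) (und N')"
    and "x \<in> verts G \<Longrightarrow> m \<in> carrier (space (und N) x) \<Longrightarrow> f x (idem N x i m) = idem N' x i (f x m)"
  using assms by (auto simp: idem_hom_def)

lemma (in wf_digraph) category_mod_idem: "category (mod_idem G)"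
proof -
  have 1: "rep_id G (und N) \<in> idem_hom G N N" if "is_idem_rep G N" for N
    using rep_id_hom[OF idem_rep[OF that]] idem_closed[OF that]
    by (auto simp: idem_hom_def rep_id_def)
  have 2: "rep_comp G (und L) g f \<in> idem_hom G L N"
    if "is_idem_rep G L" "f \<in> idem_hom G L M" "g \<in> idem_hom G M N" for L M N f g
    using rep_comp_hom[OF idem_rep[OF that(1)] idem_homD(1)[OF that(2)] idem_homD(1)[OF that(3)]]
      idem_closed[OF that(1)] rep_hom_closed[OF idem_homD(1)[OF that(2)]]
    by (auto simp: idem_hom_def rep_comp_def compose_def idem_homD(2)[OF that(2)]
        idem_homD(2)[OF that(3)])
  interpret rep: category "rep_category G"
    by (rule category_rep)
  show ?thesis
  proof (rule category.intro)
    fix L M f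
    assume "L \<in> Obj (mod_idem G)" "M \<in> Obj (mod_idem G)" "f \<in> Hom (mod_idem G) L M"
    then have LM: "is_rep G (und L)" "is_rep G (und M)" "f \<in> rep_hom G (und L) (und M)"
      by (auto simp: mod_idem_def idem_rep idem_homD)
    show "cmp (mod_idem G) L M M (idn (mod_idem G) M) f = f"
      "cmp (mod_idem G) L L M f (idn (mod_idem G) L) = f"
      using rep.idn_left[of "und L" "und M" f] rep.idn_right[of "und L" "und M" f] LM
      by (simp_all add: rep_category_def mod_idem_def)
  next
    fix K L M N f g h
    assume "K \<in> Obj (mod_idem G)" "L \<in> Obj (mod_idem G)" "M \<in> Obj (mod_idem G)"
      "N \<in> Obj (mod_idem G)" "f \<in> Hom (mod_idem G) K L" "g \<in> Hom (mod_idem G) L M"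
      "h \<in> Hom (mod_idem G) M N"
    then show "cmp (mod_idem G) K M N h (cmp (mod_idem G) K L M g f) =
        cmp (mod_idem G) K L N (cmp (mod_idem G) L M N h g) f"
      using rep.cmp_assoc[of "und K" "und L" "und M" "und N" f g h]
      by (auto simp: rep_category_def mod_idem_def idem_rep idem_homD)
  qed (use 1 2 in \<open>auto simp: mod_idem_def\<close>)
qed

text \<open>
  Every vector is the sum of its images under the idempotents.
\<close>

lemma idem_lin_ext:
  assumes N: "is_idem_rep G N" "x \<in> verts G" and W: "complex_space W"
    and f: "f \<in> lin (space (und N) x) W" "f' \<in> lin (space (und N) x) W"
    and eq: "\<And>j m. m \<in> carrier (space (und N) x) \<Longrightarrow> f (idem N x j m) = f' (idem N x j m)"
    and m: "m \<in> carrier (space (und N) x)"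
  shows "f m = f' m"
proof -
  let ?V = "space (und N) x"
  let ?I = "{i. \<exists>m \<in> carrier ?V. idem N x i m \<noteq> \<zero>\<^bsub>?V\<^esub>}"
  note V = rep_space[OF idem_rep[OF N(1)] N(2)]
  have e: "(\<lambda>i. idem N x i m) \<in> ?I \<rightarrow> carrier ?V"
    using idem_closed[OF N m] by auto
  have "f m = finsum W (\<lambda>i. f (idem N x i m)) ?I"
    using lin_finsum[OF V W f(1) e] idem_sum[OF N m] by simp
  also have "\<dots> = finsum W (\<lambda>i. f' (idem N x i m)) ?I"
    by (simp only: eq[OF m])
  also have "\<dots> = f' m"
    using lin_finsum[OF V W f(2) e] idem_sum[OF N m] by simp
  finally show ?thesis .
qed

text \<open>
  The inverse maps again commute with the arrows and the idempotents: apply the injective \<open>f\<close> to both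
  sides.
\<close>

lemma (in wf_digraph) idem_hom_bij_iso:
  assumes N: "is_idem_rep G N" and N': "is_idem_rep G N'" and f: "f \<in> idem_hom G N N'"
    and bij: "\<And>x. x \<in> verts G \<Longrightarrow>
      bij_betw (f x) (carrier (space (und N) x)) (carrier (space (und N') x))"
  shows "\<exists>g. cat_iso (mod_idem G) N' N g"
proof -
  note fr = idem_homD(1)[OF f]
  let ?V = "\<lambda>x. space (und N) x" and ?V' = "\<lambda>x. space (und N') x"
  define g where "g = (\<lambda>x\<in>verts G. \<lambda>m\<in>carrier (?V' x). inv_into (carrier (?V x)) (f x) m)"
  have g: "g x m \<in> carrier (?V x)" "f x (g x m) = m"
    if "x \<in> verts G" "m \<in> carrier (?V' x)" for x m
    using that bij_betw_imp_surj_on[OF bij[OF that(1)]]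
    by (auto simp: g_def inv_into_into f_inv_into_f)
  have f_inj: "m = m'"
    if "x \<in> verts G" "m \<in> carrier (?V x)" "m' \<in> carrier (?V x)" "f x m = f x m'" for x m m'
    using bij_betw_imp_inj_on[OF bij[OF that(1)]] that(2-4) by (auto dest: inj_onD)
  note f_closed = rep_hom_closed[OF fr]
  have "g \<in> rep_hom G (und N') (und N)"
    unfolding rep_hom_def
  proof (intro CollectI conjI ballI)
    fix x assume x: "x \<in> verts G"
    interpret V: complex_space "?V x" by (rule rep_space[OF idem_rep[OF N] x])
    interpret V': complex_space "?V' x" by (rule rep_space[OF idem_rep[OF N'] x])
    note flin = rep_homD(3)[OF fr x]
    show "g x \<in> lin (?V' x) (?V x)"
      by (rule linI; (rule f_inj[OF x])?) (simp_all add: g x lin_add[OF flin] lin_scale[OF flin])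
  next
    fix a m assume a: "a \<in> arcs G" and m: "m \<in> carrier (?V' (tail G a))"
    then have ht: "head G a \<in> verts G" "tail G a \<in> verts G"
      by auto
    note am = lin_closed[OF rep_map[OF idem_rep[OF N'] a] m]
      and ga = lin_closed[OF rep_map[OF idem_rep[OF N] a] g(1)[OF ht(2) m]]
    show "g (head G a) (linmap (und N') a m) = linmap (und N) a (g (tail G a) m)"
      by (rule f_inj[OF ht(1) g(1)[OF ht(1) am] ga])
        (simp add: g(2)[OF ht(1) am] rep_homD(4)[OF fr a g(1)[OF ht(2) m]] g(2)[OF ht(2) m])
  qed (auto simp: g_def)
  moreover have "g x (idem N' x i m) = idem N x i (g x m)"
    if x: "x \<in> verts G" and m: "m \<in> carrier (?V' x)" for x i m
  proof -
    note im = idem_closed[OF N' x m, of i] and ig = idem_closed[OF N x g(1)[OF x m], of i]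
    show ?thesis
      by (rule f_inj[OF x g(1)[OF x im] ig]) (simp add: g(2)[OF x im] idem_homD(2)[OF f x g(1)[OF x m]] g(2)[OF x m])
  qed
  ultimately have gh: "g \<in> idem_hom G N' N"
    by (auto simp: idem_hom_def)
  note gr = idem_homD(1)[OF gh]
  have "rep_comp G (und N') f g = rep_id G (und N')"
    by (rule rep_hom_eqI[OF rep_comp_hom[OF idem_rep[OF N'] gr fr] rep_id_hom[OF idem_rep[OF N']]])
      (simp_all add: rep_comp_def rep_id_def compose_def g(2))
  moreover have "rep_comp G (und N) g f = rep_id G (und N)"
  proof (rule rep_hom_eqI[OF rep_comp_hom[OF idem_rep[OF N] fr gr] rep_id_hom[OF idem_rep[OF N]]])
    fix x m assume x: "x \<in> verts G" and m: "m \<in> carrier (?V x)"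
    have "g x (f x m) = m"
      by (rule f_inj[OF x g(1)[OF x f_closed[OF x m]] m g(2)[OF x f_closed[OF x m]]])
    then show "rep_comp G (und N) g f x m = rep_id G (und N) x m"
      using x m by (simp add: rep_comp_def rep_id_def compose_def)
  qed simp
  ultimately have "cat_iso (mod_idem G) N' N g"
    using gh f by (auto simp: cat_iso_def mod_idem_def)
  then show ?thesis by blast
qed

section \<open>The annihilator of a representation\<close>

text \<open>
  In a product with a path only one way of cutting the path \<open>w\<close> contributes, namely the one that splits
  off \<open>p\<close>.
\<close>

lemma path_elem_mult_left:
  "path_mult G (path_elem u p) r (s, w) =
    (if drop (length w - length p) w = p \<and>
        last (pre_digraph.awalk_verts G s (take (length w - length p) w)) = u
     then r (s, take (length w - length p) w) else 0)"
proof -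
  let ?l = "length w - length p"
  let ?v = "\<lambda>k. last (pre_digraph.awalk_verts G s (take k w))"
  let ?c = "if drop ?l w = p \<and> ?v ?l = u then r (s, take ?l w) else 0"
  have cut: "k = ?l" if "k \<le> length w" "drop k w = p" for k
  proof -
    have "length p = length w - k"
      unfolding that(2)[symmetric] by (rule length_drop)
    with that(1) show ?thesis by linarith
  qed
  have "path_mult G (path_elem u p) r (s, w) =
      (\<Sum>k\<le>length w. (if ?v k = u \<and> drop k w = p then 1 else 0) * r (s, take k w))"
    by (simp add: path_mult_def path_elem_def)
  also have "\<dots> = (\<Sum>k\<le>length w. if k = ?l then ?c else 0)"
  proof (intro sum.cong refl)
    fix k assume k: "k \<in> {..length w}"
    have pull: "(if a \<and> b then 1 else 0) * c = (if b \<and> a then c else 0)" for a b and c :: complex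
      by simp
    show "(if ?v k = u \<and> drop k w = p then 1 else 0) * r (s, take k w) =
        (if k = ?l then ?c else 0)"
    proof (cases "k = ?l")
      case True
      then show ?thesis
        by (simp only: pull if_True simp_thms)
    next
      case False
      then have "drop k w \<noteq> p"
        using cut[of k] k by blast
      with False show ?thesis
        by simp
    qed
  qed
  also have "\<dots> = ?c"
    by (simp add: sum.delta)
  finally show ?thesis .
qed

lemma path_elem_mult_right:
  "path_mult G r (path_elem u p) (s, w) =
    (if s = u \<and> take (length p) w = p
     then r (last (pre_digraph.awalk_verts G s p), drop (length p) w) else 0)"
proof -
  let ?l = "length p"
  let ?c = "if s = u \<and> take ?l w = p
    then r (last (pre_digraph.awalk_verts G s p), drop ?l w) else 0"
  have cut: "k = ?l" if "k \<le> length w" "take k w = p" for k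
  proof -
    have "length p = min (length w) k"
      unfolding that(2)[symmetric] by (rule length_take)
    with that(1) show ?thesis by linarith
  qed
  have "path_mult G r (path_elem u p) (s, w) =
      (\<Sum>k\<le>length w. r (last (pre_digraph.awalk_verts G s (take k w)), drop k w) *
        (if s = u \<and> take k w = p then 1 else 0))"
    by (simp add: path_mult_def path_elem_def)
  also have "\<dots> = (\<Sum>k\<le>length w. if k = ?l then ?c else 0)"
  proof (intro sum.cong refl)
    fix k assume k: "k \<in> {..length w}"
    then show "r (last (pre_digraph.awalk_verts G s (take k w)), drop k w) *
        (if s = u \<and> take k w = p then 1 else 0) = (if k = ?l then ?c else 0)"
      using cut[of k] by (cases "k = ?l") auto
  qed
  also have "\<dots> = ?c"
    using cut[of ?l] by (cases "?l \<le> length w") (auto simp: sum.delta)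
  finally show ?thesis .
qed

lemma path_elem_expansion:
  assumes "finite {x. b x \<noteq> 0}"
  shows "b x = (\<Sum>y | b y \<noteq> 0. b y * path_elem (fst y) (snd y) x)"
  using assms by (simp add: path_elem_def if_distrib[of "\<lambda>c. _ * c"] sum.delta cong: if_cong)

lemma path_mult_expand_left:
  assumes "finite {x. b x \<noteq> 0}"
  shows "path_mult G b r = (\<lambda>x. \<Sum>y | b y \<noteq> 0. b y * path_mult G (path_elem (fst y) (snd y)) r x)"
proof
  fix x :: "'a \<times> 'b list"
  obtain s w where [simp]: "x = (s, w)" by force
  show "path_mult G b r x = (\<Sum>y | b y \<noteq> 0. b y * path_mult G (path_elem (fst y) (snd y)) r x)"
    by (simp add: path_mult_def path_elem_expansion[OF assms, of "(_, _)"] sum_distrib_left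
        sum_distrib_right mult.assoc sum.swap[of _ "{..length w}"])
qed

lemma path_mult_expand_right:
  assumes "finite {x. b x \<noteq> 0}"
  shows "path_mult G r b = (\<lambda>x. \<Sum>y | b y \<noteq> 0. b y * path_mult G r (path_elem (fst y) (snd y)) x)"
proof
  fix x :: "'a \<times> 'b list"
  obtain s w where [simp]: "x = (s, w)" by force
  show "path_mult G r b x = (\<Sum>y | b y \<noteq> 0. b y * path_mult G r (path_elem (fst y) (snd y)) x)"
    by (simp add: path_mult_def path_elem_expansion[OF assms, of "(_, _)"] sum_distrib_left
        sum_distrib_right mult.left_commute sum.swap[of _ "{..length w}"])
qed

lemma path_algebra_finite: "r \<in> path_algebra G \<Longrightarrow> finite {x. r x \<noteq> 0}"
  by (simp add: path_algebra_def)

lemma path_algebra_awalk: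
  "r \<in> path_algebra G \<Longrightarrow> r (s, p) \<noteq> 0 \<Longrightarrow> \<exists>t. pre_digraph.awalk G s p t"
  by (auto simp: path_algebra_def)

lemma path_algebra_finite_paths:
  assumes "r \<in> path_algebra G"
  shows "finite {p. P p \<and> r (s, p) \<noteq> 0}"
proof (rule finite_subset)
  show "{p. P p \<and> r (s, p) \<noteq> 0} \<subseteq> snd ` {x. r x \<noteq> 0}"
    by force
qed (use path_algebra_finite[OF assms] in auto)

context wf_digraph
begin

lemma fold_linmap_lin:
  assumes "is_rep G M" "awalk s p t"
  shows "fold (linmap M) p \<in> lin (space M s) (space M t)"
  using assms(2)
proof (induction p arbitrary: s)
  case Nil
  then show ?case
    by (simp add: awalk_Nil_iff id_def lin_id)
next
  case (Cons a p)
  then have "a \<in> arcs G" "s = tail G a" "fold (linmap M) p \<in> lin (space M (head G a)) (space M t)"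
    by (auto simp: awalk_Cons_iff)
  then show ?case
    using lin_comp[OF rep_map[OF assms(1)]] by (simp add: comp_def)
qed

lemma fold_linmap_closed:
  "is_rep G M \<Longrightarrow> awalk s p t \<Longrightarrow> m \<in> carrier (space M s) \<Longrightarrow>
    fold (linmap M) p m \<in> carrier (space M t)"
  by (rule lin_closed[OF fold_linmap_lin])

text \<open>
  The evaluation may be computed over any finite set of paths that contains the support; two
  evaluations can thus be compared as sums over the same set.
\<close>

lemma path_eval_eq:
  assumes M: "is_rep G M" and t: "t \<in> verts G" and m: "m \<in> carrier (space M s)" and "finite P"
    and P: "\<And>p. p \<in> P \<Longrightarrow> awalk s p t" and r: "\<And>p. awalk s p t \<Longrightarrow> r (s, p) \<noteq> 0 \<Longrightarrow> p \<in> P"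
  shows "path_eval G M r s t m =
    finsum (space M t) (\<lambda>p. r (s, p) \<odot>\<^bsub>space M t\<^esub> fold (linmap M) p m) P"
proof -
  interpret complex_space "space M t"
    by (rule rep_space[OF M t])
  have cl: "fold (linmap M) p m \<in> carrier (space M t)" if "p \<in> P" for p
    using fold_linmap_closed[OF M P[OF that] m] .
  show ?thesis
    unfolding path_eval_def
    by (rule add.finprod_mono_neutral_cong_left) (use assms cl in auto)
qed

lemma path_eval_zero_coeffs:
  assumes "is_rep G M" "t \<in> verts G" "m \<in> carrier (space M s)"
    and "\<And>p. awalk s p t \<Longrightarrow> r (s, p) = 0"
  shows "path_eval G M r s t m = \<zero>\<^bsub>space M t\<^esub>"
proof -
  interpret complex_space "space M t"
    using assms by (intro rep_space)
  show ?thesis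
    using assms by (subst path_eval_eq[where P = "{}"]) auto
qed

definition annihilator :: "('a, 'b, 'u) rep \<Rightarrow> ('a \<times> 'b list \<Rightarrow> complex) set" where
  "annihilator M = {r \<in> path_algebra G. satisfies G M r}"

lemma annihilatorI:
  assumes "r \<in> path_algebra G"
    and "\<And>s t m. s \<in> verts G \<Longrightarrow> t \<in> verts G \<Longrightarrow> m \<in> carrier (space M s) \<Longrightarrow>
      path_eval G M r s t m = \<zero>\<^bsub>space M t\<^esub>"
  shows "r \<in> annihilator M"
  using assms by (simp add: annihilator_def satisfies_def)

lemma annihilatorD:
  assumes "r \<in> annihilator M"
  shows "r \<in> path_algebra G"
    and "s \<in> verts G \<Longrightarrow> t \<in> verts G \<Longrightarrow> m \<in> carrier (space M s) \<Longrightarrow>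
      path_eval G M r s t m = \<zero>\<^bsub>space M t\<^esub>"
  using assms by (simp_all add: annihilator_def satisfies_def)

lemma annihilator_zero: "is_rep G M \<Longrightarrow> (\<lambda>_. 0) \<in> annihilator M"
  by (intro annihilatorI path_eval_zero_coeffs) (auto simp: path_algebra_def)

lemma annihilator_lincomb:
  assumes M: "is_rep G M" and r: "r \<in> annihilator M" "r' \<in> annihilator M"
  shows "(\<lambda>x. c * r x + c' * r' x) \<in> annihilator M"
proof (rule annihilatorI)
  note alg = annihilatorD(1)[OF r(1)] annihilatorD(1)[OF r(2)]
  have sub: "{x. c * r x + c' * r' x \<noteq> 0} \<subseteq> {x. r x \<noteq> 0} \<union> {x. r' x \<noteq> 0}"
    by auto
  have "\<exists>t. awalk s p t" if "c * r (s, p) + c' * r' (s, p) \<noteq> 0" for s p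
    using that path_algebra_awalk[OF alg(1), of s p] path_algebra_awalk[OF alg(2), of s p] by force
  then show "(\<lambda>x. c * r x + c' * r' x) \<in> path_algebra G"
    unfolding path_algebra_def
    using finite_subset[OF sub] alg[THEN path_algebra_finite] by auto
next
  fix s t m assume st: "s \<in> verts G" "t \<in> verts G" and m: "m \<in> carrier (space M s)"
  interpret complex_space "space M t"
    by (rule rep_space[OF M st(2)])
  note alg = annihilatorD(1)[OF r(1)] annihilatorD(1)[OF r(2)]
  define P where "P = {p. awalk s p t \<and> r (s, p) \<noteq> 0} \<union> {p. awalk s p t \<and> r' (s, p) \<noteq> 0}"
  have fin: "finite P"
    using path_algebra_finite_paths[OF alg(1)] path_algebra_finite_paths[OF alg(2)]
    by (simp add: P_def)
  have walk: "awalk s p t" if "p \<in> P" for p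
    using that by (auto simp: P_def)
  let ?f = "\<lambda>p. fold (linmap M) p m"
  have cl: "?f p \<in> carrier (space M t)" if "p \<in> P" for p
    using fold_linmap_closed[OF M walk[OF that] m] .
  have eval: "path_eval G M q s t m = finsum (space M t) (\<lambda>p. q (s, p) \<odot>\<^bsub>space M t\<^esub> ?f p) P"
    if "\<And>p. q (s, p) \<noteq> 0 \<Longrightarrow> r (s, p) \<noteq> 0 \<or> r' (s, p) \<noteq> 0" for q
    using that by (intro path_eval_eq M st m fin walk) (auto simp: P_def)
  have "path_eval G M (\<lambda>x. c * r x + c' * r' x) s t m = finsum (space M t)
      (\<lambda>p. c \<odot>\<^bsub>space M t\<^esub> (r (s, p) \<odot>\<^bsub>space M t\<^esub> ?f p) \<oplus>\<^bsub>space M t\<^esub> c' \<odot>\<^bsub>space M t\<^esub> (r' (s, p) \<odot>\<^bsub>space M t\<^esub> ?f p)) P"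
    using cl by (intro trans[OF eval finsum_cong']) (auto simp: scale_left_distrib scale_assoc)
  also have "\<dots> = c \<odot>\<^bsub>space M t\<^esub> path_eval G M r s t m \<oplus>\<^bsub>space M t\<^esub> c' \<odot>\<^bsub>space M t\<^esub> path_eval G M r' s t m"
    using cl by (subst (1 2) eval) (auto simp: scale_finsum finsum_addf)
  also have "\<dots> = \<zero>\<^bsub>space M t\<^esub>"
    using annihilatorD(2)[OF r(1) st m] annihilatorD(2)[OF r(2) st m] by simp
  finally show "path_eval G M (\<lambda>x. c * r x + c' * r' x) s t m = \<zero>\<^bsub>space M t\<^esub>" .
qed

lemma annihilator_sum:
  assumes M: "is_rep G M" and "finite A" and "\<And>y. y \<in> A \<Longrightarrow> r y \<in> annihilator M"
  shows "(\<lambda>x. \<Sum>y\<in>A. c y * r y x) \<in> annihilator M"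
  using assms(2,3)
proof (induction A rule: finite_induct)
  case (insert a A)
  then show ?case
    using annihilator_lincomb[OF M, of "r a" "\<lambda>x. \<Sum>y\<in>A. c y * r y x" "c a" 1] by simp
qed (simp add: annihilator_zero[OF M])

text \<open>
  Acting with the product is acting with \<open>r\<close> first and with the path \<open>p\<close> afterwards, and \<open>r\<close> acts as
  zero.
\<close>

lemma annihilator_path_elem_mult_left:
  assumes M: "is_rep G M" and r: "r \<in> annihilator M" and p: "awalk u p v"
  shows "path_mult G (path_elem u p) r \<in> annihilator M"
proof (rule annihilatorI)
  let ?pr = "path_mult G (path_elem u p) r"
  note alg = annihilatorD(1)[OF r]
  have supp: "\<exists>q. w = q @ p \<and> awalk s q u \<and> r (s, q) \<noteq> 0" if "?pr (s, w) \<noteq> 0" for s w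
  proof -
    define q where "q = take (length w - length p) w"
    have "drop (length w - length p) w = p" "awlast s q = u" "r (s, q) \<noteq> 0"
      using that by (auto simp: path_elem_mult_left q_def split: if_splits)
    moreover from this(1) have "w = q @ p"
      unfolding q_def by (metis append_take_drop_id)
    moreover obtain t where "awalk s q t"
      using path_algebra_awalk[OF alg] calculation by blast
    moreover have "t = u"
      using calculation by auto
    ultimately show ?thesis
      by blast
  qed
  have coeff: "?pr (s, q @ p) = r (s, q)" if "awalk s q u" for s q
    using that by (auto simp: path_elem_mult_left)
  show "?pr \<in> path_algebra G"
    unfolding path_algebra_def
  proof (intro CollectI conjI allI impI)
    have "{x. ?pr x \<noteq> 0} \<subseteq> (\<lambda>(s, q). (s, q @ p)) ` {x. r x \<noteq> 0}"
      using supp by force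
    then show "finite {x. ?pr x \<noteq> 0}"
      using path_algebra_finite[OF alg] finite_surj by blast
    show "\<exists>t. awalk s w t" if "?pr (s, w) \<noteq> 0" for s w
      using supp[OF that] p by (meson awalk_appendI)
  qed
  fix s t m assume st: "s \<in> verts G" "t \<in> verts G" and m: "m \<in> carrier (space M s)"
  show "path_eval G M ?pr s t m = \<zero>\<^bsub>space M t\<^esub>"
  proof (cases "t = v")
    case False
    have "?pr (s, w) = 0" if w: "awalk s w t" for w
    proof (rule ccontr)
      assume "?pr (s, w) \<noteq> 0"
      then obtain q where "w = q @ p" "awalk s q u"
        using supp by blast
      then have "awalk s w v"
        using p by (auto intro: awalk_appendI)
      with w False show False by auto
    qed
    then show ?thesis
      by (intro path_eval_zero_coeffs M st m)
  next
    case True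
    have uv: "u \<in> verts G" "v \<in> verts G"
      using p by auto
    interpret complex_space "space M v"
      by (rule rep_space[OF M uv(2)])
    let ?Q = "{q. awalk s q u \<and> r (s, q) \<noteq> 0}"
    let ?f = "fold (linmap M) p"
    have cl: "fold (linmap M) q m \<in> carrier (space M u)" if "q \<in> ?Q" for q
      using that fold_linmap_closed[OF M _ m] by auto
    have f: "?f \<in> lin (space M u) (space M v)"
      by (rule fold_linmap_lin[OF M p])
    have "path_eval G M ?pr s v m =
        finsum (space M v) (\<lambda>w. ?pr (s, w) \<odot>\<^bsub>space M v\<^esub> fold (linmap M) w m) ((\<lambda>q. q @ p) ` ?Q)"
      using uv supp p path_algebra_finite_paths[OF alg] by (intro path_eval_eq M m) (auto intro: awalk_appendI)
    also have "\<dots> = finsum (space M v) (\<lambda>q. ?pr (s, q @ p) \<odot>\<^bsub>space M v\<^esub> fold (linmap M) (q @ p) m) ?Q"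
      using lin_closed[OF f] cl by (intro finsum_reindex) (auto simp: inj_on_def)
    also have "\<dots> = finsum (space M v) (\<lambda>q. ?f (r (s, q) \<odot>\<^bsub>space M u\<^esub> fold (linmap M) q m)) ?Q"
      using lin_closed[OF f] cl by (intro finsum_cong') (auto simp: coeff lin_scale[OF f])
    also have "\<dots> = ?f (path_eval G M r s u m)"
      unfolding path_eval_def using cl complex_space.scale_closed[OF rep_space[OF M uv(1)]]
      by (intro lin_finsum[symmetric] f rep_space[OF M] uv) auto
    also have "\<dots> = \<zero>\<^bsub>space M v\<^esub>"
      using annihilatorD(2)[OF r st(1) uv(1) m]
      by (simp add: lin_zero[OF rep_space[OF M uv(1)] rep_space[OF M uv(2)] f])
    finally show ?thesis
      using True by simp
  qed
qed

text \<open>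
  Acting with the product is acting with the path \<open>p\<close> first and with \<open>r\<close> afterwards.
\<close>

lemma annihilator_path_elem_mult_right:
  assumes M: "is_rep G M" and r: "r \<in> annihilator M" and p: "awalk u p v"
  shows "path_mult G r (path_elem u p) \<in> annihilator M"
proof (rule annihilatorI)
  let ?rp = "path_mult G r (path_elem u p)"
  note alg = annihilatorD(1)[OF r]
  have last: "awlast u p = v"
    using p by auto
  have supp: "s = u \<and> (\<exists>q. w = p @ q \<and> r (v, q) \<noteq> 0)" if "?rp (s, w) \<noteq> 0" for s w
  proof -
    have "s = u" "take (length p) w = p" "r (v, drop (length p) w) \<noteq> 0"
      using that last by (auto simp: path_elem_mult_right split: if_splits)
    moreover from this(2) have "w = p @ drop (length p) w"
      by (metis append_take_drop_id)
    ultimately show ?thesis by blast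
  qed
  have coeff: "?rp (u, p @ q) = r (v, q)" for q
    by (simp add: path_elem_mult_right last)
  show "?rp \<in> path_algebra G"
    unfolding path_algebra_def
  proof (intro CollectI conjI allI impI)
    have "{x. ?rp x \<noteq> 0} \<subseteq> (\<lambda>(_, q). (u, p @ q)) ` {x. r x \<noteq> 0}"
      using supp by force
    then show "finite {x. ?rp x \<noteq> 0}"
      using path_algebra_finite[OF alg] finite_surj by blast
    show "\<exists>t. awalk s w t" if "?rp (s, w) \<noteq> 0" for s w
      using supp[OF that] path_algebra_awalk[OF alg] p by (meson awalk_appendI)
  qed
  fix s t m assume st: "s \<in> verts G" "t \<in> verts G" and m: "m \<in> carrier (space M s)"
  show "path_eval G M ?rp s t m = \<zero>\<^bsub>space M t\<^esub>"
  proof (cases "s = u")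
    case False
    then show ?thesis
      using supp by (intro path_eval_zero_coeffs M st m) blast
  next
    case True
    have uv: "u \<in> verts G" "v \<in> verts G"
      using p by auto
    interpret complex_space "space M t"
      by (rule rep_space[OF M st(2)])
    let ?Q = "{q. awalk v q t \<and> r (v, q) \<noteq> 0}"
    have pm: "fold (linmap M) p m \<in> carrier (space M v)"
      using fold_linmap_closed[OF M p] m True by simp
    have cl: "fold (linmap M) q (fold (linmap M) p m) \<in> carrier (space M t)" if "q \<in> ?Q" for q
      using that fold_linmap_closed[OF M _ pm] by auto
    have "path_eval G M ?rp u t m =
        finsum (space M t) (\<lambda>w. ?rp (u, w) \<odot>\<^bsub>space M t\<^esub> fold (linmap M) w m) ((\<lambda>q. p @ q) ` ?Q)"
    proof (rule path_eval_eq[OF M st(2)])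
      show "w \<in> (\<lambda>q. p @ q) ` ?Q" if "awalk u w t" "?rp (u, w) \<noteq> 0" for w
        using supp[OF that(2)] that(1) last by auto
    qed (use m True p path_algebra_finite_paths[OF alg] in \<open>auto intro: awalk_appendI\<close>)
    also have "\<dots> = finsum (space M t) (\<lambda>q. ?rp (u, p @ q) \<odot>\<^bsub>space M t\<^esub> fold (linmap M) (p @ q) m) ?Q"
      using cl by (intro finsum_reindex) (auto simp: inj_on_def)
    also have "\<dots> = path_eval G M r v t (fold (linmap M) p m)"
      by (simp add: path_eval_def coeff)
    also have "\<dots> = \<zero>\<^bsub>space M t\<^esub>"
      by (rule annihilatorD(2)[OF r uv(2) st(2) pm])
    finally show ?thesis
      using True by simp
  qed
qed

text \<open>
  The annihilator is a two-sided ideal. Every element of the path algebra is a linear combination of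
  paths, so that closure under linear combinations and under products with single paths suffices.
\<close>

lemma path_ideal_subset_annihilator:
  assumes M: "is_rep G M" and R: "R \<subseteq> annihilator M"
  shows "path_ideal G R \<subseteq> annihilator M"
proof
  fix r assume "r \<in> path_ideal G R"
  then show "r \<in> annihilator M"
  proof (induction rule: path_ideal.induct)
    case (generator r)
    then show ?case using R by blast
  next
    case zero
    then show ?case by (rule annihilator_zero[OF M])
  next
    case (add r r')
    then show ?case using annihilator_lincomb[OF M, of r r' 1 1] by simp
  next
    case (scale r c)
    then show ?case using annihilator_lincomb[OF M, of r r c 0] by simp
  next
    case (left_mult r b)
    have "path_mult G (path_elem (fst y) (snd y)) r \<in> annihilator M" if "b y \<noteq> 0" for y
      using path_algebra_awalk[OF left_mult(2), of "fst y" "snd y"] that left_mult(3)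
      by (auto intro: annihilator_path_elem_mult_left[OF M])
    then show ?case
      unfolding path_mult_expand_left[OF path_algebra_finite[OF left_mult(2)]]
      by (intro annihilator_sum M path_algebra_finite[OF left_mult(2)]) auto
  next
    case (right_mult r b)
    have "path_mult G r (path_elem (fst y) (snd y)) \<in> annihilator M" if "b y \<noteq> 0" for y
      using path_algebra_awalk[OF right_mult(2), of "fst y" "snd y"] that right_mult(3)
      by (auto intro: annihilator_path_elem_mult_right[OF M])
    then show ?case
      unfolding path_mult_expand_right[OF path_algebra_finite[OF right_mult(2)]]
      by (intro annihilator_sum M path_algebra_finite[OF right_mult(2)]) auto
  qed
qed

lemma satisfies_path_ideal_iff:
  assumes "is_rep G M" "R \<subseteq> path_algebra G"
  shows "(\<forall>r \<in> path_ideal G R. satisfies G M r) \<longleftrightarrow> (\<forall>r \<in> R. satisfies G M r)"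
  using path_ideal_subset_annihilator[OF assms(1), of R] assms(2) path_ideal.generator[of _ R G]
  by (auto simp: annihilator_def)

lemma fold_linmap_hom:
  assumes "is_rep G M" "f \<in> rep_hom G M N" "awalk s p t" "m \<in> carrier (space M s)"
  shows "f t (fold (linmap M) p m) = fold (linmap N) p (f s m)"
  using assms(3,4)
proof (induction p arbitrary: s m)
  case (Cons a p)
  then have "a \<in> arcs G" "s = tail G a" "awalk (head G a) p t"
    by (auto simp: awalk_Cons_iff)
  then show ?case
    using Cons.IH[of "head G a" "linmap M a m"] Cons.prems(2) rep_homD(4)[OF assms(2), of a m]
      lin_closed[OF rep_map[OF assms(1)]] by simp
qed (simp add: awalk_Nil_iff)

lemma path_eval_hom:
  assumes M: "is_rep G M" and N: "is_rep G N" and f: "f \<in> rep_hom G M N"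
    and st: "s \<in> verts G" "t \<in> verts G" and m: "m \<in> carrier (space M s)"
  shows "f t (path_eval G M r s t m) = path_eval G N r s t (f s m)"
proof -
  interpret T: complex_space "space M t" by (rule rep_space[OF M st(2)])
  interpret T': complex_space "space N t" by (rule rep_space[OF N st(2)])
  let ?P = "{p. awalk s p t \<and> r (s, p) \<noteq> 0}"
  note f' = rep_homD(3)[OF f st(2)]
  have cl: "fold (linmap M) p m \<in> carrier (space M t)" if "p \<in> ?P" for p
    using that fold_linmap_closed[OF M _ m] by auto
  have "f t (path_eval G M r s t m) =
      finsum (space N t) (\<lambda>p. f t (r (s, p) \<odot>\<^bsub>space M t\<^esub> fold (linmap M) p m)) ?P"
    unfolding path_eval_def using cl
    by (intro lin_finsum[OF T.complex_space_axioms T'.complex_space_axioms f']) auto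
  also have "\<dots> = path_eval G N r s t (f s m)"
    unfolding path_eval_def using cl fold_linmap_hom[OF M f _ m]
      fold_linmap_closed[OF N _ rep_hom_closed[OF f st(1) m]]
    by (intro T'.finsum_cong') (auto simp: lin_scale[OF f'])
  finally show ?thesis .
qed

text \<open>
  Morphisms commute with the evaluation of \<open>r\<close>, and every vector of \<open>N\<close> is in the image of \<open>f\<close>.
\<close>

lemma satisfies_iso:
  assumes M: "is_rep G M" and N: "is_rep G N" and f: "f \<in> rep_hom G M N"
    and g: "\<And>x m. x \<in> verts G \<Longrightarrow> m \<in> carrier (space N x) \<Longrightarrow> f x (g x m) = m"
    and g_hom: "g \<in> rep_hom G N M" and r: "satisfies G M r"
  shows "satisfies G N r"
  unfolding satisfies_def
proof (intro ballI)
  fix s t m assume st: "s \<in> verts G" "t \<in> verts G" and m: "m \<in> carrier (space N s)"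
  have gm: "g s m \<in> carrier (space M s)"
    by (rule rep_hom_closed[OF g_hom st(1) m])
  have "path_eval G N r s t m = f t (path_eval G M r s t (g s m))"
    by (simp add: path_eval_hom[OF M N f st gm] g[OF st(1) m])
  also have "\<dots> = \<zero>\<^bsub>space N t\<^esub>"
    using r st gm by (simp add: satisfies_def
        lin_zero[OF rep_space[OF M st(2)] rep_space[OF N st(2)] rep_homD(3)[OF f st(2)]])
  finally show "path_eval G N r s t m = \<zero>\<^bsub>space N t\<^esub>" .
qed

text \<open>
  A relation all of whose paths run from \<open>s\<close> to \<open>t\<close> imposes a condition at this pair of vertices only.
\<close>

lemma satisfies_supported_iff:
  assumes M: "is_rep G M" and st: "s \<in> verts G" "t \<in> verts G" and fin: "finite P"
    and P: "\<And>p. p \<in> P \<Longrightarrow> awalk s p t" and r: "\<And>s' p. r (s', p) \<noteq> 0 \<Longrightarrow> s' = s \<and> p \<in> P"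
  shows "satisfies G M r \<longleftrightarrow> (\<forall>m \<in> carrier (space M s).
    finsum (space M t) (\<lambda>p. r (s, p) \<odot>\<^bsub>space M t\<^esub> fold (linmap M) p m) P = \<zero>\<^bsub>space M t\<^esub>)"
proof -
  have other: "path_eval G M r s' t' m = \<zero>\<^bsub>space M t'\<^esub>"
    if "\<not> (s' = s \<and> t' = t)" "t' \<in> verts G" "m \<in> carrier (space M s')" for s' t' m
  proof (rule path_eval_zero_coeffs[OF M that(2,3)])
    fix p assume p: "awalk s' p t'"
    show "r (s', p) = 0"
    proof (rule ccontr)
      assume "r (s', p) \<noteq> 0"
      then have "s' = s" "awalk s p t"
        using r P by blast+
      with p have "t' = t" by auto
      with \<open>s' = s\<close> that(1) show False by simp
    qed
  qed
  have eq: "path_eval G M r s t m =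
      finsum (space M t) (\<lambda>p. r (s, p) \<odot>\<^bsub>space M t\<^esub> fold (linmap M) p m) P"
    if "m \<in> carrier (space M s)" for m
    by (rule path_eval_eq[OF M st(2) that fin P]) (use r in blast)+
  have "satisfies G M r \<longleftrightarrow> (\<forall>m \<in> carrier (space M s). path_eval G M r s t m = \<zero>\<^bsub>space M t\<^esub>)"
  proof
    assume *: "\<forall>m \<in> carrier (space M s). path_eval G M r s t m = \<zero>\<^bsub>space M t\<^esub>"
    show "satisfies G M r"
      unfolding satisfies_def
    proof (intro ballI)
      fix s' t' m assume "s' \<in> verts G" "t' \<in> verts G" "m \<in> carrier (space M s')"
      then show "path_eval G M r s' t' m = \<zero>\<^bsub>space M t'\<^esub>"
        using * other[of s' t' m] by (cases "s' = s \<and> t' = t") auto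
    qed
  qed (use st in \<open>simp add: satisfies_def\<close>)
  then show ?thesis
    by (simp add: eq)
qed

lemma satisfies_monomial_iff:
  assumes M: "is_rep G M" and p: "awalk s p t" and c: "c \<noteq> 0"
  shows "satisfies G M (\<lambda>x. c * path_elem s p x) \<longleftrightarrow>
    (\<forall>m \<in> carrier (space M s). fold (linmap M) p m = \<zero>\<^bsub>space M t\<^esub>)"
proof -
  have st: "s \<in> verts G" "t \<in> verts G"
    using p by auto
  interpret complex_space "space M t"
    by (rule rep_space[OF M st(2)])
  have "satisfies G M (\<lambda>x. c * path_elem s p x) \<longleftrightarrow> (\<forall>m \<in> carrier (space M s).
      finsum (space M t) (\<lambda>q. (c * path_elem s p (s, q)) \<odot>\<^bsub>space M t\<^esub> fold (linmap M) q m) {p} =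
      \<zero>\<^bsub>space M t\<^esub>)"
    by (rule satisfies_supported_iff[OF M st]) (auto simp: p path_elem_def split: if_splits)
  also have "\<dots> \<longleftrightarrow> (\<forall>m \<in> carrier (space M s). c \<odot>\<^bsub>space M t\<^esub> fold (linmap M) p m = \<zero>\<^bsub>space M t\<^esub>)"
    using fold_linmap_closed[OF M p] by (intro ball_cong refl) (simp add: path_elem_def)
  also have "\<dots> \<longleftrightarrow> (\<forall>m \<in> carrier (space M s). fold (linmap M) p m = \<zero>\<^bsub>space M t\<^esub>)"
  proof (intro ball_cong refl)
    fix m assume m: "m \<in> carrier (space M s)"
    let ?w = "fold (linmap M) p m"
    have w: "?w \<in> carrier (space M t)"
      by (rule fold_linmap_closed[OF M p m])
    have "inverse c \<odot>\<^bsub>space M t\<^esub> (c \<odot>\<^bsub>space M t\<^esub> ?w) = ?w"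
      using w c by (simp flip: scale_assoc)
    then show "c \<odot>\<^bsub>space M t\<^esub> ?w = \<zero>\<^bsub>space M t\<^esub> \<longleftrightarrow> ?w = \<zero>\<^bsub>space M t\<^esub>"
      by (metis scale_zero_right)
  qed
  finally show ?thesis .
qed

lemma satisfies_difference_iff:
  assumes M: "is_rep G M" and p: "awalk s p t" "awalk s p' t" "p \<noteq> p'"
  shows "satisfies G M (\<lambda>x. path_elem s p x - path_elem s p' x) \<longleftrightarrow>
    (\<forall>m \<in> carrier (space M s). fold (linmap M) p m = fold (linmap M) p' m)"
proof -
  have st: "s \<in> verts G" "t \<in> verts G"
    using p by auto
  interpret complex_space "space M t"
    by (rule rep_space[OF M st(2)])
  have "satisfies G M (\<lambda>x. path_elem s p x - path_elem s p' x) \<longleftrightarrow> (\<forall>m \<in> carrier (space M s).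
      finsum (space M t) (\<lambda>q. (path_elem s p (s, q) - path_elem s p' (s, q)) \<odot>\<^bsub>space M t\<^esub>
        fold (linmap M) q m) {p, p'} = \<zero>\<^bsub>space M t\<^esub>)"
    by (rule satisfies_supported_iff[OF M st]) (auto simp: p path_elem_def split: if_splits)
  also have "\<dots> \<longleftrightarrow> (\<forall>m \<in> carrier (space M s). fold (linmap M) p m = fold (linmap M) p' m)"
  proof (intro ball_cong refl)
    fix m assume m: "m \<in> carrier (space M s)"
    note w = fold_linmap_closed[OF M p(1) m] fold_linmap_closed[OF M p(2) m]
    have "finsum (space M t) (\<lambda>q. (path_elem s p (s, q) - path_elem s p' (s, q)) \<odot>\<^bsub>space M t\<^esub>
        fold (linmap M) q m) {p, p'} = fold (linmap M) p m \<oplus>\<^bsub>space M t\<^esub> \<ominus>\<^bsub>space M t\<^esub> fold (linmap M) p' m"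
      using w p(3) by (simp add: path_elem_def)
    also have "\<dots> = \<zero>\<^bsub>space M t\<^esub> \<longleftrightarrow> fold (linmap M) p m = fold (linmap M) p' m"
      using w by (metis minus_equality minus_minus r_neg a_comm a_inv_closed)
    finally show "finsum (space M t) (\<lambda>q. (path_elem s p (s, q) - path_elem s p' (s, q)) \<odot>\<^bsub>space M t\<^esub>
        fold (linmap M) q m) {p, p'} = \<zero>\<^bsub>space M t\<^esub> \<longleftrightarrow> fold (linmap M) p m = fold (linmap M) p' m" .
  qed
  finally show ?thesis .
qed

end

section \<open>Graded coverings\<close>

text \<open>
  These axioms say that \<open>y \<mapsto> (Fv y, v y)\<close> and \<open>b \<mapsto> (Fa b, v (head G b))\<close> identify the vertices and the
  arrows of \<open>G\<close> with those of \<open>H\<close> times the integers, an arrow \<open>a\<close> raising the second coordinate by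
  \<open>T a\<close>. In other words, \<open>G\<close> is the covering of \<open>H\<close> defined by the grading \<open>T\<close> of its arrows.
\<close>

locale graded_cover =
  fixes G :: "('w, 'b) pre_digraph" and H :: "('v, 'a) pre_digraph"
    and Fv :: "'w \<Rightarrow> 'v" and Fa :: "'b \<Rightarrow> 'a" and v :: "'w \<Rightarrow> int" and T :: "'a \<Rightarrow> int"
  assumes wf_G: "wf_digraph G" and wf_H: "wf_digraph H"
    and vert: "y \<in> verts G \<Longrightarrow> Fv y \<in> verts H"
    and arc: "b \<in> arcs G \<Longrightarrow> Fa b \<in> arcs H"
    and tail: "b \<in> arcs G \<Longrightarrow> tail H (Fa b) = Fv (tail G b)"
    and head: "b \<in> arcs G \<Longrightarrow> head H (Fa b) = Fv (head G b)"
    and degree: "b \<in> arcs G \<Longrightarrow> v (head G b) = v (tail G b) + T (Fa b)"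
    and ex1_vert: "x \<in> verts H \<Longrightarrow> \<exists>!y. y \<in> verts G \<and> Fv y = x \<and> v y = k"
    and ex1_arc: "a \<in> arcs H \<Longrightarrow> \<exists>!b. b \<in> arcs G \<and> Fa b = a \<and> v (head G b) = k"
begin

sublocale G: wf_digraph G by (rule wf_G)
sublocale H: wf_digraph H by (rule wf_H)

definition lift_vert :: "'v \<Rightarrow> int \<Rightarrow> 'w" where
  "lift_vert x k = (THE y. y \<in> verts G \<and> Fv y = x \<and> v y = k)"

lemma lift_vert:
  assumes "x \<in> verts H"
  shows "lift_vert x k \<in> verts G" "Fv (lift_vert x k) = x" "v (lift_vert x k) = k"
  using theI'[OF ex1_vert[OF assms, of k]] by (simp_all add: lift_vert_def)

lemma vert_eqI:
  "y \<in> verts G \<Longrightarrow> y' \<in> verts G \<Longrightarrow> Fv y = Fv y' \<Longrightarrow> v y = v y' \<Longrightarrow> y = y'"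
  using ex1_vert[OF vert, of y "v y"] by metis

lemma lift_vert_eq: "y \<in> verts G \<Longrightarrow> lift_vert (Fv y) (v y) = y"
  by (rule vert_eqI) (auto simp: lift_vert vert)

definition lift_arc :: "'a \<Rightarrow> 'w \<Rightarrow> 'b" where
  "lift_arc a y = (THE b. b \<in> arcs G \<and> Fa b = a \<and> v (head G b) = v y)"

abbreviation fib :: "'v \<Rightarrow> 'w set" where
  "fib \<equiv> fibre G Fv"

lemma fib_iff: "y \<in> fib x \<longleftrightarrow> y \<in> verts G \<and> Fv y = x"
  by (auto simp: fibre_def)

lemma lift_arc:
  assumes a: "a \<in> arcs H" and y: "y \<in> fib (head H a)"
  shows "lift_arc a y \<in> arcs G" "Fa (lift_arc a y) = a" "head G (lift_arc a y) = y"
    and "tail G (lift_arc a y) \<in> fib (tail H a)" "v (tail G (lift_arc a y)) = v y - T a"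
proof -
  let ?b = "lift_arc a y"
  have b: "?b \<in> arcs G" "Fa ?b = a" "v (head G ?b) = v y"
    using theI'[OF ex1_arc[OF a, of "v y"]] by (simp_all add: lift_arc_def)
  show "?b \<in> arcs G" "Fa ?b = a" by fact+
  show y': "head G ?b = y"
    by (rule vert_eqI) (use b y head[of ?b] in \<open>auto simp: fib_iff\<close>)
  show "tail G ?b \<in> fib (tail H a)"
    using b tail[of ?b] by (auto simp: fib_iff)
  show "v (tail G ?b) = v y - T a"
    using degree[OF b(1)] b(2) y' by simp
qed

lemma lift_arc_eq:
  assumes "b \<in> arcs G" "Fa b = a" "head G b = y"
  shows "lift_arc a y = b"
proof -
  have a: "a \<in> arcs H" "y \<in> fib (head H a)"
    using assms arc head by (auto simp: fib_iff)
  show ?thesis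
    using ex1_arc[OF a(1), of "v y"] lift_arc[OF a] assms by metis
qed

lemma arcs_above:
  assumes "a \<in> arcs H" "y \<in> fib (head H a)"
  shows "{b \<in> arcs G. Fa b = a \<and> head G b = y} = {lift_arc a y}"
proof (intro equalityI subsetI)
  fix b assume "b \<in> {b \<in> arcs G. Fa b = a \<and> head G b = y}"
  then show "b \<in> {lift_arc a y}"
    using lift_arc_eq[of b a y] by simp
qed (use lift_arc(1-3)[OF assms] in simp)

abbreviation \<rho> :: "('w, 'b, 'u) rep \<Rightarrow> ('v, 'a, 'w \<Rightarrow> 'u) idem_rep" where
  "\<rho> \<equiv> rho_obj G H Fv Fa v"

abbreviation total :: "('w, 'b, 'u) rep \<Rightarrow> 'v \<Rightarrow> (complex, 'w \<Rightarrow> 'u) module" where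
  "total M x \<equiv> direct_sum (fib x) (space M)"

lemma space_rho [simp]: "space (und (\<rho> M)) x = total M x"
  by (simp add: rho_obj_def rho_rep_def)

lemma idem_rho: "y \<in> fib x \<Longrightarrow> idem (\<rho> M) x k m y = (if v y = k then m y else \<zero>\<^bsub>space M y\<^esub>)"
  by (simp add: rho_obj_def)

lemma idem_rho_fun: "idem (\<rho> M) x k m = (\<lambda>y\<in>fib x. if v y = k then m y else \<zero>\<^bsub>space M y\<^esub>)"
  by (simp add: rho_obj_def)

lemma total_proj_lin: "y \<in> fib x \<Longrightarrow> (\<lambda>m. m y) \<in> lin (total M x) (space M y)"
  by (rule direct_sum_proj_lin)

context
  fixes M :: "('w, 'b, 'u) rep"
  assumes M: "is_rep G M"
begin

lemma fib_space: "y \<in> fib x \<Longrightarrow> complex_space (space M y)"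
  using rep_space[OF M] by (simp add: fib_iff)

lemma fib_zero: "y \<in> fib x \<Longrightarrow> \<zero>\<^bsub>space M y\<^esub> \<in> carrier (space M y)"
proof -
  assume "y \<in> fib x"
  then interpret complex_space "space M y"
    by (rule fib_space)
  show ?thesis by simp
qed

lemma total_space: "complex_space (total M x)"
  by (rule complex_space_direct_sum) (rule fib_space)

lemma incl_total:
  "y \<in> fib x \<Longrightarrow> u \<in> carrier (space M y) \<Longrightarrow> incl (fib x) (space M) y u \<in> carrier (total M x)"
  by (rule incl_carrier) (rule fib_space)

lemma incl_total_lin: "y \<in> fib x \<Longrightarrow> incl (fib x) (space M) y \<in> lin (space M y) (total M x)"
  by (rule incl_lin) (rule fib_space)

text \<open>
  The finiteness condition in the direct sum is automatic, because \<open>M\<close> has finite total dimension.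
\<close>

lemma total_carrier: "carrier (total M x) = (\<Pi>\<^sub>E y\<in>fib x. carrier (space M y))"
proof -
  have "finite {y \<in> fib x. m y \<noteq> \<zero>\<^bsub>space M y\<^esub>}" if m: "m \<in> (\<Pi>\<^sub>E y\<in>fib x. carrier (space M y))" for m
  proof (rule finite_subset[OF _ rep_support[OF M]], rule subsetI)
    fix y assume "y \<in> {y \<in> fib x. m y \<noteq> \<zero>\<^bsub>space M y\<^esub>}"
    then show "y \<in> {y \<in> verts G. carrier (space M y) \<noteq> {\<zero>\<^bsub>space M y\<^esub>}}"
      using PiE_mem[OF m, of y] by (auto simp: fib_iff)
  qed
  then show ?thesis
    by (auto simp: direct_sum_carrier)
qed

text \<open>
  Exactly one arrow of the covering lies above \<open>a\<close> and ends in \<open>y\<close>, so the sum that defines the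
  component at \<open>y\<close> has a single term.
\<close>

lemma linmap_rho:
  assumes a: "a \<in> arcs H" and m: "m \<in> carrier (total M (tail H a))" and y: "y \<in> fib (head H a)"
  shows "linmap (und (\<rho> M)) a m y = linmap M (lift_arc a y) (m (tail G (lift_arc a y)))"
proof -
  interpret complex_space "space M y"
    by (rule fib_space[OF y])
  let ?b = "lift_arc a y"
  have "linmap M ?b (m (tail G ?b)) \<in> carrier (space M y)"
    using lin_closed[OF rep_map[OF M lift_arc(1)[OF a y]]] lift_arc[OF a y]
      direct_sum_component[OF m] by simp
  then show ?thesis
    using y by (simp add: rho_obj_def rho_rep_def arcs_above[OF a y])
qed

lemma linmap_rho_lin:
  assumes a: "a \<in> arcs H"
  shows "linmap (und (\<rho> M)) a \<in> lin (total M (tail H a)) (total M (head H a))"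
proof (rule lin_direct_sumI[OF _ _ total_space fib_space])
  have comp: "(\<lambda>m. linmap (und (\<rho> M)) a m y) \<in> lin (total M (tail H a)) (space M y)"
    if y: "y \<in> fib (head H a)" for y
  proof (rule lin_cong[OF _ total_space])
    show "(\<lambda>m. linmap M (lift_arc a y) (m (tail G (lift_arc a y)))) \<in>
        lin (total M (tail H a)) (space M y)"
      using lin_comp[OF total_proj_lin[OF lift_arc(4)[OF a y]] rep_map[OF M lift_arc(1)[OF a y]]]
        lift_arc(3)[OF a y] by simp
  qed (rule linmap_rho[OF a _ y])
  then show "(\<lambda>m. linmap (und (\<rho> M)) a m y) \<in> lin (total M (tail H a)) (space M y)"
    if "y \<in> fib (head H a)" for y
    using that .
  show "linmap (und (\<rho> M)) a m \<in> carrier (total M (head H a))" if "m \<in> carrier (total M (tail H a))" for m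
    using lin_closed[OF comp that] unfolding total_carrier
    by (auto simp: rho_obj_def rho_rep_def)
qed

lemma idem_rho_lin: "idem (\<rho> M) x k \<in> lin (total M x) (total M x)"
proof (rule lin_direct_sumI[OF _ _ total_space fib_space])
  fix y assume y: "y \<in> fib x"
  interpret complex_space "space M y"
    by (rule fib_space[OF y])
  show "(\<lambda>m. idem (\<rho> M) x k m y) \<in> lin (total M x) (space M y)"
    using y by (intro linI) (auto simp: idem_rho direct_sum_component)
next
  fix m assume "m \<in> carrier (total M x)"
  then show "idem (\<rho> M) x k m \<in> carrier (total M x)"
    unfolding total_carrier idem_rho_fun by (auto simp: fib_zero)
qed

lemma rep_rho: "is_rep H (und (\<rho> M))"
  unfolding is_rep_def
proof (intro conjI ballI)
  fix x assume "x \<in> verts H"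
  show "vectorspace class_ring (space (und (\<rho> M)) x)"
    using complex_space.vectorspace[OF total_space] by simp
  have "finite {y \<in> fib x. carrier (space M y) \<noteq> {\<zero>\<^bsub>space M y\<^esub>}}"
    by (rule finite_subset[OF _ rep_support[OF M]]) (auto simp: fib_iff)
  then show "vectorspace.fin_dim class_ring (space (und (\<rho> M)) x)"
    using fin_dim_direct_sum[of "fib x" "space M"] fib_space rep_fin_dim[OF M] by (simp add: fib_iff)
next
  fix a assume "a \<in> arcs H"
  then show "linmap (und (\<rho> M)) a \<in>
      lin (space (und (\<rho> M)) (tail H a)) (space (und (\<rho> M)) (head H a))"
    using linmap_rho_lin by simp
next
  have "Fv ` {y \<in> verts G. carrier (space M y) \<noteq> {\<zero>\<^bsub>space M y\<^esub>}} \<supseteq>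
      {x \<in> verts H. carrier (space (und (\<rho> M)) x) \<noteq> {\<zero>\<^bsub>space (und (\<rho> M)) x\<^esub>}}"
  proof
    fix x assume x: "x \<in> {x \<in> verts H. carrier (space (und (\<rho> M)) x) \<noteq> {\<zero>\<^bsub>space (und (\<rho> M)) x\<^esub>}}"
    interpret complex_space "total M x" by (rule total_space)
    obtain m where m: "m \<in> carrier (total M x)" "m \<noteq> \<zero>\<^bsub>total M x\<^esub>"
      using x zero_closed by (auto simp del: direct_sum_simps)
    then obtain y where y: "y \<in> fib x" "m y \<noteq> \<zero>\<^bsub>space M y\<^esub>"
      using direct_sum_eqI[OF m(1) zero_closed] by auto
    then show "x \<in> Fv ` {y \<in> verts G. carrier (space M y) \<noteq> {\<zero>\<^bsub>space M y\<^esub>}}"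
      using direct_sum_component[OF m(1) y(1)] by (auto simp: fib_iff)
  qed
  then show "finite {x \<in> verts H. carrier (space (und (\<rho> M)) x) \<noteq> {\<zero>\<^bsub>space (und (\<rho> M)) x\<^esub>}}"
    by (rule finite_subset) (rule finite_imageI[OF rep_support[OF M]])
qed

lemma idem_rep_rho: "is_idem_rep H (\<rho> M)"
  unfolding is_idem_rep_def Let_def
proof (intro conjI ballI allI impI)
  fix x assume x: "x \<in> verts H"
  let ?e = "idem (\<rho> M) x"
  let ?nz = "{i. \<exists>m \<in> carrier (space (und (\<rho> M)) x). ?e i m \<noteq> \<zero>\<^bsub>space (und (\<rho> M)) x\<^esub>}"
  interpret S: complex_space "total M x" by (rule total_space)
  show "?e k \<in> lin (space (und (\<rho> M)) x) (space (und (\<rho> M)) x)" for k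
    using idem_rho_lin by simp
  have closed: "?e k m \<in> carrier (total M x)" if "m \<in> carrier (total M x)" for k m
    by (rule lin_closed[OF idem_rho_lin that])
  have "?nz \<subseteq> v ` {y \<in> verts G. carrier (space M y) \<noteq> {\<zero>\<^bsub>space M y\<^esub>}}"
  proof
    fix k assume "k \<in> ?nz"
    then obtain m where m: "m \<in> carrier (total M x)" "?e k m \<noteq> \<zero>\<^bsub>total M x\<^esub>"
      by auto
    then obtain y where y: "y \<in> fib x" "?e k m y \<noteq> \<zero>\<^bsub>space M y\<^esub>"
      using direct_sum_eqI[OF closed[OF m(1)] S.zero_closed] by auto
    then show "k \<in> v ` {y \<in> verts G. carrier (space M y) \<noteq> {\<zero>\<^bsub>space M y\<^esub>}}"
      using direct_sum_component[OF m(1) y(1)] by (auto simp: fib_iff idem_rho split: if_splits)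
  qed
  then show nz: "finite ?nz"
    by (rule finite_subset) (rule finite_imageI[OF rep_support[OF M]])
  show "?e i (?e k m) = \<zero>\<^bsub>space (und (\<rho> M)) x\<^esub>"
    if "i \<noteq> k" "m \<in> carrier (space (und (\<rho> M)) x)" for i k m
    using that by (auto simp: idem_rho_fun)
  fix m assume "m \<in> carrier (space (und (\<rho> M)) x)"
  then have m: "m \<in> carrier (total M x)" by simp
  have "finsum (total M x) (\<lambda>i. ?e i m) ?nz = m"
  proof (rule direct_sum_eqI[OF _ m])
    show "finsum (total M x) (\<lambda>i. ?e i m) ?nz \<in> carrier (total M x)"
      using closed[OF m] by (intro S.finsum_closed) auto
    fix y assume y: "y \<in> fib x"
    interpret Y: complex_space "space M y"
      by (rule fib_space[OF y])
    have my: "m y \<in> carrier (space M y)"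
      by (rule direct_sum_component[OF m y])
    have "(finsum (total M x) (\<lambda>i. ?e i m) ?nz) y = finsum (space M y) (\<lambda>i. ?e i m y) ?nz"
      using closed[OF m] by (intro lin_finsum[OF S.complex_space_axioms Y.complex_space_axioms
            direct_sum_proj_lin[OF y]]) auto
    also have "\<dots> = finsum (space M y) (\<lambda>i. if v y = i then m y else \<zero>\<^bsub>space M y\<^esub>) ?nz"
      using my by (intro Y.finsum_cong') (auto simp: idem_rho[OF y])
    also have "\<dots> = m y"
    proof (cases "v y \<in> ?nz")
      case True
      then show ?thesis
        using Y.finsum_singleton[OF True nz, of "\<lambda>_. m y"] my by simp
    next
      case False
      then have "?e (v y) m = \<zero>\<^bsub>total M x\<^esub>"
        using m by auto
      then have "m y = \<zero>\<^bsub>space M y\<^esub>"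
        using idem_rho[OF y, of M "v y" m] y by simp
      moreover have "finsum (space M y) (\<lambda>i. if v y = i then m y else \<zero>\<^bsub>space M y\<^esub>) ?nz =
          finsum (space M y) (\<lambda>_. \<zero>\<^bsub>space M y\<^esub>) ?nz"
        using calculation by (intro Y.finsum_cong') auto
      ultimately show ?thesis by simp
    qed
    finally show "(finsum (total M x) (\<lambda>i. ?e i m) ?nz) y = m y" .
  qed
  then show "finsum (space (und (\<rho> M)) x) (\<lambda>i. ?e i m) ?nz = m"
    by simp
qed (rule rep_rho)

text \<open>
  The component at \<open>y\<close> of the image under \<open>a\<close> depends only on the component at the tail of the arrow
  above \<open>a\<close> that ends in \<open>y\<close>, and this tail has label \<open>v y - T a\<close>.
\<close>

lemma rho_degree:
  assumes a: "a \<in> arcs H" and ik: "i - k \<noteq> T a" and m: "m \<in> carrier (total M (tail H a))"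
  shows "idem (\<rho> M) (head H a) i (linmap (und (\<rho> M)) a (idem (\<rho> M) (tail H a) k m)) =
    \<zero>\<^bsub>total M (head H a)\<^esub>"
proof -
  interpret S: complex_space "total M (head H a)" by (rule total_space)
  have em: "idem (\<rho> M) (tail H a) k m \<in> carrier (total M (tail H a))"
    by (rule lin_closed[OF idem_rho_lin m])
  show ?thesis
  proof (rule direct_sum_eqI[OF lin_closed[OF idem_rho_lin lin_closed[OF linmap_rho_lin[OF a] em]]
        S.zero_closed])
    fix y assume y: "y \<in> fib (head H a)"
    let ?b = "lift_arc a y"
    note b = lift_arc[OF a y]
    have "linmap M ?b \<zero>\<^bsub>space M (tail G ?b)\<^esub> = \<zero>\<^bsub>space M y\<^esub>"
      using lin_zero[OF fib_space[OF b(4)] _ rep_map[OF M b(1)]] b(3) fib_space[OF y] by simp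
    then show "idem (\<rho> M) (head H a) i (linmap (und (\<rho> M)) a (idem (\<rho> M) (tail H a) k m)) y =
        \<zero>\<^bsub>total M (head H a)\<^esub> y"
      using y ik b(5) by (simp add: idem_rho linmap_rho[OF a em y] idem_rho[OF b(4)])
  qed
qed

text \<open>
  The arrow \<open>b\<close> is the only one above \<open>Fa b\<close> that starts in its tail, since the label of the tail
  determines that of the head. So a vector in one summand is mapped into one summand.
\<close>

lemma linmap_rho_incl:
  assumes b: "b \<in> arcs G" and u: "u \<in> carrier (space M (tail G b))"
  shows "linmap (und (\<rho> M)) (Fa b) (incl (fib (Fv (tail G b))) (space M) (tail G b) u) =
    incl (fib (Fv (head G b))) (space M) (head G b) (linmap M b u)" (is "linmap _ _ ?i = ?j")
proof -
  let ?a = "Fa b"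
  have a: "?a \<in> arcs H" and ta: "tail G b \<in> fib (tail H ?a)" and ha: "head G b \<in> fib (head H ?a)"
    using b arc tail head by (auto simp: fib_iff)
  have i: "?i \<in> carrier (total M (tail H ?a))"
    using incl_total[OF ta u] tail[OF b] by simp
  have j: "?j \<in> carrier (total M (head H ?a))"
    using incl_total[OF ha lin_closed[OF rep_map[OF M b] u]] head[OF b] by simp
  show ?thesis
  proof (rule direct_sum_eqI[OF lin_closed[OF linmap_rho_lin[OF a] i] j])
    fix y assume y: "y \<in> fib (head H ?a)"
    let ?b = "lift_arc ?a y"
    note b' = lift_arc[OF a y]
    show "linmap (und (\<rho> M)) ?a ?i y = ?j y"
    proof (cases "y = head G b")
      case True
      then have "?b = b"
        using b by (intro lift_arc_eq) auto
      then show ?thesis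
        unfolding linmap_rho[OF a i y]
        using y ta ha True tail[OF b] head[OF b] by (simp add: incl_def)
    next
      case False
      then have "v y \<noteq> v (head G b)"
        using y ha by (auto simp: fib_iff intro: vert_eqI)
      then have "tail G ?b \<noteq> tail G b"
        using degree[OF b] b'(5) by auto
      moreover have "linmap M ?b \<zero>\<^bsub>space M (tail G ?b)\<^esub> = \<zero>\<^bsub>space M y\<^esub>"
        using lin_zero[OF fib_space[OF b'(4)] _ rep_map[OF M b'(1)]] b'(3) fib_space[OF y] by simp
      ultimately show ?thesis
        unfolding linmap_rho[OF a i y]
        using y b'(4) False tail[OF b] head[OF b] by (simp add: incl_def)
    qed
  qed
qed

text \<open>
  The label \<open>v y\<close> separates \<open>y\<close> from the other vertices of its fibre. This is how a component of a
  vector is recovered from the idempotents.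
\<close>

lemma idem_rho_incl:
  assumes y: "y \<in> fib x" and m: "m \<in> carrier (total M x)"
  shows "idem (\<rho> M) x (v y) m = incl (fib x) (space M) y (m y)"
proof -
  have "v z = v y \<longleftrightarrow> z = y" if "z \<in> fib x" for z
    using that y vert_eqI by (auto simp: fib_iff)
  then show ?thesis
    by (auto simp: idem_rho_fun incl_def restrict_def fun_eq_iff)
qed

text \<open>
  By induction along the path: the arrow ending in a vertex reads the component at the preceding vertex
  of the lift only.
\<close>

lemma fold_rho:
  assumes "G.awalk y q z" "m \<in> carrier (total M (Fv y))"
  shows "fold (linmap (und (\<rho> M))) (map Fa q) m z = fold (linmap M) q (m y)"
  using assms
proof (induction q arbitrary: y m)
  case (Cons b q)
  then have b: "b \<in> arcs G" "y = tail G b" "G.awalk (head G b) q z"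
    by (auto simp: G.awalk_Cons_iff)
  have a: "Fa b \<in> arcs H" "head G b \<in> fib (head H (Fa b))" "m \<in> carrier (total M (tail H (Fa b)))"
    using b arc head tail Cons.prems(2) by (auto simp: fib_iff)
  have "linmap (und (\<rho> M)) (Fa b) m (head G b) = linmap M b (m y)"
    using linmap_rho[OF a(1,3,2)] lift_arc_eq[OF b(1) refl refl] b(2) by simp
  moreover have "linmap (und (\<rho> M)) (Fa b) m \<in> carrier (total M (Fv (head G b)))"
    using lin_closed[OF linmap_rho_lin[OF a(1)] a(3)] head[OF b(1)] by simp
  ultimately show ?case
    using Cons.IH[OF b(3)] by simp
qed (simp add: G.awalk_Nil_iff)

end

abbreviation \<rho>_map :: "('w, 'b, 'u) rep \<Rightarrow> ('w \<Rightarrow> 'u \<Rightarrow> 'u) \<Rightarrow> 'v \<Rightarrow> ('w \<Rightarrow> 'u) \<Rightarrow> 'w \<Rightarrow> 'u" where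
  "\<rho>_map \<equiv> rho_arr G H Fv"

lemma rho_arr_apply:
  "x \<in> verts H \<Longrightarrow> m \<in> carrier (total M x) \<Longrightarrow> \<rho>_map M f x m = (\<lambda>y\<in>fib x. f y (m y))"
  by (simp add: rho_arr_def)

lemma rho_arr_hom:
  assumes M: "is_rep G M" and N: "is_rep G N" and f: "f \<in> rep_hom G M N"
  shows "\<rho>_map M f \<in> idem_hom H (\<rho> M) (\<rho> N)"
proof -
  have f_closed: "f y u \<in> carrier (space N y)" if "y \<in> fib x" "u \<in> carrier (space M y)" for x y u
    using rep_hom_closed[OF f] that by (simp add: fib_iff)
  have closed: "\<rho>_map M f x m \<in> carrier (total N x)"
    if "x \<in> verts H" "m \<in> carrier (total M x)" for x m
    using that f_closed unfolding rho_arr_apply[OF that] total_carrier[OF M] total_carrier[OF N]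
    by auto
  have linear: "\<rho>_map M f x \<in> lin (total M x) (total N x)" if x: "x \<in> verts H" for x
  proof (rule lin_direct_sumI[OF _ _ total_space[OF M] fib_space[OF N]])
    fix y assume y: "y \<in> fib x"
    then have "(\<lambda>m. f y (m y)) \<in> lin (total M x) (space N y)"
      by (intro lin_comp[OF total_proj_lin rep_homD(3)[OF f]]) (auto simp: fib_iff)
    then show "(\<lambda>m. \<rho>_map M f x m y) \<in> lin (total M x) (space N y)"
      by (rule lin_cong[OF _ total_space[OF M]]) (simp add: rho_arr_apply[OF x] y)
  qed (rule closed[OF x])
  have arrows: "\<rho>_map M f (head H a) (linmap (und (\<rho> M)) a m) =
      linmap (und (\<rho> N)) a (\<rho>_map M f (tail H a) m)"
    if a: "a \<in> arcs H" and m: "m \<in> carrier (total M (tail H a))" for a m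
  proof -
    have ht: "head H a \<in> verts H" "tail H a \<in> verts H"
      using a by auto
    note am = lin_closed[OF linmap_rho_lin[OF M a] m]
    note fm = closed[OF ht(2) m]
    show ?thesis
    proof (rule direct_sum_eqI[OF closed[OF ht(1) am] lin_closed[OF linmap_rho_lin[OF N a] fm]])
      fix y assume y: "y \<in> fib (head H a)"
      let ?b = "lift_arc a y"
      note b = lift_arc[OF a y]
      have "f y (linmap M ?b (m (tail G ?b))) = linmap N ?b (f (tail G ?b) (m (tail G ?b)))"
        using rep_homD(4)[OF f b(1)] b(3) direct_sum_component[OF m b(4)] by simp
      then show "\<rho>_map M f (head H a) (linmap (und (\<rho> M)) a m) y =
          linmap (und (\<rho> N)) a (\<rho>_map M f (tail H a) m) y"
        unfolding linmap_rho[OF N a fm y]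
        using y b(4) by (simp add: rho_arr_apply[OF ht(1) am] linmap_rho[OF M a m y]
            rho_arr_apply[OF ht(2) m])
    qed
  qed
  have idems: "\<rho>_map M f x (idem (\<rho> M) x k m) = idem (\<rho> N) x k (\<rho>_map M f x m)"
    if x: "x \<in> verts H" and m: "m \<in> carrier (total M x)" for x k m
  proof -
    have "f y \<zero>\<^bsub>space M y\<^esub> = \<zero>\<^bsub>space N y\<^esub>" if "y \<in> fib x" for y
      using lin_zero[OF fib_space[OF M that] fib_space[OF N that]] rep_homD(3)[OF f] that
      by (simp add: fib_iff)
    moreover have "\<rho>_map M f x (idem (\<rho> M) x k m) = (\<lambda>y\<in>fib x. f y (idem (\<rho> M) x k m y))"
      by (rule rho_arr_apply[OF x lin_closed[OF idem_rho_lin[OF M] m]])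
    ultimately show ?thesis
      by (auto simp: rho_arr_apply[OF x m] idem_rho_fun restrict_def fun_eq_iff)
  qed
  show ?thesis
    unfolding idem_hom_def rep_hom_def using linear arrows idems by (auto simp: rho_arr_def)
qed

abbreviation \<R> :: "(('w, 'b, 'u) rep, 'w \<Rightarrow> 'u \<Rightarrow> 'u, ('v, 'a, 'w \<Rightarrow> 'u) idem_rep,
    'v \<Rightarrow> ('w \<Rightarrow> 'u) \<Rightarrow> 'w \<Rightarrow> 'u) cat_map" where
  "\<R> \<equiv> rho G H Fv Fa v"

lemma \<R>_simps [simp]: "on_obj \<R> = \<rho>" "on_arr \<R> M N = \<rho>_map M"
  by (simp_all add: rho_def)

lemma category_mod_idem_deg: "category (mod_idem_deg H T)"
  unfolding mod_idem_deg_def by (intro category_full_subcategory H.category_mod_idem)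

lemma mod_idem_deg_simps:
  "N \<in> Obj (mod_idem_deg H T) \<longleftrightarrow> is_idem_rep H N \<and>
    (\<forall>a \<in> arcs H. \<forall>i k. i - k \<noteq> T a \<longrightarrow> (\<forall>m \<in> carrier (space (und N) (tail H a)).
      idem N (head H a) i (linmap (und N) a (idem N (tail H a) k m)) = \<zero>\<^bsub>space (und N) (head H a)\<^esub>))"
  "Hom (mod_idem_deg H T) = idem_hom H" "idn (mod_idem_deg H T) N = rep_id H (und N)"
  "cmp (mod_idem_deg H T) L N N' g f = rep_comp H (und L) g f"
  by (simp_all add: mod_idem_deg_def mod_idem_def)

lemma rep_category_simps:
  "M \<in> Obj (rep_category G) \<longleftrightarrow> is_rep G M" "Hom (rep_category G) = rep_hom G"
  "idn (rep_category G) M = rep_id G M" "cmp (rep_category G) L M N g f = rep_comp G L g f"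
  by (simp_all add: rep_category_def)

lemma rho_functor: "cat_functor (rep_category G) (mod_idem_deg H T) \<R>"
proof (intro cat_functor.intro cat_functor_axioms.intro G.category_rep category_mod_idem_deg)
  fix M assume "M \<in> Obj (rep_category G)"
  then have M: "is_rep G M" by (simp add: rep_category_simps)
  show "on_obj \<R> M \<in> Obj (mod_idem_deg H T)"
    using idem_rep_rho[OF M] rho_degree[OF M] by (simp add: mod_idem_deg_simps del: direct_sum_simps)
  have "\<rho>_map M (rep_id G M) x m = rep_id H (und (\<rho> M)) x m"
    if "x \<in> verts H" "m \<in> carrier (total M x)" for x m
  proof -
    have "\<rho>_map M (rep_id G M) x m = restrict m (fib x)"
      using that direct_sum_component[OF that(2)]
      by (auto simp: rho_arr_apply rep_id_def restrict_def fun_eq_iff fib_iff)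
    also have "\<dots> = m"
      using that(2) by (auto simp: total_carrier[OF M] PiE_restrict)
    finally show ?thesis
      using that by (simp add: rep_id_def)
  qed
  then have "\<rho>_map M (rep_id G M) = rep_id H (und (\<rho> M))"
    by (intro rep_hom_eqI[OF idem_homD(1)[OF rho_arr_hom[OF M M G.rep_id_hom[OF M]]]
        H.rep_id_hom[OF rep_rho[OF M]]]) auto
  then show "on_arr \<R> M M (idn (rep_category G) M) = idn (mod_idem_deg H T) (on_obj \<R> M)"
    by (simp add: mod_idem_deg_simps rep_category_simps)
next
  fix M N f assume "M \<in> Obj (rep_category G)" "N \<in> Obj (rep_category G)" "f \<in> Hom (rep_category G) M N"
  then show "on_arr \<R> M N f \<in> Hom (mod_idem_deg H T) (on_obj \<R> M) (on_obj \<R> N)"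
    by (simp add: rep_category_simps mod_idem_deg_simps rho_arr_hom)
next
  fix L M N f g
  assume "L \<in> Obj (rep_category G)" "M \<in> Obj (rep_category G)" "N \<in> Obj (rep_category G)"
    "f \<in> Hom (rep_category G) L M" "g \<in> Hom (rep_category G) M N"
  then have L: "is_rep G L" and M: "is_rep G M" and N: "is_rep G N"
    and f: "f \<in> rep_hom G L M" and g: "g \<in> rep_hom G M N"
    by (simp_all add: rep_category_simps)
  note Rf = idem_homD(1)[OF rho_arr_hom[OF L M f]] and Rg = idem_homD(1)[OF rho_arr_hom[OF M N g]]
  have "\<rho>_map L (rep_comp G L g f) = rep_comp H (und (\<rho> L)) (\<rho>_map M g) (\<rho>_map L f)"
  proof (rule rep_hom_eqI[OF idem_homD(1)[OF rho_arr_hom[OF L N G.rep_comp_hom[OF L f g]]]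
        H.rep_comp_hom[OF rep_rho[OF L] Rf Rg]])
    fix x m assume x: "x \<in> verts H" and "m \<in> carrier (space (und (\<rho> L)) x)"
    then have m: "m \<in> carrier (total L x)" by simp
    have fm: "\<rho>_map L f x m \<in> carrier (total M x)"
      using rep_hom_closed[OF Rf x] m by simp
    have "rep_comp H (und (\<rho> L)) (\<rho>_map M g) (\<rho>_map L f) x m = \<rho>_map M g x (\<rho>_map L f x m)"
      using x m by (simp add: rep_comp_def compose_def)
    also have "\<dots> = (\<lambda>y\<in>fib x. g y (\<rho>_map L f x m y))"
      by (rule rho_arr_apply[OF x fm])
    also have "\<dots> = \<rho>_map L (rep_comp G L g f) x m"
      using direct_sum_component[OF m]
      by (auto simp: rep_comp_def compose_def rho_arr_apply[OF x m] restrict_def fun_eq_iff fib_iff)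
    finally show "\<rho>_map L (rep_comp G L g f) x m = rep_comp H (und (\<rho> L)) (\<rho>_map M g) (\<rho>_map L f) x m"
      by simp
  qed simp
  then show "on_arr \<R> L N (cmp (rep_category G) L M N g f) =
      cmp (mod_idem_deg H T) (on_obj \<R> L) (on_obj \<R> M) (on_obj \<R> N) (on_arr \<R> M N g) (on_arr \<R> L M f)"
    by (simp add: rep_category_simps mod_idem_deg_simps)
qed

text \<open>
  A morphism \<open>f\<close> is recovered from its image by evaluating on vectors with a single non-zero component.
  Conversely, let \<open>h\<close> commute with the arrows and the idempotents, and define \<open>f\<close> in this way. The
  component of \<open>h m\<close> at \<open>y\<close> is that of \<open>e (h m) = h (e m)\<close> for the idempotent \<open>e\<close> of index \<open>v y\<close>, and
  \<open>e m\<close> has \<open>m y\<close> as its only component; so \<open>h\<close> is diagonal, with the maps \<open>f y\<close> on the diagonal.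
\<close>

lemma rho_fully_faithful:
  assumes M: "is_rep G M" and N: "is_rep G N"
  shows "bij_betw (\<rho>_map M) (rep_hom G M N) (idem_hom H (\<rho> M) (\<rho> N))"
  unfolding bij_betw_def
proof (intro conjI inj_onI equalityI subsetI)
  note inclM = incl_total[OF M]
  fix f f' assume f: "f \<in> rep_hom G M N" "f' \<in> rep_hom G M N" and eq: "\<rho>_map M f = \<rho>_map M f'"
  show "f = f'"
  proof (rule rep_hom_eqI[OF f])
    fix y u assume y: "y \<in> verts G" and u: "u \<in> carrier (space M y)"
    let ?i = "incl (fib (Fv y)) (space M) y u"
    have yf: "y \<in> fib (Fv y)"
      using y by (simp add: fib_iff)
    have "\<rho>_map M g (Fv y) ?i y = g y u" for g
      using yf by (simp add: rho_arr_apply[OF vert[OF y] inclM[OF yf u]]) (simp add: incl_def)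
    with eq show "f y u = f' y u" by metis
  qed simp
next
  fix g assume "g \<in> \<rho>_map M ` rep_hom G M N"
  then show "g \<in> idem_hom H (\<rho> M) (\<rho> N)"
    using rho_arr_hom[OF M N] by auto
next
  note inclM = incl_total[OF M]
  fix h assume h: "h \<in> idem_hom H (\<rho> M) (\<rho> N)"
  note hr = idem_homD(1)[OF h]
  have h_lin: "h x \<in> lin (total M x) (total N x)" if "x \<in> verts H" for x
    using rep_homD(3)[OF hr that] by simp
  let ?i = "\<lambda>y. incl (fib (Fv y)) (space M) y"
  define f where "f = (\<lambda>y\<in>verts G. \<lambda>u\<in>carrier (space M y). h (Fv y) (?i y u) y)"
  have f: "f \<in> rep_hom G M N"
    unfolding rep_hom_def
  proof (intro CollectI conjI ballI)
    fix y assume y: "y \<in> verts G"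
    then have yf: "y \<in> fib (Fv y)"
      by (simp add: fib_iff)
    have "(\<lambda>u. h (Fv y) (?i y u) y) \<in> lin (space M y) (space N y)"
      using lin_comp[OF lin_comp[OF incl_total_lin[OF M yf] h_lin[OF vert[OF y]]]
          total_proj_lin[OF yf]] .
    then show "f y \<in> lin (space M y) (space N y)"
      by (rule lin_cong[OF _ rep_space[OF M y]]) (simp add: f_def y)
  next
    fix b u assume b: "b \<in> arcs G" and u: "u \<in> carrier (space M (tail G b))"
    let ?y = "tail G b" and ?z = "head G b" and ?a = "Fa b"
    have yz: "?y \<in> verts G" "?z \<in> verts G"
      using b by auto
    have a: "?a \<in> arcs H" "tail H ?a = Fv ?y" "head H ?a = Fv ?z"
      using b by (simp_all add: arc tail head)
    have yf: "?y \<in> fib (tail H ?a)" and zf: "?z \<in> fib (head H ?a)"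
      using yz a by (simp_all add: fib_iff)
    have i: "?i ?y u \<in> carrier (total M (tail H ?a))"
      using inclM[OF yf u] a by simp
    have hi: "h (tail H ?a) (?i ?y u) \<in> carrier (total N (tail H ?a))"
      using lin_closed[OF h_lin i] a(1) by simp
    have "f ?z (linmap M b u) = h (head H ?a) (linmap (und (\<rho> M)) ?a (?i ?y u)) ?z"
      using yz lin_closed[OF rep_map[OF M b] u] linmap_rho_incl[OF M b u] a by (simp add: f_def)
    also have "\<dots> = linmap (und (\<rho> N)) ?a (h (tail H ?a) (?i ?y u)) ?z"
      using rep_homD(4)[OF hr a(1)] i by simp
    also have "\<dots> = linmap N b (h (tail H ?a) (?i ?y u) ?y)"
      using linmap_rho[OF N a(1) hi zf] lift_arc_eq[OF b refl refl] by simp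
    also have "\<dots> = linmap N b (f ?y u)"
      using yz u a by (simp add: f_def)
    finally show "f ?z (linmap M b u) = linmap N b (f ?y u)" .
  qed (auto simp: f_def)
  have "\<rho>_map M f = h"
  proof (rule rep_hom_eqI[OF idem_homD(1)[OF rho_arr_hom[OF M N f]] hr])
    fix x m assume x: "x \<in> verts H" and "m \<in> carrier (space (und (\<rho> M)) x)"
    then have m: "m \<in> carrier (total M x)" by simp
    have hm: "h x m \<in> carrier (total N x)"
      by (rule lin_closed[OF h_lin[OF x] m])
    have fm: "\<rho>_map M f x m \<in> carrier (total N x)"
      using rep_hom_closed[OF idem_homD(1)[OF rho_arr_hom[OF M N f]] x] m by simp
    show "\<rho>_map M f x m = h x m"
    proof (rule direct_sum_eqI[OF fm hm])
      fix y assume y: "y \<in> fib x"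
      then have y': "y \<in> verts G" "Fv y = x"
        by (auto simp: fib_iff)
      have "h x m y = idem (\<rho> N) x (v y) (h x m) y"
        by (simp add: idem_rho[OF y])
      also have "\<dots> = h x (idem (\<rho> M) x (v y) m) y"
        using idem_homD(2)[OF h x] m by simp
      also have "\<dots> = f y (m y)"
        using y' direct_sum_component[OF m y] by (simp add: idem_rho_incl[OF M y m] f_def)
      finally show "\<rho>_map M f x m y = h x m y"
        using y by (simp add: rho_arr_apply[OF x m])
    qed
  qed simp
  with f show "h \<in> \<rho>_map M ` rep_hom G M N"
    by blast
qed

text \<open>
  The space of \<open>M\<close> at \<open>y\<close> is a copy inside the type \<open>'u\<close> of the image of the idempotent of index \<open>v y\<close>
  at \<open>Fv y\<close>. The degree condition makes \<open>N\<^sub>a\<close> map the image of the idempotent of index \<open>k\<close> into that of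
  index \<open>k + T a\<close>, so that the arrows of the covering act by restrictions of the maps \<open>N\<^sub>a\<close>. The
  isomorphism sends a vector to the family of its images under the idempotents.
\<close>

lemma rho_essentially_surjective:
  fixes N :: "('v, 'a, 'w \<Rightarrow> 'u) idem_rep" and \<iota> :: "complex \<Rightarrow> 'u"
  assumes \<iota>: "inj \<iota>" and "N \<in> Obj (mod_idem_deg H T)"
  shows "\<exists>M :: ('w, 'b, 'u) rep. is_rep G M \<and> (\<exists>f. cat_iso (mod_idem_deg H T) (\<rho> M) N f)"
proof -
  have N: "is_idem_rep H N"
    and deg: "\<And>a i k m. a \<in> arcs H \<Longrightarrow> i - k \<noteq> T a \<Longrightarrow> m \<in> carrier (space (und N) (tail H a)) \<Longrightarrow>
      idem N (head H a) i (linmap (und N) a (idem N (tail H a) k m)) = \<zero>\<^bsub>space (und N) (head H a)\<^esub>"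
    using assms(2) by (auto simp: mod_idem_deg_simps)
  note R = idem_rep[OF N]
  let ?V = "space (und N)" and ?e = "idem N"
  note V = rep_space[OF R] and e_lin = idem_lin[OF N] and e_closed = idem_closed[OF N]
  have zero: "\<zero>\<^bsub>?V x\<^esub> \<in> carrier (?V x)" if "x \<in> verts H" for x
  proof -
    interpret complex_space "?V x" by (rule V[OF that])
    show ?thesis by simp
  qed
  have e_zero: "?e x k \<zero>\<^bsub>?V x\<^esub> = \<zero>\<^bsub>?V x\<^esub>" if "x \<in> verts H" for x k
    by (rule lin_zero[OF V[OF that] V[OF that] e_lin[OF that]])
  have a_closed: "linmap (und N) a m \<in> carrier (?V (head H a))"
    if "a \<in> arcs H" "m \<in> carrier (?V (tail H a))" for a m
    by (rule lin_closed[OF rep_map[OF R that(1)] that(2)])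
  have shift: "?e (head H a) (k + T a) (linmap (und N) a (?e (tail H a) k m)) =
      linmap (und N) a (?e (tail H a) k m)"
    if a: "a \<in> arcs H" and m: "m \<in> carrier (?V (tail H a))" for a k m
  proof -
    have ht: "head H a \<in> verts H" "tail H a \<in> verts H"
      using a by auto
    have m': "linmap (und N) a (?e (tail H a) k m) \<in> carrier (?V (head H a))"
      using a_closed[OF a e_closed[OF ht(2) m]] .
    show ?thesis
    proof (rule idem_ext[OF N ht(1) e_closed[OF ht(1) m'] m'])
      show "?e (head H a) i (?e (head H a) (k + T a) (linmap (und N) a (?e (tail H a) k m))) =
          ?e (head H a) i (linmap (und N) a (?e (tail H a) k m))" for i
        using deg[OF a _ m, of i k] idem_idem[OF N ht(1) m'] idem_orth[OF N ht(1) _ m']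
        by (cases "i = k + T a") auto
    qed
  qed
  have commute: "?e (head H a) i (linmap (und N) a m) = linmap (und N) a (?e (tail H a) (i - T a) m)"
    if a: "a \<in> arcs H" and m: "m \<in> carrier (?V (tail H a))" for a i m
  proof -
    have ht: "head H a \<in> verts H" "tail H a \<in> verts H"
      using a by auto
    let ?k = "i - T a"
    \<comment> \<open>On the image of an idempotent of index other than \<open>?k\<close> both sides vanish.\<close>
    have "?e (head H a) i (linmap (und N) a m) =
        ?e (head H a) i (linmap (und N) a (?e (tail H a) ?k m))"
    proof (rule idem_lin_ext[OF N ht(2) V[OF ht(1)] _ _ _ m])
      show "(\<lambda>m. ?e (head H a) i (linmap (und N) a m)) \<in> lin (?V (tail H a)) (?V (head H a))"
        by (rule lin_comp[OF rep_map[OF R a] e_lin[OF ht(1)]])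
      show "(\<lambda>m. ?e (head H a) i (linmap (und N) a (?e (tail H a) ?k m))) \<in>
          lin (?V (tail H a)) (?V (head H a))"
        by (rule lin_comp[OF e_lin[OF ht(2)] lin_comp[OF rep_map[OF R a] e_lin[OF ht(1)]]])
      fix j m assume m: "m \<in> carrier (?V (tail H a))"
      show "?e (head H a) i (linmap (und N) a (?e (tail H a) j m)) =
          ?e (head H a) i (linmap (und N) a (?e (tail H a) ?k (?e (tail H a) j m)))"
      proof (cases "j = ?k")
        case True
        then show ?thesis by (simp add: idem_idem[OF N ht(2) m])
      next
        case False
        then have "i - j \<noteq> T a" by auto
        then show ?thesis
          using deg[OF a _ m, of i j] idem_orth[OF N ht(2) _ m, of ?k j] False
          by (simp add: lin_zero[OF V[OF ht(2)] V[OF ht(1)] rep_map[OF R a]] e_zero[OF ht(1)])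
      qed
    qed
    also have "\<dots> = linmap (und N) a (?e (tail H a) ?k m)"
      using shift[OF a m, of ?k] by simp
    finally show ?thesis .
  qed

  \<comment> \<open>One injection \<open>g x\<close> of the whole space at \<open>x\<close> serves all vertices above \<open>x\<close>.\<close>
  have "\<exists>g :: ('w \<Rightarrow> 'u) \<Rightarrow> 'u. inj_on g (carrier (?V x))" if x: "x \<in> verts H" for x
  proof -
    interpret complex_space "?V x" by (rule V[OF x])
    obtain g :: "('w \<Rightarrow> 'u) \<Rightarrow> complex" where "inj_on g (carrier (?V x))"
      using fin_dim_embeds[OF rep_fin_dim[OF R x]] by blast
    then have "inj_on (\<iota> \<circ> g) (carrier (?V x))"
      using \<iota> by (intro comp_inj_on) (auto intro: inj_on_subset)
    then show ?thesis by blast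
  qed
  then obtain g :: "'v \<Rightarrow> ('w \<Rightarrow> 'u) \<Rightarrow> 'u" where g: "\<And>x. x \<in> verts H \<Longrightarrow> inj_on (g x) (carrier (?V x))"
    by metis
  define I where "I y = image_space (?e (Fv y) (v y)) (?V (Fv y))" for y
  define \<psi> where "\<psi> y = inv_into (carrier (I y)) (g (Fv y))" for y
  define M :: "('w, 'b, 'u) rep" where
    "M = \<lparr>space = (\<lambda>y. transport (g (Fv y)) (I y)),
          linmap = (\<lambda>b u. g (Fv (head G b)) (linmap (und N) (Fa b) (\<psi> (tail G b) u)))\<rparr>"
  have I_sub: "carrier (I y) \<subseteq> carrier (?V (Fv y))" if "y \<in> verts G" for y
    using e_closed[OF vert[OF that]] by (auto simp: I_def)
  have e_I: "?e (Fv y) (v y) m \<in> carrier (I y)" if "m \<in> carrier (?V (Fv y))" for y m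
    using that by (simp add: I_def)
  have I_space: "complex_space (I y)" if "y \<in> verts G" for y
    unfolding I_def by (intro complex_space_image_space V e_lin vert that)
  have gI: "inj_on (g (Fv y)) (carrier (I y))" if "y \<in> verts G" for y
    using g[OF vert[OF that]] I_sub[OF that] by (rule inj_on_subset)
  have M_space: "complex_space (space M y)" and g_lin: "g (Fv y) \<in> lin (I y) (space M y)"
    and \<psi>_lin: "\<psi> y \<in> lin (space M y) (I y)" if "y \<in> verts G" for y
    unfolding M_def \<psi>_def using transport[OF I_space[OF that] gI[OF that]] by simp_all
  have \<psi>_g: "\<psi> y (g (Fv y) w) = w" if "y \<in> verts G" "w \<in> carrier (I y)" for y w
    unfolding \<psi>_def using gI[OF that(1)] that(2) by simp
  have g_\<psi>: "g (Fv y) (\<psi> y u) = u" if "y \<in> verts G" "u \<in> carrier (space M y)" for y u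
    unfolding \<psi>_def using that(2) f_inv_into_f[of u "g (Fv y)" "carrier (I y)"]
    by (simp add: M_def transport_def)
  have M_zero: "\<zero>\<^bsub>space M y\<^esub> = g (Fv y) \<zero>\<^bsub>?V (Fv y)\<^esub>" for y
    by (simp add: M_def transport_def I_def)
  have M_carrier: "carrier (space M y) = g (Fv y) ` carrier (I y)" for y
    by (simp add: M_def transport_def)
  have ge_lin: "(\<lambda>m. g (Fv y) (?e (Fv y) (v y) m)) \<in> lin (?V (Fv y)) (space M y)"
    if "y \<in> verts G" for y
    using lin_comp[OF lin_image_space[OF V[OF vert[OF that]] e_lin[OF vert[OF that], of "v y"]], folded I_def]
      g_lin[OF that] by blast
  have M: "is_rep G M"
    unfolding is_rep_def
  proof (intro conjI ballI)
    fix y assume y: "y \<in> verts G"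
    show "vectorspace class_ring (space M y)"
      by (rule complex_space.vectorspace[OF M_space[OF y]])
    show "vectorspace.fin_dim class_ring (space M y)"
    proof (rule fin_dim_surj[OF V[OF vert[OF y]] M_space[OF y] ge_lin[OF y] _
          rep_fin_dim[OF R vert[OF y]]])
      show "carrier (space M y) \<subseteq> (\<lambda>m. g (Fv y) (?e (Fv y) (v y) m)) ` carrier (?V (Fv y))"
        by (auto simp: M_carrier I_def)
    qed
  next
    fix b assume b: "b \<in> arcs G"
    let ?a = "Fa b" and ?y = "tail G b" and ?z = "head G b"
    have yz: "?y \<in> verts G" "?z \<in> verts G"
      using b by auto
    have a: "?a \<in> arcs H" "tail H ?a = Fv ?y" "head H ?a = Fv ?z"
      using b by (simp_all add: arc tail head)
    have map: "linmap (und N) ?a w \<in> carrier (I ?z)" if w: "w \<in> carrier (I ?y)" for w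
    proof -
      obtain m where m: "m \<in> carrier (?V (Fv ?y))" "w = ?e (Fv ?y) (v ?y) m"
        using w by (auto simp: I_def)
      then have "linmap (und N) ?a w = ?e (Fv ?z) (v ?z) (linmap (und N) ?a w)"
        using shift[OF a(1), of m "v ?y"] a degree[OF b] by simp
      moreover have "linmap (und N) ?a w \<in> carrier (?V (Fv ?z))"
        using a_closed[OF a(1)] a w I_sub[OF yz(1)] by auto
      ultimately show ?thesis
        using e_I by metis
    qed
    have "linmap (und N) ?a \<in> lin (I ?y) (I ?z)"
    proof (rule linI)
      fix w w' assume w: "w \<in> carrier (I ?y)" "w' \<in> carrier (I ?y)"
      then show "linmap (und N) ?a (w \<oplus>\<^bsub>I ?y\<^esub> w') = linmap (und N) ?a w \<oplus>\<^bsub>I ?z\<^esub> linmap (und N) ?a w'"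
        using lin_add[OF rep_map[OF R a(1)], of w w'] I_sub[OF yz(1)] a by (auto simp: I_def)
    next
      fix c w assume w: "w \<in> carrier (I ?y)"
      then show "linmap (und N) ?a (c \<odot>\<^bsub>I ?y\<^esub> w) = c \<odot>\<^bsub>I ?z\<^esub> linmap (und N) ?a w"
        using lin_scale[OF rep_map[OF R a(1)], of w c] I_sub[OF yz(1)] a by (auto simp: I_def)
    qed (rule map)
    then show "linmap M b \<in> lin (space M ?y) (space M ?z)"
      using lin_comp[OF lin_comp[OF \<psi>_lin[OF yz(1)]] g_lin[OF yz(2)]] by (simp add: M_def)
  next
    let ?X = "{x \<in> verts H. carrier (?V x) \<noteq> {\<zero>\<^bsub>?V x\<^esub>}}"
    let ?K = "\<lambda>x. {i. \<exists>m \<in> carrier (?V x). ?e x i m \<noteq> \<zero>\<^bsub>?V x\<^esub>}"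
    have "{y \<in> verts G. carrier (space M y) \<noteq> {\<zero>\<^bsub>space M y\<^esub>}} \<subseteq>
        (\<lambda>(x, k). lift_vert x k) ` (SIGMA x:?X. ?K x)"
    proof
      fix y assume "y \<in> {y \<in> verts G. carrier (space M y) \<noteq> {\<zero>\<^bsub>space M y\<^esub>}}"
      then have y: "y \<in> verts G" and ne: "carrier (space M y) \<noteq> {\<zero>\<^bsub>space M y\<^esub>}"
        by auto
      interpret complex_space "space M y" by (rule M_space[OF y])
      obtain u where u: "u \<in> carrier (space M y)" "u \<noteq> \<zero>\<^bsub>space M y\<^esub>"
        using ne zero_closed by blast
      then obtain m where m: "m \<in> carrier (?V (Fv y))" "u = g (Fv y) (?e (Fv y) (v y) m)"
        by (auto simp: M_carrier I_def)
      then have "?e (Fv y) (v y) m \<noteq> \<zero>\<^bsub>?V (Fv y)\<^esub>"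
        using u(2) by (auto simp: M_zero)
      then have "(Fv y, v y) \<in> (SIGMA x:?X. ?K x)"
        using m(1) vert[OF y] e_zero[OF vert[OF y]] by auto
      then show "y \<in> (\<lambda>(x, k). lift_vert x k) ` (SIGMA x:?X. ?K x)"
        using lift_vert_eq[OF y] by (auto intro!: image_eqI[of _ _ "(Fv y, v y)"])
    qed
    moreover have "finite (SIGMA x:?X. ?K x)"
      using rep_support[OF R] by (intro finite_SigmaI idem_finite[OF N]) auto
    ultimately show "finite {y \<in> verts G. carrier (space M y) \<noteq> {\<zero>\<^bsub>space M y\<^esub>}}"
      by (meson finite_imageI finite_subset)
  qed

  define \<eta> where
    "\<eta> = (\<lambda>x\<in>verts H. \<lambda>m\<in>carrier (?V x). \<lambda>y\<in>fib x. g x (?e x (v y) m))"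
  have \<eta>: "\<eta> x m y = g x (?e x (v y) m)" if "x \<in> verts H" "m \<in> carrier (?V x)" "y \<in> fib x" for x m y
    using that by (simp add: \<eta>_def)
  have \<eta>_closed: "\<eta> x m \<in> carrier (total M x)" if "x \<in> verts H" "m \<in> carrier (?V x)" for x m
    unfolding total_carrier[OF M] using that by (auto simp: \<eta>_def fib_iff M_carrier I_def)
  have \<eta>_lin: "\<eta> x \<in> lin (?V x) (total M x)" if x: "x \<in> verts H" for x
  proof (rule lin_direct_sumI[OF _ \<eta>_closed[OF x] V[OF x] fib_space[OF M]])
    fix y assume y: "y \<in> fib x"
    then have y': "y \<in> verts G" "Fv y = x"
      by (simp_all add: fib_iff)
    show "(\<lambda>m. \<eta> x m y) \<in> lin (?V x) (space M y)"
      by (rule lin_cong[OF ge_lin[OF y'(1), unfolded y'(2)] V[OF x] \<eta>[OF x _ y]])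
  qed
  have \<eta>_hom: "\<eta> \<in> idem_hom H N (\<rho> M)"
    unfolding idem_hom_def rep_hom_def
  proof (intro CollectI conjI ballI allI)
    fix x assume "x \<in> verts H"
    then show "\<eta> x \<in> lin (?V x) (space (und (\<rho> M)) x)"
      using \<eta>_lin by simp
  next
    fix a m assume a: "a \<in> arcs H" and m: "m \<in> carrier (?V (tail H a))"
    have ht: "head H a \<in> verts H" "tail H a \<in> verts H"
      using a by auto
    note am = a_closed[OF a m] and em = \<eta>_closed[OF ht(2) m]
    show "\<eta> (head H a) (linmap (und N) a m) = linmap (und (\<rho> M)) a (\<eta> (tail H a) m)"
    proof (rule direct_sum_eqI[OF \<eta>_closed[OF ht(1) am] lin_closed[OF linmap_rho_lin[OF M a] em]])
      fix y assume y: "y \<in> fib (head H a)"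
      let ?b = "lift_arc a y"
      note b = lift_arc[OF a y]
      have t: "tail G ?b \<in> verts G" "Fv (tail G ?b) = tail H a" and y': "y \<in> verts G" "Fv y = head H a"
        using b(4) y by (simp_all add: fib_iff)
      have "\<eta> (head H a) (linmap (und N) a m) y = g (head H a) (?e (head H a) (v y) (linmap (und N) a m))"
        by (rule \<eta>[OF ht(1) am y])
      also have "\<dots> = g (head H a) (linmap (und N) a (?e (tail H a) (v (tail G ?b)) m))"
        by (simp add: commute[OF a m] b(5))
      also have "\<dots> = linmap M ?b (g (tail H a) (?e (tail H a) (v (tail G ?b)) m))"
        using \<psi>_g[OF t(1) e_I, of m] m t(2) y' b(2,3) by (simp add: M_def)
      also have "\<dots> = linmap M ?b (\<eta> (tail H a) m (tail G ?b))"
        by (simp add: \<eta>[OF ht(2) m b(4)])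
      also have "\<dots> = linmap (und (\<rho> M)) a (\<eta> (tail H a) m) y"
        by (rule linmap_rho[OF M a em y, symmetric])
      finally show "\<eta> (head H a) (linmap (und N) a m) y = linmap (und (\<rho> M)) a (\<eta> (tail H a) m) y" .
    qed
  next
    fix x k m assume x: "x \<in> verts H" and m: "m \<in> carrier (?V x)"
    show "\<eta> x (?e x k m) = idem (\<rho> M) x k (\<eta> x m)"
    proof (rule direct_sum_eqI[OF \<eta>_closed[OF x e_closed[OF x m]]
          lin_closed[OF idem_rho_lin[OF M] \<eta>_closed[OF x m]]])
      fix y assume y: "y \<in> fib x"
      then have "Fv y = x" by (simp add: fib_iff)
      then show "\<eta> x (?e x k m) y = idem (\<rho> M) x k (\<eta> x m) y"
        using idem_idem[OF N x m] idem_orth[OF N x _ m]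
        by (simp add: \<eta>[OF x e_closed[OF x m] y] \<eta>[OF x m y] idem_rho[OF y] M_zero)
    qed
  qed (auto simp: \<eta>_def)
  have \<eta>_bij: "bij_betw (\<eta> x) (carrier (?V x)) (carrier (total M x))" if x: "x \<in> verts H" for x
    unfolding bij_betw_def
  proof (intro conjI inj_onI equalityI subsetI)
    fix m m' assume m: "m \<in> carrier (?V x)" "m' \<in> carrier (?V x)" and eq: "\<eta> x m = \<eta> x m'"
    show "m = m'"
    proof (rule idem_ext[OF N x m])
      fix k
      have y: "lift_vert x k \<in> fib x" "v (lift_vert x k) = k"
        using lift_vert[OF x] by (simp_all add: fib_iff)
      then have "g x (?e x k m) = g x (?e x k m')"
        using \<eta>[OF x m(1) y(1)] \<eta>[OF x m(2) y(1)] eq by simp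
      then show "?e x k m = ?e x k m'"
        using g[OF x] e_closed[OF x] m by (auto dest: inj_onD)
    qed
  next
    fix n assume "n \<in> \<eta> x ` carrier (?V x)"
    then show "n \<in> carrier (total M x)"
      using \<eta>_closed[OF x] by auto
  next
    fix n assume n: "n \<in> carrier (total M x)"
    interpret complex_space "?V x" by (rule V[OF x])
    let ?K = "{i. \<exists>m \<in> carrier (?V x). ?e x i m \<noteq> \<zero>\<^bsub>?V x\<^esub>}"
    define w where "w k = \<psi> (lift_vert x k) (n (lift_vert x k))" for k
    have lv: "lift_vert x k \<in> verts G" "Fv (lift_vert x k) = x" "v (lift_vert x k) = k"
      "lift_vert x k \<in> fib x" for k
      using lift_vert[OF x] by (simp_all add: fib_iff)
    have w_I: "w k \<in> carrier (I (lift_vert x k))" for k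
      unfolding w_def by (rule lin_closed[OF \<psi>_lin[OF lv(1)] direct_sum_component[OF n lv(4)]])
    have w: "w k \<in> carrier (?V x)" and ew: "?e x k (w k) = w k" for k
    proof -
      obtain m where m: "m \<in> carrier (?V x)" "w k = ?e x k m"
        using w_I[of k] by (auto simp: I_def lv)
      then show "w k \<in> carrier (?V x)" "?e x k (w k) = w k"
        using idem_idem[OF N x m(1)] e_closed[OF x m(1)] by auto
    qed
    have gw: "g x (w k) = n (lift_vert x k)" for k
      using g_\<psi>[OF lv(1) direct_sum_component[OF n lv(4)], of k] by (simp add: w_def lv)
    \<comment> \<open>The preimage of \<open>n\<close>: the sum of its components, moved back into the space at \<open>x\<close>. Indices outside
      \<open>?K\<close> contribute nothing, since there the idempotent and hence the component is zero.\<close>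
    let ?m = "finsum (?V x) w ?K"
    have m: "?m \<in> carrier (?V x)"
      using w by (intro finsum_closed) auto
    have em: "?e x j ?m = w j" for j
    proof -
      have "?e x j ?m = finsum (?V x) (\<lambda>k. ?e x j (w k)) ?K"
        using w by (intro lin_finsum[OF V[OF x] V[OF x] e_lin[OF x]]) auto
      also have "\<dots> = finsum (?V x) (\<lambda>k. if j = k then w k else \<zero>\<^bsub>?V x\<^esub>) ?K"
      proof (rule finsum_cong'[OF refl])
        fix k
        show "?e x j (w k) = (if j = k then w k else \<zero>\<^bsub>?V x\<^esub>)"
          using ew idem_orth[OF N x _ w, of j k k] by (cases "j = k") auto
      qed (use w in auto)
      also have "\<dots> = w j"
      proof (cases "j \<in> ?K")
        case True
        then show ?thesis
          using w by (intro finsum_singleton idem_finite[OF N x]) auto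
      next
        case False
        then have "w j = \<zero>\<^bsub>?V x\<^esub>"
          using ew[of j] w[of j] by auto
        moreover have "finsum (?V x) (\<lambda>k. if j = k then w k else \<zero>\<^bsub>?V x\<^esub>) ?K =
            finsum (?V x) (\<lambda>_. \<zero>\<^bsub>?V x\<^esub>) ?K"
          using calculation by (intro finsum_cong') auto
        ultimately show ?thesis by simp
      qed
      finally show ?thesis .
    qed
    have "\<eta> x ?m = n"
    proof (rule direct_sum_eqI[OF \<eta>_closed[OF x m] n])
      fix y assume y: "y \<in> fib x"
      then have "lift_vert x (v y) = y"
        using lift_vert_eq by (auto simp: fib_iff)
      then show "\<eta> x ?m y = n y"
        using gw[of "v y"] by (simp add: \<eta>[OF x m y] em)
    qed
    with m show "n \<in> \<eta> x ` carrier (?V x)" by blast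
  qed
  have "\<exists>f. cat_iso (mod_idem H) (\<rho> M) N f"
    by (rule H.idem_hom_bij_iso[OF N idem_rep_rho[OF M] \<eta>_hom]) (use \<eta>_bij in simp)
  then have "\<exists>f. cat_iso (mod_idem_deg H T) (\<rho> M) N f"
    by (simp add: mod_idem_deg_def)
  with M show ?thesis by blast
qed

text \<open>
  The paths \<open>q y\<close> are the lifts of \<open>p\<close>, one from each vertex \<open>y\<close> above \<open>s\<close>, and \<open>z y\<close> is the vertex at
  which they end. Every vertex above \<open>t\<close> is such an end. So an identity between paths holds in \<open>\<rho> M\<close>
  if and only if all its lifts hold in \<open>M\<close>.
\<close>

context
  fixes M :: "('w, 'b, 'u) rep" and s t :: 'v and z :: "'w \<Rightarrow> 'w"
  assumes M: "is_rep G M" and z: "z ` fib s = fib t"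
begin

lemma fold_rho_zero_iff:
  assumes p: "H.awalk s p t" and q: "\<And>y. y \<in> fib s \<Longrightarrow> G.awalk y (q y) (z y) \<and> map Fa (q y) = p"
  shows "(\<forall>m \<in> carrier (total M s). fold (linmap (und (\<rho> M))) p m = \<zero>\<^bsub>total M t\<^esub>) \<longleftrightarrow>
    (\<forall>y \<in> fib s. \<forall>u \<in> carrier (space M y). fold (linmap M) (q y) u = \<zero>\<^bsub>space M (z y)\<^esub>)"
proof (intro iffI ballI)
  have comp: "fold (linmap (und (\<rho> M))) p m (z y) = fold (linmap M) (q y) (m y)"
    if "y \<in> fib s" "m \<in> carrier (total M s)" for y m
    using fold_rho[OF M, of y "q y" "z y" m] q[OF that(1)] that by (simp add: fib_iff)
  {
    fix y u
    assume *: "\<forall>m \<in> carrier (total M s). fold (linmap (und (\<rho> M))) p m = \<zero>\<^bsub>total M t\<^esub>"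
      and y: "y \<in> fib s" and u: "u \<in> carrier (space M y)"
    have "z y \<in> fib t"
      using y z by blast
    with * y u show "fold (linmap M) (q y) u = \<zero>\<^bsub>space M (z y)\<^esub>"
      using comp[OF y incl_total[OF M y u]] incl_total[OF M y u] by (simp add: incl_def)
  next
    fix m
    assume *: "\<forall>y \<in> fib s. \<forall>u \<in> carrier (space M y). fold (linmap M) (q y) u = \<zero>\<^bsub>space M (z y)\<^esub>"
      and m: "m \<in> carrier (total M s)"
    interpret complex_space "total M t" by (rule total_space[OF M])
    have pm: "fold (linmap (und (\<rho> M))) p m \<in> carrier (total M t)"
      using H.fold_linmap_closed[OF rep_rho[OF M] p] m by simp
    show "fold (linmap (und (\<rho> M))) p m = \<zero>\<^bsub>total M t\<^esub>"
    proof (rule direct_sum_eqI[OF pm zero_closed])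
      fix w assume w: "w \<in> fib t"
      then obtain y where "y \<in> fib s" "w = z y"
        using z by blast
      with * w show "fold (linmap (und (\<rho> M))) p m w = \<zero>\<^bsub>total M t\<^esub> w"
        using comp[OF _ m] direct_sum_component[OF m] by simp
    qed
  }
qed

lemma fold_rho_eq_iff:
  assumes p: "H.awalk s p t" and q: "\<And>y. y \<in> fib s \<Longrightarrow> G.awalk y (q y) (z y) \<and> map Fa (q y) = p"
    and p': "H.awalk s p' t" and q': "\<And>y. y \<in> fib s \<Longrightarrow> G.awalk y (q' y) (z y) \<and> map Fa (q' y) = p'"
  shows "(\<forall>m \<in> carrier (total M s).
      fold (linmap (und (\<rho> M))) p m = fold (linmap (und (\<rho> M))) p' m) \<longleftrightarrow>
    (\<forall>y \<in> fib s. \<forall>u \<in> carrier (space M y). fold (linmap M) (q y) u = fold (linmap M) (q' y) u)"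
proof (intro iffI ballI)
  have comp: "fold (linmap (und (\<rho> M))) p m (z y) = fold (linmap M) (q y) (m y)"
    "fold (linmap (und (\<rho> M))) p' m (z y) = fold (linmap M) (q' y) (m y)"
    if "y \<in> fib s" "m \<in> carrier (total M s)" for y m
    using fold_rho[OF M, of y "q y" "z y" m] q[OF that(1)]
      fold_rho[OF M, of y "q' y" "z y" m] q'[OF that(1)] that by (simp_all add: fib_iff)
  {
    fix y u
    assume *: "\<forall>m \<in> carrier (total M s).
        fold (linmap (und (\<rho> M))) p m = fold (linmap (und (\<rho> M))) p' m"
      and y: "y \<in> fib s" and u: "u \<in> carrier (space M y)"
    with * show "fold (linmap M) (q y) u = fold (linmap M) (q' y) u"
      using comp[OF y incl_total[OF M y u]] incl_total[OF M y u] by (simp add: incl_def)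
  next
    fix m
    assume *: "\<forall>y \<in> fib s. \<forall>u \<in> carrier (space M y). fold (linmap M) (q y) u = fold (linmap M) (q' y) u"
      and m: "m \<in> carrier (total M s)"
    have pm: "fold (linmap (und (\<rho> M))) p m \<in> carrier (total M t)"
      "fold (linmap (und (\<rho> M))) p' m \<in> carrier (total M t)"
      using H.fold_linmap_closed[OF rep_rho[OF M] p] H.fold_linmap_closed[OF rep_rho[OF M] p'] m
      by simp_all
    show "fold (linmap (und (\<rho> M))) p m = fold (linmap (und (\<rho> M))) p' m"
    proof (rule direct_sum_eqI[OF pm])
      fix w assume w: "w \<in> fib t"
      then obtain y where "y \<in> fib s" "w = z y"
        using z by blast
      with * show "fold (linmap (und (\<rho> M))) p m w = fold (linmap (und (\<rho> M))) p' m w"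
        using comp[OF _ m] direct_sum_component[OF m] by simp
    qed
  }
qed

end

end

section \<open>The covering of the double quiver of type A\<close>

lemma double_A_quiver_simps:
  "verts (double_quiver (A_quiver n)) = {1..n}"
  "arcs (double_quiver (A_quiver n)) = Arc ` {1..<n} \<union> Star ` {1..<n}"
  "tail (double_quiver (A_quiver n)) (Arc i) = i" "head (double_quiver (A_quiver n)) (Arc i) = i + 1"
  "tail (double_quiver (A_quiver n)) (Star i) = i + 1" "head (double_quiver (A_quiver n)) (Star i) = i"
  by (simp_all add: double_quiver_def A_quiver_def)

lemma cover_quiver_simps:
  "verts (cover_quiver n) = {1..n} \<times> UNIV"
  "Alpha i j \<in> arcs (cover_quiver n) \<longleftrightarrow> i \<in> {1..<n}"
  "Alpha_star i j \<in> arcs (cover_quiver n) \<longleftrightarrow> i \<in> {1..<n}"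
  "tail (cover_quiver n) (Alpha i j) = (i, j)" "head (cover_quiver n) (Alpha i j) = (i + 1, j)"
  "tail (cover_quiver n) (Alpha_star i j) = (i + 1, j)" "head (cover_quiver n) (Alpha_star i j) = (i, j - 1)"
  by (auto simp: cover_quiver_def)

lemma graded_cover_A:
  assumes T: "\<forall>a \<in> arcs (A_quiver n). T (Arc a) = 0 \<and> T (Star a) = -1"
  shows "graded_cover (cover_quiver n) (double_quiver (A_quiver n)) cover_vert_map cover_arc_map
    cover_label T"
proof (rule graded_cover.intro)
  show "cover_label (head (cover_quiver n) b) = cover_label (tail (cover_quiver n) b) + T (cover_arc_map b)"
    if "b \<in> arcs (cover_quiver n)" for b
    using that T by (cases b) (auto simp: cover_quiver_simps A_quiver_def)
  show "\<exists>!y. y \<in> verts (cover_quiver n) \<and> cover_vert_map y = x \<and> cover_label y = k"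
    if "x \<in> verts (double_quiver (A_quiver n))" for x k
    using that by (intro ex1I[of _ "(x, k)"]) (auto simp: cover_quiver_simps double_A_quiver_simps)
  show "\<exists>!b. b \<in> arcs (cover_quiver n) \<and> cover_arc_map b = a \<and>
      cover_label (head (cover_quiver n) b) = k"
    if "a \<in> arcs (double_quiver (A_quiver n))" for a k
  proof (cases a)
    case (Arc i)
    show ?thesis
    proof (rule ex1I[of _ "Alpha i k"])
      fix b
      show "b \<in> arcs (cover_quiver n) \<and> cover_arc_map b = a \<and>
          cover_label (head (cover_quiver n) b) = k \<Longrightarrow> b = Alpha i k"
        using Arc by (cases b) (auto simp: cover_quiver_simps)
    qed (use that Arc in \<open>auto simp: cover_quiver_simps double_A_quiver_simps\<close>)
  next
    case (Star i)
    show ?thesis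
    proof (rule ex1I[of _ "Alpha_star i (k + 1)"])
      fix b
      show "b \<in> arcs (cover_quiver n) \<and> cover_arc_map b = a \<and>
          cover_label (head (cover_quiver n) b) = k \<Longrightarrow> b = Alpha_star i (k + 1)"
        using Star by (cases b) (auto simp: cover_quiver_simps)
    qed (use that Star in \<open>auto simp: cover_quiver_simps double_A_quiver_simps\<close>)
  qed
qed (use cover_quiver_morphism[where n = n] wf_cover_quiver wf_double_A_quiver in auto)

abbreviation up_down :: "nat \<Rightarrow> int \<Rightarrow> cover_arc list" where
  "up_down i j \<equiv> [Alpha i j, Alpha_star i j]"

abbreviation down_up :: "nat \<Rightarrow> int \<Rightarrow> cover_arc list" where
  "down_up i j \<equiv> [Alpha_star (i - 1) j, Alpha (i - 1) (j - 1)]"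

text \<open>
  The generators of \<open>J\<^sub>n\<close> are the lifts of the relations of the preprojective algebra, up to sign. At
  the vertex \<open>1\<close> and at the vertex \<open>n\<close> only one of the two paths of length two exists, in between there
  are both; for \<open>n = 1\<close> there is none.
\<close>

lemma cover_relations_iff_preproj:
  fixes T :: "nat double_arc \<Rightarrow> int"
  assumes T: "\<forall>a \<in> arcs (A_quiver n). T (Arc a) = 0 \<and> T (Star a) = -1" and "n \<ge> 1"
    and M: "is_rep (cover_quiver n) M"
  shows "(\<forall>r \<in> cover_relations n. satisfies (cover_quiver n) M r) \<longleftrightarrow>
    (\<forall>i \<in> {1..n}. satisfies (double_quiver (A_quiver n))
      (und (rho_obj (cover_quiver n) (double_quiver (A_quiver n)) cover_vert_map cover_arc_map cover_label M))
      (preproj_relation n i))"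
proof -
  interpret graded_cover "cover_quiver n" "double_quiver (A_quiver n)" cover_vert_map cover_arc_map
    cover_label T
    by (rule graded_cover_A[OF T])
  let ?G = "cover_quiver n" and ?H = "double_quiver (A_quiver n)"
  have fib: "fib i = {i} \<times> UNIV" if "i \<in> {1..n}" for i
    using that by (auto simp: fibre_def cover_quiver_simps)
  \<comment> \<open>Both paths of length two pass one starred arrow, which lowers the second index by one.\<close>
  define z :: "nat \<times> int \<Rightarrow> nat \<times> int" where "z = (\<lambda>(i, j). (i, j - 1))"
  have z: "z ` fib i = fib i" if "i \<in> {1..n}" for i
  proof -
    have "(i, j) \<in> z ` ({i} \<times> UNIV)" for j
      by (rule image_eqI[of _ _ "(i, j + 1)"]) (simp_all add: z_def)
    then show ?thesis
      unfolding fib[OF that] by (auto simp: z_def)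
  qed
  have up: "H.awalk i [Arc i, Star i] i" "G.awalk (i, j) (up_down i j) (i, j - 1)"
    if "i \<in> {1..<n}" for i j
    using that by (auto simp: H.awalk_simps G.awalk_simps cover_quiver_simps double_A_quiver_simps)
  have down: "H.awalk i [Star (i - 1), Arc (i - 1)] i" "G.awalk (i, j) (down_up i j) (i, j - 1)"
    if "i \<in> {2..n}" for i j
    using that by (auto simp: image_iff H.awalk_simps G.awalk_simps cover_quiver_simps double_A_quiver_simps)
  note N = rep_rho[OF M]
  have lowest: "satisfies ?H (und (\<rho> M)) (preproj_relation n 1) \<longleftrightarrow>
      (\<forall>j. satisfies ?G M (path_elem (1, j) (up_down 1 j)))" if n: "n \<ge> 2"
  proof -
    have i: "1 \<in> {1..<n}" "1 \<in> {1..n}"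
      using n by auto
    have "preproj_relation n 1 = (\<lambda>x. 1 * path_elem 1 [Arc 1, Star 1] x)"
      using n by (simp add: preproj_relation_def A_quiver_def fun_eq_iff)
    then have "satisfies ?H (und (\<rho> M)) (preproj_relation n 1) \<longleftrightarrow>
        (\<forall>m \<in> carrier (total M 1). fold (linmap (und (\<rho> M))) [Arc 1, Star 1] m = \<zero>\<^bsub>total M 1\<^esub>)"
      using H.satisfies_monomial_iff[OF N up(1)[OF i(1)], of 1] by simp
    also have "\<dots> \<longleftrightarrow> (\<forall>y \<in> fib 1. \<forall>u \<in> carrier (space M y).
        fold (linmap M) ((\<lambda>(i, j). up_down i j) y) u = \<zero>\<^bsub>space M (z y)\<^esub>)"
      using up[OF i(1)] by (intro fold_rho_zero_iff[OF M z[OF i(2)]]) (auto simp: fib[OF i(2), unfolded One_nat_def] z_def)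
    also have "\<dots> \<longleftrightarrow> (\<forall>j. satisfies ?G M (\<lambda>x. 1 * path_elem (1, j) (up_down 1 j) x))"
      unfolding G.satisfies_monomial_iff[OF M up(2)[OF i(1)] one_neq_zero] fib[OF i(2)]
      by (auto simp: z_def)
    finally show ?thesis by simp
  qed
  have highest: "satisfies ?H (und (\<rho> M)) (preproj_relation n n) \<longleftrightarrow>
      (\<forall>j. satisfies ?G M (path_elem (n, j) (down_up n j)))" if n: "n \<ge> 2"
  proof -
    have i: "n \<in> {2..n}" "n \<in> {1..n}"
      using n by auto
    have "preproj_relation n n = (\<lambda>x. - 1 * path_elem n [Star (n - 1), Arc (n - 1)] x)"
      using n by (auto simp: preproj_relation_def A_quiver_def fun_eq_iff)
    then have "satisfies ?H (und (\<rho> M)) (preproj_relation n n) \<longleftrightarrow>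
        (\<forall>m \<in> carrier (total M n).
          fold (linmap (und (\<rho> M))) [Star (n - 1), Arc (n - 1)] m = \<zero>\<^bsub>total M n\<^esub>)"
      using H.satisfies_monomial_iff[OF N down(1)[OF i(1)], of "- 1"] by simp
    also have "\<dots> \<longleftrightarrow> (\<forall>y \<in> fib n. \<forall>u \<in> carrier (space M y).
        fold (linmap M) ((\<lambda>(i, j). down_up i j) y) u = \<zero>\<^bsub>space M (z y)\<^esub>)"
      using down[OF i(1)] by (intro fold_rho_zero_iff[OF M z[OF i(2)]]) (auto simp: fib[OF i(2)] z_def)
    also have "\<dots> \<longleftrightarrow> (\<forall>j. satisfies ?G M (\<lambda>x. 1 * path_elem (n, j) (down_up n j) x))"
      unfolding G.satisfies_monomial_iff[OF M down(2)[OF i(1)] one_neq_zero] fib[OF i(2)]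
      by (auto simp: z_def)
    finally show ?thesis by simp
  qed
  have middle: "satisfies ?H (und (\<rho> M)) (preproj_relation n i) \<longleftrightarrow>
      (\<forall>j. satisfies ?G M (\<lambda>x. path_elem (i, j) (up_down i j) x - path_elem (i, j) (down_up i j) x))"
    if "2 \<le> i" "i \<le> n - 1" for i
  proof -
    have i: "i \<in> {1..<n}" "i \<in> {2..n}" "i \<in> {1..n}"
      using that by auto
    have "preproj_relation n i =
        (\<lambda>x. path_elem i [Arc i, Star i] x - path_elem i [Star (i - 1), Arc (i - 1)] x)"
      using that by (auto simp: preproj_relation_def A_quiver_def fun_eq_iff)
    then have "satisfies ?H (und (\<rho> M)) (preproj_relation n i) \<longleftrightarrow>
        (\<forall>m \<in> carrier (total M i). fold (linmap (und (\<rho> M))) [Arc i, Star i] m =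
          fold (linmap (und (\<rho> M))) [Star (i - 1), Arc (i - 1)] m)"
      using H.satisfies_difference_iff[OF N up(1)[OF i(1)] down(1)[OF i(2)]] by simp
    also have "\<dots> \<longleftrightarrow> (\<forall>y \<in> fib i. \<forall>u \<in> carrier (space M y).
        fold (linmap M) ((\<lambda>(i, j). up_down i j) y) u = fold (linmap M) ((\<lambda>(i, j). down_up i j) y) u)"
      using up[OF i(1)] down[OF i(2)]
      by (intro fold_rho_eq_iff[OF M z[OF i(3)]]) (auto simp: fib[OF i(3)] z_def)
    also have "\<dots> \<longleftrightarrow>
        (\<forall>j. satisfies ?G M (\<lambda>x. path_elem (i, j) (up_down i j) x - path_elem (i, j) (down_up i j) x))"
      using G.satisfies_difference_iff[OF M up(2)[OF i(1)] down(2)[OF i(2)]]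
      unfolding fib[OF i(3)] by auto
    finally show ?thesis .
  qed
  show ?thesis
  proof (cases "n = 1")
    case True
    have "preproj_relation n i = (\<lambda>_. 0)" if "i \<in> {1..n}" for i
      using that True by (auto simp: preproj_relation_def A_quiver_def)
    moreover have "satisfies ?H (und (\<rho> M)) (\<lambda>_. 0)"
      using H.path_eval_zero_coeffs[OF N, of _ _ _ "\<lambda>_. 0"] by (simp add: satisfies_def)
    moreover have "cover_relations n = {}"
      using True by (auto simp: cover_relations_def)
    ultimately show ?thesis by simp
  next
    case False
    with \<open>n \<ge> 1\<close> have n: "n \<ge> 2" by simp
    then have "{1..n} = {1} \<union> {n} \<union> {i. 2 \<le> i \<and> i \<le> n - 1}"
      by auto
    then have "(\<forall>i \<in> {1..n}. satisfies ?H (und (\<rho> M)) (preproj_relation n i)) \<longleftrightarrow>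
        satisfies ?H (und (\<rho> M)) (preproj_relation n 1) \<and>
        satisfies ?H (und (\<rho> M)) (preproj_relation n n) \<and>
        (\<forall>i. 2 \<le> i \<and> i \<le> n - 1 \<longrightarrow> satisfies ?H (und (\<rho> M)) (preproj_relation n i))"
      by auto
    also have "\<dots> \<longleftrightarrow> (\<forall>j. satisfies ?G M (path_elem (1, j) (up_down 1 j))) \<and>
        (\<forall>j. satisfies ?G M (path_elem (n, j) (down_up n j))) \<and>
        (\<forall>i. 2 \<le> i \<and> i \<le> n - 1 \<longrightarrow> (\<forall>j. satisfies ?G M
          (\<lambda>x. path_elem (i, j) (up_down i j) x - path_elem (i, j) (down_up i j) x)))"
      using lowest[OF n] highest[OF n] middle by blast
    also have "\<dots> \<longleftrightarrow> (\<forall>r \<in> cover_relations n. satisfies ?G M r)"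
      unfolding cover_relations_def using n by blast
    finally show ?thesis by simp
  qed
qed

theorem proposition10p1:
  fixes n :: nat and T :: "nat double_arc \<Rightarrow> int" and \<iota> :: "complex \<Rightarrow> 'u"
  assumes "n \<ge> 1"
    and "\<forall>a \<in> arcs (A_quiver n). T (Arc a) = 0 \<and> T (Star a) = -1"
    and "inj \<iota>"
  shows "cat_equivalence
    (mod_quotient (cover_quiver n) (cover_ideal n)
      :: ((nat \<times> int, cover_arc, 'u) rep, nat \<times> int \<Rightarrow> 'u \<Rightarrow> 'u) category)
    (mod_idem_preproj n T)
    (cover_rho n)"
proof -
  interpret graded_cover "cover_quiver n" "double_quiver (A_quiver n)" cover_vert_map cover_arc_map
    cover_label T
    by (rule graded_cover_A[OF assms(2)])
  show ?thesis
    unfolding mod_quotient_def mod_idem_preproj_def cover_rho_def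
  proof (rule equivalence_of_full_subcategories[OF rho_functor])
    fix M N :: "(nat \<times> int, cover_arc, 'u) rep"
    assume "M \<in> Obj (rep_category (cover_quiver n))" "N \<in> Obj (rep_category (cover_quiver n))"
    then show "bij_betw (on_arr \<R> M N) (Hom (rep_category (cover_quiver n)) M N)
        (Hom (mod_idem_deg (double_quiver (A_quiver n)) T) (on_obj \<R> M) (on_obj \<R> N))"
      using rho_fully_faithful[of M N]
      by (simp add: rep_category_simps mod_idem_deg_simps)
  next
    fix N :: "(nat, nat double_arc, nat \<times> int \<Rightarrow> 'u) idem_rep"
    assume "N \<in> Obj (mod_idem_deg (double_quiver (A_quiver n)) T)"
    then show "\<exists>M \<in> Obj (rep_category (cover_quiver n)).
        \<exists>f. cat_iso (mod_idem_deg (double_quiver (A_quiver n)) T) (on_obj \<R> M) N f"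
      using rho_essentially_surjective[OF assms(3)] by (simp add: Bex_def rep_category_simps)
  next
    fix M :: "(nat \<times> int, cover_arc, 'u) rep"
    assume "M \<in> Obj (rep_category (cover_quiver n))"
    then have M: "is_rep (cover_quiver n) M"
      by (simp add: rep_category_simps)
    show "(\<forall>r \<in> cover_ideal n. satisfies (cover_quiver n) M r) \<longleftrightarrow>
        (\<forall>i \<in> {1..n}. satisfies (double_quiver (A_quiver n)) (und (on_obj \<R> M)) (preproj_relation n i))"
      unfolding cover_ideal_def G.satisfies_path_ideal_iff[OF M cover_relations_subset]
      using cover_relations_iff_preproj[OF assms(2,1) M] by simp
  next
    fix N N' :: "(nat, nat double_arc, nat \<times> int \<Rightarrow> 'u) idem_rep" and f
    assume N: "N \<in> Obj (mod_idem_deg (double_quiver (A_quiver n)) T)"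
      "N' \<in> Obj (mod_idem_deg (double_quiver (A_quiver n)) T)"
      and "cat_iso (mod_idem_deg (double_quiver (A_quiver n)) T) N N' f"
      and sat: "\<forall>i \<in> {1..n}. satisfies (double_quiver (A_quiver n)) (und N') (preproj_relation n i)"
    then obtain g where f: "f \<in> idem_hom (double_quiver (A_quiver n)) N N'"
      and g: "g \<in> idem_hom (double_quiver (A_quiver n)) N' N"
      and gf: "rep_comp (double_quiver (A_quiver n)) (und N) g f =
        rep_id (double_quiver (A_quiver n)) (und N)"
      by (auto simp: cat_iso_def mod_idem_deg_simps)
    have R: "is_rep (double_quiver (A_quiver n)) (und N)" "is_rep (double_quiver (A_quiver n)) (und N')"
      using N by (auto simp: mod_idem_deg_simps idem_rep)
    have "g x (f x m) = m"
      if "x \<in> verts (double_quiver (A_quiver n))" "m \<in> carrier (space (und N) x)" for x m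
      using fun_cong[OF fun_cong[OF gf], of x m] that by (simp add: rep_comp_def rep_id_def compose_def)
    then show "\<forall>i \<in> {1..n}. satisfies (double_quiver (A_quiver n)) (und N) (preproj_relation n i)"
      using sat H.satisfies_iso[OF R(2,1) idem_homD(1)[OF g] _ idem_homD(1)[OF f]] by blast
  qed
qed

end
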